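(* Let $(M,\omega)$ be a compact Hermitian manifold of complex dimension $n\ge 2$ with Hermitian metric $g$, and assume that either (a) $n=2$; or (b) $n>2$ and $d(\omega^{n-1})=0$. For every sequence $(K_m)_{m\ge 0}$ of positive real numbers there exist constants $C$ and $A$, depending only on $(M,g)$ and $(K_m)_{m\ge 0}$, such that the following holds. Let $F$ be a smooth real-valued function on $M$ with $\|F\|_{C^m(M)}\le K_m$ for all $m\ge 0$, and let $\varphi$ be a smooth real-valued function on $M$ satisfying $$(\omega+\sqrt{-1}\,\partial\overline{\partial}\varphi)^n=e^F\omega^n,\qquad \omega+\sqrt{-1}\,\partial\overline{\partial}\varphi>0,\qquad \sup_M\varphi=0.$$ Let $g'$ be the Hermitian metric $g'_{i\overline{j}}=g_{i\overline{j}}+\partial_i\partial_{\overline{j}}\varphi$. Then, at every point of $M$, $$\mathrm{tr}_g\,g'\le C\,e^{A(\varphi-\inf_M\varphi)}.$$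
   Context: A Hermitian metric $g$ is identified with its positive real $(1,1)$-form $\omega=\sqrt{-1}\sum_{i,j}g_{i\overline{j}}\,dz^i\wedge d\overline{z^j}$; no Kähler condition is assumed. The trace is $\mathrm{tr}_g\,g'=g^{i\overline{j}}g'_{i\overline{j}}$ (summed over $i,j$), where $(g^{i\overline{j}})$ is the inverse of $(g_{i\overline{j}})$. The norms $\|\cdot\|_{C^m(M)}$ are the usual $C^m$ norms with respect to the fixed metric $g$. *)

theory Defs
  imports "HOL-Analysis.Analysis" "HOL-Combinatorics.Permutations"
begin

section \<open>Calculus in coordinates\<close>

text \<open>The next two notions are used on open sets \<open>S\<close> only.\<close>

primrec Ck_on :: "nat \<Rightarrow> ('v::real_normed_vector \<Rightarrow> 'w::real_normed_vector) \<Rightarrow> 'v set \<Rightarrow> bool" where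
  "Ck_on 0 f S \<longleftrightarrow> continuous_on S f"
| "Ck_on (Suc k) f S \<longleftrightarrow> (\<forall>x\<in>S. f differentiable (at x)) \<and>
     (\<forall>v. Ck_on k (\<lambda>x. frechet_derivative f (at x) v) S)"

definition smooth_on :: "('v::real_normed_vector \<Rightarrow> 'w::real_normed_vector) \<Rightarrow> 'v set \<Rightarrow> bool" where
  "smooth_on f S \<longleftrightarrow> (\<forall>k. Ck_on k f S)"

definition holomorphic_map_on :: "(complex^'n \<Rightarrow> complex^'m) \<Rightarrow> (complex^'n) set \<Rightarrow> bool" where
  "holomorphic_map_on f S \<longleftrightarrow>
     (\<forall>z\<in>S. \<exists>D. (f has_derivative D) (at z) \<and> (\<forall>c v. D (c *s v) = c *s D v))"

definition wirt :: "'n \<Rightarrow> (complex^'n \<Rightarrow> complex) \<Rightarrow> complex^'n \<Rightarrow> complex" where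
  "wirt i f z =
     (frechet_derivative f (at z) (axis i 1) - \<i> * frechet_derivative f (at z) (axis i \<i>)) / 2"

definition wirtbar :: "'n \<Rightarrow> (complex^'n \<Rightarrow> complex) \<Rightarrow> complex^'n \<Rightarrow> complex" where
  "wirtbar i f z =
     (frechet_derivative f (at z) (axis i 1) + \<i> * frechet_derivative f (at z) (axis i \<i>)) / 2"

definition complex_hessian :: "(complex^'n \<Rightarrow> real) \<Rightarrow> complex^'n \<Rightarrow> complex^'n^'n" where
  "complex_hessian f z = (\<chi> i j. wirt i (wirtbar j (\<lambda>w. complex_of_real (f w))) z)"

section \<open>Differential forms in coordinates\<close>

text \<open>A complex-valued \<open>k\<close>-form at a point is an alternating, real-multilinear function of the
  vectors \<open>v 0, \<dots>, v (k - 1)\<close>; the other entries of \<open>v\<close> are ignored. A form field is a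
  function of the point and of \<open>v\<close>. Degrees are passed explicitly.\<close>

type_synonym 'n form = "(nat \<Rightarrow> complex^'n) \<Rightarrow> complex"

definition wedge :: "nat \<Rightarrow> nat \<Rightarrow> 'n form \<Rightarrow> 'n form \<Rightarrow> 'n form" where
  "wedge p q \<alpha> \<beta> = (\<lambda>v.
     (\<Sum>\<sigma> | \<sigma> permutes {..<p + q}.
        of_int (sign \<sigma>) * \<alpha> (\<lambda>i. v (\<sigma> i)) * \<beta> (\<lambda>i. v (\<sigma> (p + i)))) / (fact p * fact q))"

text \<open>Here \<open>\<alpha>\<close> must be a 2-form.\<close>

primrec wedge_power :: "nat \<Rightarrow> 'n form \<Rightarrow> 'n form" where
  "wedge_power 0 \<alpha> = (\<lambda>v. 1)"
| "wedge_power (Suc k) \<alpha> = wedge 2 (2 * k) \<alpha> (wedge_power k \<alpha>)"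

text \<open>The invariant formula for the exterior derivative, on constant vector fields, for which
  the bracket terms vanish.\<close>

definition ext_deriv :: "nat \<Rightarrow> (complex^'n \<Rightarrow> 'n form) \<Rightarrow> complex^'n \<Rightarrow> 'n form" where
  "ext_deriv k \<alpha> z = (\<lambda>v. \<Sum>i\<le>k. (-1) ^ i *
     frechet_derivative (\<lambda>w. \<alpha> w (\<lambda>j. if j < i then v j else v (Suc j))) (at z) (v i))"

definition dz :: "'n::finite \<Rightarrow> 'n form" where
  "dz i = (\<lambda>v. v 0 $ i)"

definition dzbar :: "'n::finite \<Rightarrow> 'n form" where
  "dzbar i = (\<lambda>v. cnj (v 0 $ i))"

definition form11 :: "complex^'n^'n \<Rightarrow> 'n form" where
  "form11 G = (\<lambda>v. \<i> * (\<Sum>i\<in>UNIV. \<Sum>j\<in>UNIV. G $ i $ j * wedge 1 1 (dz i) (dzbar j) v))"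

section \<open>Hermitian matrices\<close>

definition herm_prod :: "complex^'n^'n \<Rightarrow> complex^'n \<Rightarrow> complex^'n \<Rightarrow> complex" where
  "herm_prod G u v = (\<Sum>i\<in>UNIV. \<Sum>j\<in>UNIV. G $ i $ j * u $ i * cnj (v $ j))"

definition hermitian_pos_def :: "complex^'n^'n \<Rightarrow> bool" where
  "hermitian_pos_def G \<longleftrightarrow>
     (\<forall>i j. G $ i $ j = cnj (G $ j $ i)) \<and> (\<forall>v. v \<noteq> 0 \<longrightarrow> 0 < Re (herm_prod G v v))"

text \<open>The inverse \<open>g\<^sup>i\<^sup>j\<close> (with \<open>j\<close> barred) is normalised by summing the barred indices,
  \<open>g\<^sup>i\<^sup>j g\<^sub>k\<^sub>j = \<delta>\<close>, so it is the \<open>(j, i)\<close> entry of the inverse matrix.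
  The trace is real when both matrices are Hermitian.\<close>

definition herm_trace :: "complex^'n^'n \<Rightarrow> complex^'n^'n \<Rightarrow> real" where
  "herm_trace G G' = Re (\<Sum>i\<in>UNIV. \<Sum>j\<in>UNIV. matrix_inv G $ j $ i * G' $ i $ j)"

section \<open>Complex manifolds and Hermitian metrics\<close>

type_synonym ('a, 'n) chart = "'a set \<times> ('a \<Rightarrow> complex^'n)"

definition chart_image :: "('a, 'n::finite) chart \<Rightarrow> (complex^'n) set" where
  "chart_image \<kappa> = snd \<kappa> ` fst \<kappa>"

definition chart_inv :: "('a, 'n::finite) chart \<Rightarrow> complex^'n \<Rightarrow> 'a" where
  "chart_inv \<kappa> = inv_into (fst \<kappa>) (snd \<kappa>)"

definition transition :: "('a, 'n::finite) chart \<Rightarrow> ('a, 'n) chart \<Rightarrow> complex^'n \<Rightarrow> complex^'n" where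
  "transition \<kappa> \<mu> = snd \<mu> \<circ> chart_inv \<kappa>"

definition complex_manifold :: "'a topology \<Rightarrow> ('a, 'n::finite) chart set \<Rightarrow> bool" where
  "complex_manifold X \<A> \<longleftrightarrow>
     Hausdorff_space X \<and> second_countable X \<and>
     \<Union> (fst ` \<A>) = topspace X \<and>
     (\<forall>\<kappa>\<in>\<A>. openin X (fst \<kappa>) \<and> open (chart_image \<kappa>) \<and>
        homeomorphic_map (subtopology X (fst \<kappa>)) (top_of_set (chart_image \<kappa>)) (snd \<kappa>)) \<and>
     (\<forall>\<kappa>\<in>\<A>. \<forall>\<mu>\<in>\<A>. holomorphic_map_on (transition \<kappa> \<mu>) (snd \<kappa> ` (fst \<kappa> \<inter> fst \<mu>)))"

definition smooth_function :: "('a, 'n::finite) chart set \<Rightarrow> ('a \<Rightarrow> real) \<Rightarrow> bool" where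
  "smooth_function \<A> f \<longleftrightarrow> (\<forall>\<kappa>\<in>\<A>. smooth_on (f \<circ> chart_inv \<kappa>) (chart_image \<kappa>))"

text \<open>A metric is given by its component matrices: \<open>g \<kappa> z $ i $ j\<close> is the component with
  indices \<open>i\<close> and \<open>j\<close> barred in the chart \<open>\<kappa>\<close> at the point with coordinates \<open>z\<close>.\<close>

type_synonym ('a, 'n) metric = "('a, 'n) chart \<Rightarrow> complex^'n \<Rightarrow> complex^'n^'n"

definition hermitian_metric :: "('a, 'n::finite) chart set \<Rightarrow> ('a, 'n) metric \<Rightarrow> bool" where
  "hermitian_metric \<A> g \<longleftrightarrow>
     (\<forall>\<kappa>\<in>\<A>. smooth_on (g \<kappa>) (chart_image \<kappa>) \<and>
        (\<forall>z\<in>chart_image \<kappa>. hermitian_pos_def (g \<kappa> z))) \<and>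
     (\<forall>\<kappa>\<in>\<A>. \<forall>\<mu>\<in>\<A>. \<forall>z\<in>snd \<kappa> ` (fst \<kappa> \<inter> fst \<mu>). \<forall>i j.
        g \<kappa> z $ i $ j =
          (\<Sum>k\<in>UNIV. \<Sum>l\<in>UNIV. g \<mu> (transition \<kappa> \<mu> z) $ k $ l *
             wirt i (\<lambda>w. transition \<kappa> \<mu> w $ k) z * cnj (wirt j (\<lambda>w. transition \<kappa> \<mu> w $ l) z)))"

definition perturbed_metric :: "('a, 'n::finite) metric \<Rightarrow> ('a \<Rightarrow> real) \<Rightarrow> ('a, 'n) metric" where
  "perturbed_metric g \<phi> \<kappa> z = g \<kappa> z + complex_hessian (\<phi> \<circ> chart_inv \<kappa>) z"

text \<open>\<open>fundamental_form g\<close> is \<open>\<omega>\<close>; \<open>fundamental_form (perturbed_metric g \<phi>)\<close> is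
  \<open>\<omega> + \<i> \<partial> \<partial>bar \<phi>\<close>, because \<open>\<i> \<partial> \<partial>bar \<phi>\<close> is the (1,1)-form of the complex Hessian.\<close>

definition fundamental_form :: "('a, 'n::finite) metric \<Rightarrow> ('a, 'n) chart \<Rightarrow> complex^'n \<Rightarrow> 'n form" where
  "fundamental_form g \<kappa> z = form11 (g \<kappa> z)"

definition balanced :: "('a, 'n::finite) chart set \<Rightarrow> ('a, 'n) metric \<Rightarrow> bool" where
  "balanced \<A> g \<longleftrightarrow>
     (\<forall>\<kappa>\<in>\<A>. \<forall>z\<in>chart_image \<kappa>. \<forall>v.
        ext_deriv (2 * (CARD('n) - 1))
          (\<lambda>w. wedge_power (CARD('n) - 1) (fundamental_form g \<kappa> w)) z v = 0)"

definition monge_ampere ::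
    "('a, 'n::finite) chart set \<Rightarrow> ('a, 'n) metric \<Rightarrow> ('a \<Rightarrow> real) \<Rightarrow> ('a \<Rightarrow> real) \<Rightarrow> bool" where
  "monge_ampere \<A> g F \<phi> \<longleftrightarrow>
     (\<forall>\<kappa>\<in>\<A>. \<forall>z\<in>chart_image \<kappa>. \<forall>v.
        wedge_power CARD('n) (fundamental_form (perturbed_metric g \<phi>) \<kappa> z) v =
        complex_of_real (exp (F (chart_inv \<kappa> z))) *
          wedge_power CARD('n) (fundamental_form g \<kappa> z) v)"

section \<open>\<open>C\<^sup>m\<close> norms of functions with respect to a metric\<close>

text \<open>The underlying Riemannian metric \<open>\<omega> (u, J v)\<close> in a chart.\<close>

definition riem :: "('a, 'n::finite) metric \<Rightarrow> ('a, 'n) chart \<Rightarrow> complex^'n \<Rightarrow> complex^'n \<Rightarrow> complex^'n \<Rightarrow> real"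
  where "riem g \<kappa> z u v = 2 * Re (herm_prod (g \<kappa> z) u v)"

text \<open>The Levi-Civita derivative in direction \<open>u\<close> of the constant vector field \<open>v\<close>,
  determined by the Koszul formula.\<close>

definition christoffel :: "('v::real_normed_vector \<Rightarrow> 'v \<Rightarrow> 'v \<Rightarrow> real) \<Rightarrow> 'v \<Rightarrow> 'v \<Rightarrow> 'v \<Rightarrow> 'v" where
  "christoffel h z u v = (THE w. \<forall>y. 2 * h z w y =
       frechet_derivative (\<lambda>x. h x v y) (at z) u
     + frechet_derivative (\<lambda>x. h x u y) (at z) v
     - frechet_derivative (\<lambda>x. h x u v) (at z) y)"

text \<open>The iterated Levi-Civita covariant derivative: \<open>cov_deriv h f [v\<^sub>1, \<dots>, v\<^sub>k] z\<close> is the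
  covariant \<open>k\<close>-tensor \<open>\<nabla>\<^sup>k f\<close> at \<open>z\<close> evaluated on \<open>v\<^sub>1, \<dots>, v\<^sub>k\<close>, where \<open>v\<^sub>1\<close> is the
  direction of the last differentiation.\<close>

fun cov_deriv :: "('v::real_normed_vector \<Rightarrow> 'v \<Rightarrow> 'v \<Rightarrow> real) \<Rightarrow> ('v \<Rightarrow> real) \<Rightarrow> 'v list \<Rightarrow> 'v \<Rightarrow> real"
  where
  "cov_deriv h f [] z = f z"
| "cov_deriv h f (v # vs) z =
     frechet_derivative (\<lambda>x. cov_deriv h f vs x) (at z) v
     - (\<Sum>i<length vs. cov_deriv h f (vs[i := christoffel h z v (vs ! i)]) z)"

definition orthonormal_frame :: "('v::real_vector \<Rightarrow> 'v \<Rightarrow> real) \<Rightarrow> 'v set \<Rightarrow> bool" where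
  "orthonormal_frame h B \<longleftrightarrow> finite B \<and> span B = UNIV \<and>
     (\<forall>u\<in>B. \<forall>v\<in>B. h u v = (if u = v then 1 else 0))"

text \<open>The norm of a covariant \<open>k\<close>-tensor at a point. The sum does not depend on the frame, so
  the supremum is over a single value; similarly the supremum over all charts in \<open>cm_norm\<close>
  only ensures that each point of the manifold is covered. With values in
  \<^typ>\<open>ennreal\<close> no boundedness is presupposed.\<close>

definition tensor_norm :: "('v::real_vector \<Rightarrow> 'v \<Rightarrow> real) \<Rightarrow> nat \<Rightarrow> ('v list \<Rightarrow> real) \<Rightarrow> ennreal" where
  "tensor_norm h k T = (SUP B\<in>{B. orthonormal_frame h B}.
     ennreal (sqrt (\<Sum>vs | set vs \<subseteq> B \<and> length vs = k. (T vs)\<^sup>2)))"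

definition cm_norm :: "('a, 'n::finite) chart set \<Rightarrow> ('a, 'n) metric \<Rightarrow> nat \<Rightarrow> ('a \<Rightarrow> real) \<Rightarrow> ennreal" where
  "cm_norm \<A> g m f = (\<Sum>k\<le>m. SUP \<kappa>\<in>\<A>. SUP z\<in>chart_image \<kappa>.
     tensor_norm (riem g \<kappa> z) k (\<lambda>vs. cov_deriv (riem g \<kappa>) (f \<circ> chart_inv \<kappa>) vs z))"

end

theory Submission
  imports Defs "HOL-Complex_Analysis.Cauchy_Integral_Formula" "HOL-Real_Asymp.Real_Asymp"
begin

text \<open>Let \<open>u = tr\<^sub>g g'\<close>, let \<open>m = inf \<phi>\<close> and let \<open>L\<close> be the complex Laplacian of \<open>g'\<close>. At a point
  choose a frame in which \<open>g\<close> is the identity and \<open>g'\<close> is diagonal. Differentiating the logarithm of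
  the equation twice and completing the square in the third derivatives of \<open>\<phi>\<close> gives
  \<open>L log u \<ge> (2 / u\<^sup>2) Re \<langle>\<partial>u, \<tau>\<rangle> - C tr\<^sub>g\<^sub>' g\<close> wherever \<open>u \<ge> 1\<close>, with a torsion term \<open>\<tau>\<close>
  bounded in terms of \<open>g\<close>. Apply the maximum principle to \<open>log u - A \<phi> + 1 / (\<phi> - m + 1)\<close> (a trick of
  Phong and Sturm): at a maximum \<open>\<partial>u\<close> is a multiple of \<open>\<partial>\<phi>\<close>, and the Hessian of the last summand
  yields \<open>2 |\<partial>\<phi>|\<^sup>2 / (\<phi> - m + 1)\<^sup>3\<close>, which absorbs the torsion term unless
  \<open>u < (A + 1) (\<phi> - m + 1) powr (3 / 2)\<close>. In the first case \<open>tr\<^sub>g\<^sub>' g\<close>, hence by the equation \<open>u\<close>, is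
  bounded at the maximum; in the second case \<open>u\<close> is at most \<open>(A + 1) exp (A (\<phi> - m))\<close> there.\<close>

section \<open>Smooth functions and Wirtinger derivatives\<close>

text \<open>In the Kaehler case the third-order terms complete to a square with no remainder linear
  in \<open>\<partial>u\<close>, and the maximum principle for \<open>log u - A \<phi>\<close>
  suffices. Torsion adds a term linear in \<open>\<partial>u\<close>. Nothing is known about
  \<open>\<partial>u\<close> beforehand, so it cannot be estimated by the trace of g with respect to
  g'; only at a maximum is it tied to \<open>\<partial>\<phi>\<close>, and then a strictly convex
  function of \<phi> is needed to produce a good square. The summand
  \<open>1 / (\<phi> - m + 1)\<close> takes values in (0, 1], so it costs at most a factor e in the
  final constant, and its derivative in \<phi> lies in [-1, 0), so the effective coefficient of
  \<phi> stays between A and A + 1. All local computations use constant vectors in one chart that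
  are unitary for g at a single point; no adapted coordinates are chosen. The price is that
  derivatives of g must be bounded in every unitary frame at every point, since the frame that
  diagonalises g' depends on the unknown \<phi>. Compactness supplies these bounds before F and
  \<phi> are fixed, and this is what makes C and A uniform.\<close>

definition dd :: "'v::real_normed_vector \<Rightarrow> ('v \<Rightarrow> 'w::real_normed_vector) \<Rightarrow> 'v \<Rightarrow> 'w" where
  "dd v f z = frechet_derivative f (at z) v"

lemma dd_eq: "(f has_derivative f') (at z) \<Longrightarrow> dd v f z = f' v"
  unfolding dd_def by (metis frechet_derivative_at)

lemma has_derivative_dd: "f differentiable at z \<Longrightarrow> (f has_derivative (\<lambda>v. dd v f z)) (at z)"
  unfolding dd_def by (simp add: frechet_derivative_works)

lemma dd_cong_open:
  assumes "open S" "z \<in> S" "\<And>x. x \<in> S \<Longrightarrow> f x = g x"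
  shows "dd v f z = dd v g z"
proof -
  have "(f has_derivative D) (at z) = (g has_derivative D) (at z)" for D
    using has_derivative_transform_within_open[of f D z UNIV S g]
      has_derivative_transform_within_open[of g D z UNIV S f] assms by auto
  then show ?thesis by (simp add: dd_def frechet_derivative_def)
qed

lemma differentiable_cong_open:
  assumes "open S" "z \<in> S" "\<And>x. x \<in> S \<Longrightarrow> f x = g x" "f differentiable at z"
  shows "g differentiable at z"
  using assms has_derivative_transform_within_open[of f _ z UNIV S g]
  unfolding differentiable_def by blast

lemma linear_dd: "f differentiable at z \<Longrightarrow> linear (\<lambda>v. dd v f z)"
  by (drule has_derivative_dd) (rule has_derivative_linear)

lemma dd_add_dir: "f differentiable at z \<Longrightarrow> dd (a + b) f z = dd a f z + dd b f z"
  and dd_scaleR_dir: "f differentiable at z \<Longrightarrow> dd (r *\<^sub>R a) f z = r *\<^sub>R dd a f z"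
  and dd_zero_dir: "f differentiable at z \<Longrightarrow> dd 0 f z = 0"
  using linear_add[OF linear_dd, of f z] linear_scale[OF linear_dd, of f z] linear_0[OF linear_dd, of f z]
  by simp_all

lemma dd_Basis:
  fixes f :: "'v::euclidean_space \<Rightarrow> 'w::real_normed_vector"
  assumes "f differentiable at z"
  shows "dd u f z = (\<Sum>e\<in>Basis. (u \<bullet> e) *\<^sub>R dd e f z)"
proof -
  have "dd (\<Sum>e\<in>Basis. (u \<bullet> e) *\<^sub>R e) f z = (\<Sum>e\<in>Basis. dd ((u \<bullet> e) *\<^sub>R e) f z)"
    using linear_sum[OF linear_dd[OF assms]] by blast
  then show ?thesis by (simp add: euclidean_representation dd_scaleR_dir[OF assms])
qed

lemma dd_add:
  "f differentiable at z \<Longrightarrow> g differentiable at z \<Longrightarrow> dd v (\<lambda>x. f x + g x) z = dd v f z + dd v g z"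
  by (rule dd_eq) (intro has_derivative_add has_derivative_dd)

lemma dd_bounded_linear:
  "bounded_linear L \<Longrightarrow> f differentiable at z \<Longrightarrow> dd v (\<lambda>x. L (f x)) z = L (dd v f z)"
  by (rule dd_eq[OF bounded_linear.has_derivative[OF _ has_derivative_dd]])

lemma dd_mult:
  fixes f g :: "_ \<Rightarrow> 'b::real_normed_algebra"
  shows "f differentiable at z \<Longrightarrow> g differentiable at z
    \<Longrightarrow> dd v (\<lambda>x. f x * g x) z = dd v f z * g z + f z * dd v g z"
  by (subst dd_eq[OF has_derivative_mult[OF has_derivative_dd has_derivative_dd]]) auto

lemma dd_const [simp]: "dd v (\<lambda>x. c) z = 0"
  by (simp add: dd_def)

section \<open>Closure properties of smooth functions\<close>

lemma Ck_on_cong: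
  assumes "open S" "\<And>x. x \<in> S \<Longrightarrow> f x = g x"
  shows "Ck_on k f S \<longleftrightarrow> Ck_on k g S"
  using assms
proof (induction k arbitrary: f g)
  case 0
  then show ?case by (auto cong: continuous_on_cong)
next
  case (Suc k)
  have "Ck_on k (\<lambda>x. frechet_derivative f (at x) v) S = Ck_on k (\<lambda>x. frechet_derivative g (at x) v) S" for v
    using Suc.prems by (intro Suc.IH) (auto simp flip: dd_def intro!: dd_cong_open)
  moreover have "f differentiable at x \<longleftrightarrow> g differentiable at x" if "x \<in> S" for x
    using Suc.prems that differentiable_cong_open[of S x f g] differentiable_cong_open[of S x g f] by auto
  ultimately show ?case by simp
qed

lemma differentiable_bounded_linear:
  "bounded_linear L \<Longrightarrow> f differentiable at z \<Longrightarrow> (\<lambda>x. L (f x)) differentiable at z"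
  by (rule differentiableI[OF bounded_linear.has_derivative[OF _ has_derivative_dd]])

lemma Ck_on_bounded_linear:
  assumes "open S" and L: "bounded_linear L" and "Ck_on k f S"
  shows "Ck_on k (\<lambda>x. L (f x)) S"
  using assms(3)
proof (induction k arbitrary: f)
  case 0
  then show ?case using bounded_linear.continuous_on[OF L] by simp
next
  case (Suc k)
  have d: "f differentiable at x" if "x \<in> S" for x
    using Suc.prems that by auto
  have "Ck_on k (\<lambda>x. L (dd v f x)) S" for v
    using Suc.prems by (intro Suc.IH) (simp add: dd_def)
  then have "Ck_on k (\<lambda>x. dd v (\<lambda>x. L (f x)) x) S" for v
    using Ck_on_cong[OF assms(1), of "\<lambda>x. dd v (\<lambda>x. L (f x)) x" "\<lambda>x. L (dd v f x)"]
      dd_bounded_linear[OF L d] by simp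
  then show ?case using differentiable_bounded_linear[OF L d] by (simp add: dd_def)
qed

lemma Ck_on_add:
  assumes "open S" "Ck_on k f S" "Ck_on k g S"
  shows "Ck_on k (\<lambda>x. f x + g x) S"
  using assms(2,3)
proof (induction k arbitrary: f g)
  case 0
  then show ?case by (auto intro!: continuous_on_add)
next
  case (Suc k)
  have d: "f differentiable at x" "g differentiable at x" if "x \<in> S" for x
    using Suc.prems that by auto
  have "Ck_on k (\<lambda>x. dd v f x + dd v g x) S" for v
    using Suc.prems by (intro Suc.IH) (simp_all add: dd_def)
  then have "Ck_on k (\<lambda>x. dd v (\<lambda>x. f x + g x) x) S" for v
    using Ck_on_cong[OF assms(1), of "\<lambda>x. dd v (\<lambda>x. f x + g x) x" "\<lambda>x. dd v f x + dd v g x"]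
      dd_add[OF d] by simp
  then show ?case using differentiable_add[OF d] by (simp add: dd_def)
qed

lemma Ck_on_const [simp]: "Ck_on k (\<lambda>x. c) S"
  by (induction k arbitrary: c) auto

lemma smooth_on_bounded_linear:
  "open S \<Longrightarrow> bounded_linear L \<Longrightarrow> smooth_on f S \<Longrightarrow> smooth_on (\<lambda>x. L (f x)) S"
  unfolding smooth_on_def using Ck_on_bounded_linear by blast

lemma smooth_on_add: "open S \<Longrightarrow> smooth_on f S \<Longrightarrow> smooth_on g S \<Longrightarrow> smooth_on (\<lambda>x. f x + g x) S"
  unfolding smooth_on_def using Ck_on_add by blast

lemma smooth_on_const [simp]: "smooth_on (\<lambda>x. c) S"
  by (simp add: smooth_on_def)

lemma smooth_on_sum:
  "open S \<Longrightarrow> (\<And>i. i \<in> I \<Longrightarrow> smooth_on (f i) S) \<Longrightarrow> smooth_on (\<lambda>x. \<Sum>i\<in>I. f i x) S"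
  by (induction I rule: infinite_finite_induct) (auto intro!: smooth_on_add)

lemma smooth_on_dd: "smooth_on f S \<Longrightarrow> smooth_on (dd v f) S"
  unfolding smooth_on_def dd_def[abs_def] by (metis Ck_on.simps(2))

lemma smooth_on_differentiable: "smooth_on f S \<Longrightarrow> z \<in> S \<Longrightarrow> f differentiable at z"
  unfolding smooth_on_def by (metis Ck_on.simps(2))

lemma smooth_on_continuous: "smooth_on f S \<Longrightarrow> continuous_on S f"
  unfolding smooth_on_def by (metis Ck_on.simps(1))

lemma smooth_on_cmult:
  fixes f :: "_ \<Rightarrow> complex"
  shows "open S \<Longrightarrow> smooth_on f S \<Longrightarrow> smooth_on (\<lambda>x. c * f x) S"
  by (rule smooth_on_bounded_linear[OF _ bounded_linear_mult_right])

section \<open>Symmetry of second derivatives\<close>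

lemma has_real_derivative_line:
  fixes f :: "'v::real_normed_vector \<Rightarrow> real"
  assumes "f differentiable at (z + s *\<^sub>R v)"
  shows "((\<lambda>s. f (z + s *\<^sub>R v)) has_real_derivative dd v f (z + s *\<^sub>R v)) (at s)"
proof -
  have 1: "((\<lambda>s. z + s *\<^sub>R v) has_derivative (\<lambda>h. h *\<^sub>R v)) (at s)"
    by (auto intro!: derivative_eq_intros)
  have "((\<lambda>s. f (z + s *\<^sub>R v)) has_derivative (\<lambda>h. dd (h *\<^sub>R v) f (z + s *\<^sub>R v))) (at s)"
    using diff_chain_at[OF 1 has_derivative_dd[OF assms]] by (simp add: o_def)
  moreover have "(\<lambda>h. dd (h *\<^sub>R v) f (z + s *\<^sub>R v)) = (\<lambda>h. h * dd v f (z + s *\<^sub>R v))"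
    by (simp add: dd_scaleR_dir[OF assms])
  ultimately show ?thesis
    by (metis (no_types, lifting) ext has_field_derivative_def mult.commute)
qed

text \<open>The second difference is the increment of \<open>k\<close>, a difference of values of
  \<open>f\<close> along two parallel segments. The mean value theorem for \<open>k\<close> gives a
  derivative in direction \<open>v\<close>, a second one in direction \<open>w\<close> gives the
  mixed derivative. The left-hand side is symmetric in \<open>v\<close> and \<open>w\<close>, which
  is the point.\<close>

lemma second_difference_mvt:
  fixes f :: "'v::real_normed_vector \<Rightarrow> real"
  assumes S: "\<And>x. dist z x < r \<Longrightarrow> x \<in> S" and f: "smooth_on f S"
    and h: "h > 0" "h * (norm v + norm w) < r"
  shows "\<exists>p. dist z p \<le> h * (norm v + norm w) \<and>
    f (z + h *\<^sub>R v + h *\<^sub>R w) - f (z + h *\<^sub>R v) - f (z + h *\<^sub>R w) + f z = h * h * dd w (dd v f) p"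
proof -
  have bound: "dist z (z + s *\<^sub>R v + t *\<^sub>R w) \<le> h * (norm v + norm w)"
    if "0 \<le> s" "s \<le> h" "0 \<le> t" "t \<le> h" for s t
  proof -
    have "dist z (z + s *\<^sub>R v + t *\<^sub>R w) = norm (s *\<^sub>R v + t *\<^sub>R w)"
      by (metis add.assoc add_diff_cancel_left' dist_commute dist_norm)
    also have "\<dots> \<le> s * norm v + t * norm w"
      using that by (intro order_trans[OF norm_triangle_ineq]) auto
    also have "\<dots> \<le> h * (norm v + norm w)"
      using that by (auto simp: distrib_left intro!: add_mono mult_right_mono)
    finally show ?thesis .
  qed
  have inS: "z + s *\<^sub>R v + t *\<^sub>R w \<in> S" if "0 \<le> s" "s \<le> h" "0 \<le> t" "t \<le> h" for s t
    using bound[OF that] h S by auto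
  define k where "k = (\<lambda>s. f ((z + h *\<^sub>R w) + s *\<^sub>R v) - f (z + s *\<^sub>R v))"
  have dk: "(k has_real_derivative dd v f ((z + h *\<^sub>R w) + s *\<^sub>R v) - dd v f (z + s *\<^sub>R v)) (at s)"
    if "0 \<le> s" "s \<le> h" for s
  proof -
    have "z + s *\<^sub>R v + h *\<^sub>R w \<in> S" "z + s *\<^sub>R v + 0 *\<^sub>R w \<in> S"
      using that h by (intro inS; simp)+
    moreover have "z + s *\<^sub>R v + h *\<^sub>R w = (z + h *\<^sub>R w) + s *\<^sub>R v"
      by (simp add: algebra_simps)
    ultimately have "(z + h *\<^sub>R w) + s *\<^sub>R v \<in> S" "z + s *\<^sub>R v \<in> S"
      by simp_all
    then show ?thesis
      unfolding k_def using smooth_on_differentiable[OF f]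
      by (intro DERIV_diff has_real_derivative_line)
  qed
  then obtain s where s: "0 < s" "s < h"
      "k h - k 0 = (h - 0) * (dd v f ((z + h *\<^sub>R w) + s *\<^sub>R v) - dd v f (z + s *\<^sub>R v))"
    using MVT2[OF h(1) dk] by blast
  have dt: "((\<lambda>t. dd v f ((z + s *\<^sub>R v) + t *\<^sub>R w)) has_real_derivative
      dd w (dd v f) ((z + s *\<^sub>R v) + t *\<^sub>R w)) (at t)" if "0 \<le> t" "t \<le> h" for t
    using inS[of s t] that s
    by (intro has_real_derivative_line smooth_on_differentiable[OF smooth_on_dd[OF f]]) simp
  then obtain t where t: "0 < t" "t < h" "dd v f ((z + s *\<^sub>R v) + h *\<^sub>R w) - dd v f ((z + s *\<^sub>R v) + 0 *\<^sub>R w)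
      = (h - 0) * dd w (dd v f) ((z + s *\<^sub>R v) + t *\<^sub>R w)"
    using MVT2[OF h(1) dt] by blast
  have "f (z + h *\<^sub>R v + h *\<^sub>R w) - f (z + h *\<^sub>R v) - f (z + h *\<^sub>R w) + f z = k h - k 0"
    by (simp add: k_def algebra_simps)
  also have "\<dots> = h * h * dd w (dd v f) (z + s *\<^sub>R v + t *\<^sub>R w)"
    using s(3) t(3) by (simp add: algebra_simps)
  finally show ?thesis
    using bound[of s t] s t by fastforce
qed

text \<open>Both orders of differentiation are realised, at points \<open>p n\<close> and
  \<open>q n\<close> near \<open>z\<close>, by one and the same second difference. The points tend
  to \<open>z\<close> with the step, and continuity of both mixed derivatives finishes.\<close>

lemma dd_commute_real:
  fixes f :: "'v::real_normed_vector \<Rightarrow> real"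
  assumes "open S" "z \<in> S" and f: "smooth_on f S"
  shows "dd v (dd w f) z = dd w (dd v f) z"
proof -
  obtain r where r: "r > 0" "\<And>x. dist z x < r \<Longrightarrow> x \<in> S"
    using assms(1,2) by (metis open_contains_ball_eq mem_ball subsetD)
  \<comment> \<open>The summand 1 keeps \<open>N\<close> positive when \<open>v\<close> and
    \<open>w\<close> vanish; the 2 in \<open>h\<close> keeps the step below \<open>r / N\<close>
    already for \<open>n = 0\<close>.\<close>
  define N where "N = norm v + norm w + 1"
  have N: "N > 0" unfolding N_def by (simp add: add_nonneg_pos)
  define h where "h = (\<lambda>n. r / (N * (real n + 2)))"
  have h: "h n > 0" for n using r N by (auto simp: h_def)
  have hr: "h n * (norm v + norm w) < r" for n
  proof -
    have "h n * (norm v + norm w) \<le> h n * N" using h[of n] by (simp add: N_def)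
    also have "\<dots> = r / (real n + 2)" using N by (simp add: h_def)
    also have "\<dots> < r" using r by (simp add: field_simps add_pos_nonneg)
    finally show ?thesis .
  qed
  have h0: "(\<lambda>n. h n * (norm v + norm w)) \<longlonglongrightarrow> 0"
    unfolding h_def using N by real_asymp
  have "\<exists>p q. dist z p \<le> h n * (norm v + norm w) \<and> dist z q \<le> h n * (norm v + norm w) \<and>
      dd w (dd v f) p = dd v (dd w f) q" for n
  proof -
    obtain p where p: "dist z p \<le> h n * (norm v + norm w)"
      "f (z + h n *\<^sub>R v + h n *\<^sub>R w) - f (z + h n *\<^sub>R v) - f (z + h n *\<^sub>R w) + f z = h n * h n * dd w (dd v f) p"
      using second_difference_mvt[OF r(2) f h hr] by blast
    obtain q where q: "dist z q \<le> h n * (norm v + norm w)"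
      "f (z + h n *\<^sub>R w + h n *\<^sub>R v) - f (z + h n *\<^sub>R w) - f (z + h n *\<^sub>R v) + f z = h n * h n * dd v (dd w f) q"
      using second_difference_mvt[OF r(2) f h hr[of n, unfolded add.commute[of "norm v"]]]
      by (auto simp: add.commute[of "norm w"])
    have "h n * h n * dd w (dd v f) p = h n * h n * dd v (dd w f) q"
      unfolding p(2)[symmetric] q(2)[symmetric] by (simp add: algebra_simps)
    then show ?thesis using p q h[of n] by auto
  qed
  then obtain p q where pq: "\<And>n. dist z (p n) \<le> h n * (norm v + norm w)"
    "\<And>n. dist z (q n) \<le> h n * (norm v + norm w)" "\<And>n. dd w (dd v f) (p n) = dd v (dd w f) (q n)"
    by metis
  have lim: "s \<longlonglongrightarrow> z" if "\<And>n. dist z (s n) \<le> h n * (norm v + norm w)" for s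
    using tendsto_sandwich[OF _ _ tendsto_const h0, of "\<lambda>n. dist (s n) z"] that
    by (subst tendsto_dist_iff) (auto simp: dist_commute)
  have cont: "isCont (dd a (dd b f)) z" for a b
    using smooth_on_continuous[OF smooth_on_dd[OF smooth_on_dd[OF f]]] assms(1,2)
      continuous_on_eq_continuous_at by blast
  have "(\<lambda>n. dd w (dd v f) (p n)) \<longlonglongrightarrow> dd w (dd v f) z"
    by (rule isCont_tendsto_compose[OF cont lim[OF pq(1)]])
  moreover have "(\<lambda>n. dd v (dd w f) (q n)) \<longlonglongrightarrow> dd v (dd w f) z"
    by (rule isCont_tendsto_compose[OF cont lim[OF pq(2)]])
  ultimately show ?thesis using pq(3) LIMSEQ_unique by simp
qed

lemma dd_commute:
  fixes f :: "'v::real_normed_vector \<Rightarrow> complex"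
  assumes S: "open S" "z \<in> S" and f: "smooth_on f S"
  shows "dd v (dd w f) z = dd w (dd v f) z"
proof -
  have *: "L (dd a (dd b f) z) = dd a (dd b (\<lambda>x. L (f x))) z" if L: "bounded_linear L"
    for L :: "complex \<Rightarrow> real" and a b
  proof -
    have "dd a (dd b (\<lambda>x. L (f x))) z = dd a (\<lambda>x. L (dd b f x)) z"
      using S smooth_on_differentiable[OF f] L
      by (intro dd_cong_open[OF S]) (simp add: dd_bounded_linear[OF L])
    then show ?thesis
      using L smooth_on_differentiable[OF smooth_on_dd[OF f]] S by (simp add: dd_bounded_linear[OF L])
  qed
  have "L (dd v (dd w f) z) = L (dd w (dd v f) z)" if L: "bounded_linear L" for L :: "complex \<Rightarrow> real"
    using dd_commute_real[OF S smooth_on_bounded_linear[OF S(1) L f]] *[OF L] by simp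
  from this[OF bounded_linear_Re] this[OF bounded_linear_Im] show ?thesis
    by (simp add: complex_eq_iff)
qed

text \<open>For \<open>e = -\<i>\<close> this is \<open>\<partial>\<close> in the direction \<open>a\<close>, complex linear in \<open>a\<close>; for
  \<open>e = \<i>\<close> it is \<open>\<partial>bar\<close>, conjugate linear in \<open>a\<close>.\<close>

definition wd :: "complex \<Rightarrow> complex^'n \<Rightarrow> (complex^'n::finite \<Rightarrow> complex) \<Rightarrow> complex^'n \<Rightarrow> complex" where
  "wd e a f z = (dd a f z + e * dd (\<i> *s a) f z) / 2"

abbreviation "del \<equiv> wd (- \<i>)"
abbreviation "delbar \<equiv> wd \<i>"

lemma i_axis: "\<i> *s axis i 1 = (axis i \<i> :: complex^'n)"
  by (simp add: vec_eq_iff axis_def)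

lemma wirt_eq: "wirt i f z = del (axis i 1) f z" and wirtbar_eq: "wirtbar i f z = delbar (axis i 1) f z"
  by (simp_all add: wirt_def wirtbar_def wd_def dd_def i_axis)

lemma wd_cong_open:
  "open S \<Longrightarrow> z \<in> S \<Longrightarrow> (\<And>x. x \<in> S \<Longrightarrow> f x = g x) \<Longrightarrow> wd e v f z = wd e v g z"
  by (simp add: wd_def dd_cong_open[of S z f g])

lemma wd_add:
  "f differentiable at z \<Longrightarrow> g differentiable at z \<Longrightarrow> wd e v (\<lambda>x. f x + g x) z = wd e v f z + wd e v g z"
  by (simp add: wd_def dd_add field_simps)

lemma wd_mult:
  "f differentiable at z \<Longrightarrow> g differentiable at z
    \<Longrightarrow> wd e v (\<lambda>x. f x * g x) z = wd e v f z * g z + f z * wd e v g z"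
  by (simp add: wd_def dd_mult field_simps)

lemma wd_const [simp]: "wd e v (\<lambda>x. c) z = 0"
  by (simp add: wd_def)

lemma wd_cmult: "f differentiable at z \<Longrightarrow> wd e v (\<lambda>x. c * f x) z = c * wd e v f z"
  by (simp add: wd_mult)

lemma wd_sum:
  "(\<And>i. i \<in> I \<Longrightarrow> f i differentiable at z)
    \<Longrightarrow> wd e v (\<lambda>x. \<Sum>i\<in>I. f i x) z = (\<Sum>i\<in>I. wd e v (f i) z)"
proof (induction I rule: infinite_finite_induct)
  case (insert i I)
  then have "(\<lambda>x. \<Sum>i\<in>I. f i x) differentiable at z" by (auto intro!: differentiable_sum)
  with insert show ?case by (simp add: wd_add)
qed auto

lemma wd_cnj: "f differentiable at z \<Longrightarrow> wd e v (\<lambda>x. cnj (f x)) z = cnj (wd (cnj e) v f z)"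
  by (simp add: wd_def dd_bounded_linear[OF bounded_linear_cnj])

lemma dd_i_smult:
  assumes "f differentiable at z"
  shows "dd (c *s a) f z = Re c *\<^sub>R dd a f z + Im c *\<^sub>R dd (\<i> *s a) f z"
proof -
  have "c *s a = Re c *\<^sub>R a + Im c *\<^sub>R (\<i> *s a)"
    by (simp add: vec_eq_iff complex_eq_iff)
  then show ?thesis using assms by (simp add: dd_add_dir dd_scaleR_dir)
qed

lemma del_smult: "f differentiable at z \<Longrightarrow> del (c *s a) f z = c * del a f z"
  and delbar_smult: "f differentiable at z \<Longrightarrow> delbar (c *s a) f z = cnj c * delbar a f z"
  unfolding wd_def vector_smult_assoc
  by (simp_all add: dd_i_smult[of f z c] dd_i_smult[of f z "\<i> * c"] complex_eq_iff scaleR_conv_of_real algebra_simps)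

lemma wd_add_dir: "f differentiable at z \<Longrightarrow> wd e (a + b) f z = wd e a f z + wd e b f z"
  unfolding wd_def vector_add_ldistrib by (simp add: dd_add_dir field_simps)

lemma wd_zero_dir [simp]: "f differentiable at z \<Longrightarrow> wd e 0 f z = 0"
  unfolding wd_def by (simp add: dd_zero_dir)

lemma wd_sum_dir: "f differentiable at z \<Longrightarrow> wd e (\<Sum>i\<in>I. a i) f z = (\<Sum>i\<in>I. wd e (a i) f z)"
  by (induction I rule: infinite_finite_induct) (auto simp: wd_add_dir)

lemma del_expand: "f differentiable at z \<Longrightarrow> del a f z = (\<Sum>i\<in>UNIV. a $ i * wirt i f z)"
  and delbar_expand: "f differentiable at z \<Longrightarrow> delbar a f z = (\<Sum>i\<in>UNIV. cnj (a $ i) * wirtbar i f z)"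
  using wd_sum_dir[of f z _ "\<lambda>i. a $ i *s axis i 1" UNIV]
  by (simp_all add: basis_expansion del_smult delbar_smult wirt_eq wirtbar_eq)

lemma wd_alt: "wd e a f = (\<lambda>z. (1/2) * (dd a f z + e * dd (\<i> *s a) f z))"
  by (auto simp: wd_def)

lemma smooth_on_wd: "open S \<Longrightarrow> smooth_on f S \<Longrightarrow> smooth_on (wd e a f) S"
  unfolding wd_alt by (intro smooth_on_cmult smooth_on_add smooth_on_dd)

lemma wd_commute:
  assumes S: "open S" "z \<in> S" and f: "smooth_on f S"
  shows "wd e a (wd e' b f) z = wd e' b (wd e a f) z"
proof -
  have *: "dd v (wd e b f) z = (dd v (dd b f) z + e * dd v (dd (\<i> *s b) f) z) / 2" for v e b
  proof -
    note d = smooth_on_differentiable[OF smooth_on_dd[OF f] S(2)]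
    have 1: "(\<lambda>z. e * dd (\<i> *s b) f z) differentiable at z"
      by (intro differentiable_mult d differentiable_const)
    have "dd v (\<lambda>z. (1/2) * (dd b f z + e * dd (\<i> *s b) f z)) z
      = (1/2) * dd v (\<lambda>z. dd b f z + e * dd (\<i> *s b) f z) z"
      by (rule dd_bounded_linear[OF bounded_linear_mult_right differentiable_add[OF d 1]])
    also have "dd v (\<lambda>z. dd b f z + e * dd (\<i> *s b) f z) z
        = dd v (dd b f) z + dd v (\<lambda>z. e * dd (\<i> *s b) f z) z"
      by (rule dd_add[OF d 1])
    also have "dd v (\<lambda>z. e * dd (\<i> *s b) f z) z = e * dd v (dd (\<i> *s b) f) z"
      by (rule dd_bounded_linear[OF bounded_linear_mult_right d])
    finally show ?thesis by (simp add: wd_alt)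
  qed
  show ?thesis
    unfolding wd_def[of e a] wd_def[of e' b "wd e a f"] *
    using dd_commute[OF S f] by (simp add: field_simps)
qed

section \<open>Hermitian forms and unitary frames\<close>

lemma herm_prod_add_left: "herm_prod G (u + v) w = herm_prod G u w + herm_prod G v w"
  and herm_prod_add_right: "herm_prod G w (u + v) = herm_prod G w u + herm_prod G w v"
  and herm_prod_smult_left: "herm_prod G (c *s u) w = c * herm_prod G u w"
  and herm_prod_smult_right: "herm_prod G w (c *s u) = cnj c * herm_prod G w u"
  and herm_prod_zero_left [simp]: "herm_prod G 0 w = 0"
  and herm_prod_zero_right [simp]: "herm_prod G w 0 = 0"
  and herm_prod_add_matrix: "herm_prod (G + H) u w = herm_prod G u w + herm_prod H u w"
  by (simp_all add: herm_prod_def algebra_simps sum.distrib sum_distrib_left)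

lemma herm_prod_scaleR_left: "herm_prod G (r *\<^sub>R u) w = of_real r * herm_prod G u w"
  and herm_prod_scaleR_right: "herm_prod G w (r *\<^sub>R u) = of_real r * herm_prod G w u"
  by (simp_all add: herm_prod_def algebra_simps sum_distrib_left scaleR_conv_of_real[where 'a = complex])

lemma herm_prod_sum_left: "herm_prod G (\<Sum>i\<in>I. u i) w = (\<Sum>i\<in>I. herm_prod G (u i) w)"
  and herm_prod_sum_right: "herm_prod G w (\<Sum>i\<in>I. u i) = (\<Sum>i\<in>I. herm_prod G w (u i))"
  by (induction I rule: infinite_finite_induct) (auto simp: herm_prod_add_left herm_prod_add_right)

lemma herm_prod_cnj:
  assumes "\<And>i j. G $ i $ j = cnj (G $ j $ i)"
  shows "cnj (herm_prod G u v) = herm_prod G v u"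
proof -
  have "cnj (herm_prod G u v) = (\<Sum>i\<in>UNIV. \<Sum>j\<in>UNIV. G $ j $ i * cnj (u $ i) * v $ j)"
    unfolding herm_prod_def by (simp add: assms[symmetric])
  also have "\<dots> = herm_prod G v u"
    unfolding herm_prod_def by (subst sum.swap) (simp add: mult.commute mult.left_commute)
  finally show ?thesis .
qed

lemma hermitian_pos_def_cnj: "hermitian_pos_def G \<Longrightarrow> cnj (herm_prod G u v) = herm_prod G v u"
  unfolding hermitian_pos_def_def by (rule herm_prod_cnj) blast

lemma hermitian_pos_def_real:
  assumes "hermitian_pos_def G"
  shows "herm_prod G v v = of_real (Re (herm_prod G v v))"
  using hermitian_pos_def_cnj[OF assms, of v v] by (simp add: complex_eq_iff)

section \<open>Unitary frames and simultaneous diagonalisation\<close>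

definition unitary_frame :: "complex^'n^'n \<Rightarrow> ('n \<Rightarrow> complex^'n) \<Rightarrow> bool" where
  "unitary_frame G a \<longleftrightarrow> (\<forall>i j. herm_prod G (a i) (a j) = (if i = j then 1 else 0))"

definition frame_matrix :: "('n \<Rightarrow> complex^'n) \<Rightarrow> complex^'n^'n::finite" where
  "frame_matrix a = (\<chi> i k. a i $ k)"

definition frame_adjoint :: "('n \<Rightarrow> complex^'n) \<Rightarrow> complex^'n^'n::finite" where
  "frame_adjoint a = (\<chi> k j. cnj (a j $ k))"

lemma frame_product:
  "frame_matrix a ** G ** frame_adjoint a = (\<chi> i j. herm_prod G (a i) (a j))"
proof -
  have "(\<Sum>l\<in>UNIV. (\<Sum>k\<in>UNIV. a i $ k * G $ k $ l) * cnj (a j $ l)) = herm_prod G (a i) (a j)" for i j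
    unfolding herm_prod_def by (subst sum.swap) (simp add: sum_distrib_left sum_distrib_right mult_ac)
  then show ?thesis
    by (simp add: vec_eq_iff frame_matrix_def frame_adjoint_def matrix_matrix_mult_def)
qed

lemma det_frame_product:
  "det (\<chi> i j. herm_prod G (a i) (a j)) = det (frame_matrix a) * det G * det (frame_adjoint a)"
  by (simp add: frame_product[symmetric] det_mul)

lemma matrix_inv_unique:
  fixes A B :: "complex^'n::finite^'n"
  assumes "A ** B = mat 1"
  shows "matrix_inv A = B"
proof -
  have B: "B ** A = mat 1" using assms matrix_left_right_inverse by blast
  have "A ** matrix_inv A = mat 1 \<and> matrix_inv A ** A = mat 1"
    unfolding matrix_inv_def by (rule someI[of _ B]) (use assms B in simp)
  then have "B ** (A ** matrix_inv A) = B" by simp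
  then show ?thesis by (simp add: matrix_mul_assoc B)
qed

lemma matrix_inv_right:
  fixes A :: "complex^'n::finite^'n"
  assumes "det A \<noteq> 0"
  shows "A ** matrix_inv A = mat 1" "matrix_inv A ** A = mat 1"
proof -
  obtain B where "A ** B = mat 1" using assms invertible_det_nz invertible_def by blast
  then show "A ** matrix_inv A = mat 1" by (simp add: matrix_inv_unique)
  then show "matrix_inv A ** A = mat 1" using matrix_left_right_inverse by blast
qed

text \<open>Unitarity says that the product of \<open>frame_matrix a\<close>, \<open>G\<close> and
  \<open>frame_adjoint a\<close> is the identity. For square matrices one-sided inverses are
  two-sided, so the three factors may be rotated cyclically.\<close>

lemma unitary_frame_matrix:
  assumes "unitary_frame G a"
  shows "frame_matrix a ** (G ** frame_adjoint a) = mat 1"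
    and "(G ** frame_adjoint a) ** frame_matrix a = mat 1"
    and "matrix_inv G = frame_adjoint a ** frame_matrix a"
    and "det G \<noteq> 0"
proof -
  show 1: "frame_matrix a ** (G ** frame_adjoint a) = mat 1"
    using assms by (simp add: matrix_mul_assoc frame_product unitary_frame_def mat_def)
  then show 2: "(G ** frame_adjoint a) ** frame_matrix a = mat 1"
    using matrix_left_right_inverse by blast
  then have 3: "G ** (frame_adjoint a ** frame_matrix a) = mat 1"
    by (simp add: matrix_mul_assoc)
  then show "matrix_inv G = frame_adjoint a ** frame_matrix a"
    by (rule matrix_inv_unique)
  show "det G \<noteq> 0"
    using 3 invertible_det_nz invertible_right_inverse by blast
qed

lemma unitary_frame_expand:
  assumes "unitary_frame G a"
  shows "v = (\<Sum>i\<in>UNIV. herm_prod G v (a i) *s a i)"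
proof -
  have "v $ k = (\<Sum>i\<in>UNIV. herm_prod G v (a i) *s a i) $ k" for k
  proof -
    have "v $ k = (\<Sum>l\<in>UNIV. v $ l * ((G ** frame_adjoint a) ** frame_matrix a) $ l $ k)"
      unfolding unitary_frame_matrix(2)[OF assms] by (simp add: mat_def if_distrib sum.delta cong: if_cong)
    also have "\<dots> = (\<Sum>l\<in>UNIV. \<Sum>i\<in>UNIV. v $ l * (\<Sum>p\<in>UNIV. G $ l $ p * cnj (a i $ p)) * a i $ k)"
      by (simp add: matrix_matrix_mult_def frame_adjoint_def frame_matrix_def sum_distrib_left sum_distrib_right mult_ac)
    also have "\<dots> = (\<Sum>i\<in>UNIV. \<Sum>l\<in>UNIV. v $ l * (\<Sum>p\<in>UNIV. G $ l $ p * cnj (a i $ p)) * a i $ k)"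
      by (rule sum.swap)
    also have "\<dots> = (\<Sum>i\<in>UNIV. herm_prod G v (a i) * a i $ k)"
      by (intro sum.cong refl) (simp add: herm_prod_def sum_distrib_left sum_distrib_right mult_ac)
    finally show ?thesis by simp
  qed
  then show ?thesis by (simp add: vec_eq_iff)
qed

lemma herm_prod_expand:
  assumes "unitary_frame G c"
  shows "herm_prod H u v = (\<Sum>i\<in>UNIV. \<Sum>j\<in>UNIV.
    herm_prod G u (c i) * cnj (herm_prod G v (c j)) * herm_prod H (c i) (c j))"
proof -
  have "herm_prod H u v = herm_prod H (\<Sum>i\<in>UNIV. herm_prod G u (c i) *s c i) (\<Sum>i\<in>UNIV. herm_prod G v (c i) *s c i)"
    using unitary_frame_expand[OF assms] by metis
  also have "\<dots> = (\<Sum>j\<in>UNIV. \<Sum>i\<in>UNIV.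
      herm_prod G u (c i) * cnj (herm_prod G v (c j)) * herm_prod H (c i) (c j))"
    by (simp add: herm_prod_sum_left herm_prod_sum_right herm_prod_smult_left herm_prod_smult_right
        sum_distrib_left mult_ac)
  also have "\<dots> = (\<Sum>i\<in>UNIV. \<Sum>j\<in>UNIV.
      herm_prod G u (c i) * cnj (herm_prod G v (c j)) * herm_prod H (c i) (c j))"
    by (rule sum.swap)
  finally show ?thesis .
qed

text \<open>The inverse of \<open>G\<close> is the sum of the rank-one matrices built from the
  frame. Since every unitary frame gives the same value, this is also what makes the trace
  comparable between charts.\<close>

lemma herm_trace_frame:
  assumes "unitary_frame G a"
  shows "herm_trace G H = (\<Sum>m\<in>UNIV. Re (herm_prod H (a m) (a m)))"
proof -
  have "(\<Sum>i\<in>UNIV. \<Sum>j\<in>UNIV. matrix_inv G $ j $ i * H $ i $ j)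
    = (\<Sum>i\<in>UNIV. \<Sum>j\<in>UNIV. \<Sum>m\<in>UNIV. H $ i $ j * a m $ i * cnj (a m $ j))"
    unfolding unitary_frame_matrix(3)[OF assms]
    by (simp add: matrix_matrix_mult_def frame_adjoint_def frame_matrix_def sum_distrib_right sum_distrib_left mult_ac)
  also have "\<dots> = (\<Sum>i\<in>UNIV. \<Sum>m\<in>UNIV. \<Sum>j\<in>UNIV. H $ i $ j * a m $ i * cnj (a m $ j))"
    by (intro sum.cong refl sum.swap)
  also have "\<dots> = (\<Sum>m\<in>UNIV. herm_prod H (a m) (a m))"
    unfolding herm_prod_def by (rule sum.swap)
  finally show ?thesis unfolding herm_trace_def by simp
qed

text \<open>If \<open>b = q w v\<close> were nonzero, moving from the null vector \<open>v\<close> a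
  little in the direction \<open>w\<close>, with phase opposite to \<open>b\<close>, would make the
  form negative, because the linear term beats the quadratic one. Semidefiniteness is asked only on
  this complex line, since in the application it is known only on a subspace.\<close>

lemma psd_null_vector:
  fixes q :: "complex^'n \<Rightarrow> complex^'n \<Rightarrow> complex"
  assumes q: "q = herm_prod Q" and sym: "\<And>i j. Q $ i $ j = cnj (Q $ j $ i)"
    and W: "\<And>t. 0 \<le> Re (q (v + t *s w) (v + t *s w))"
    and null: "q v v = 0"
  shows "q w v = 0"
proof (rule ccontr)
  define b where "b = q w v"
  assume "q w v \<noteq> 0"
  then have b: "norm b > 0" by (simp add: b_def)
  define d where "d = Re (q w w)"
  have vw: "q v w = cnj b" using herm_prod_cnj[OF sym] by (simp add: b_def q)
  \<comment> \<open>Any positive \<open>s\<close> with \<open>s * d < 2\<close> works; this choice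
    gives \<open>s * d < 1\<close>.\<close>
  define s where "s = 1 / (\<bar>d\<bar> + 1)"
  have s: "s > 0" "s * d < 1" by (auto simp: s_def field_simps abs_if)
  define t where "t = - of_real s * cnj b"
  have "q (v + t *s w) (v + t *s w) = t * b + cnj t * cnj b + t * cnj t * q w w"
    using null vw by (simp add: q b_def herm_prod_add_left herm_prod_add_right herm_prod_smult_left
        herm_prod_smult_right algebra_simps)
  also have "Re \<dots> = - 2 * s * (norm b)\<^sup>2 + s\<^sup>2 * (norm b)\<^sup>2 * d"
    by (simp add: t_def d_def cmod_power2) (simp add: power2_eq_square algebra_simps)
  also have "\<dots> = s * (norm b)\<^sup>2 * (s * d - 2)"
    by (simp add: power2_eq_square algebra_simps)
  also have "\<dots> < 0" using s b by (intro mult_pos_neg) auto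
  finally show False using W[of t] by simp
qed

lemma continuous_on_herm_prod: "continuous_on S (\<lambda>v. herm_prod G v v)"
  unfolding herm_prod_def by (intro continuous_intros)

text \<open>The new vector maximises the quotient of the two quadratic forms on the
  \<open>G\<close>-orthogonal complement of the vectors that are already there.\<close>

lemma simultaneous_diagonalization_step:
  fixes G H :: "complex^'n::finite^'n" and a :: "'n \<Rightarrow> complex^'n"
  assumes G: "hermitian_pos_def G" and H: "\<And>i j. H $ i $ j = cnj (H $ j $ i)"
    and ON: "\<And>i j. i \<in> I \<Longrightarrow> j \<in> I \<Longrightarrow> herm_prod G (a i) (a j) = (if i = j then 1 else 0)"
    and eig: "\<And>i v. i \<in> I \<Longrightarrow> herm_prod H v (a i) = of_real (lam i) * herm_prod G v (a i)"
    and k: "k \<notin> I"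
  shows "\<exists>x l. herm_prod G x x = 1 \<and> (\<forall>i\<in>I. herm_prod G x (a i) = 0) \<and>
    (\<forall>v. herm_prod H v x = of_real l * herm_prod G v x)"
proof -
  \<comment> \<open>The rows in \<open>I\<close> encode orthogonality to the vectors found so far
    and all other rows vanish. The zero row \<open>k\<close> makes the matrix singular, so its
    kernel, the orthogonal complement, is nontrivial.\<close>
  define M :: "complex^'n^'n" where "M = (\<chi> j k. if j \<in> I then (\<Sum>l\<in>UNIV. G $ k $ l * cnj (a j $ l)) else 0)"
  have M: "(M *v v) $ j = (if j \<in> I then herm_prod G v (a j) else 0)" for v j
    by (auto simp: M_def matrix_vector_mult_def herm_prod_def sum_distrib_left sum_distrib_right mult_ac)
  have "row k M = 0" using k by (auto simp: row_def M_def vec_eq_iff)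
  then have "\<not> invertible M"
    by (simp add: invertible_det_nz det_zero_row)
  then obtain w where w: "w \<noteq> 0" "M *v w = 0"
    using matrix_left_invertible_ker[of M] invertible_left_inverse[of M] by blast
  define W where "W = {v. M *v v = 0}"
  have W_add: "u + c *s v \<in> W" if "u \<in> W" "v \<in> W" for u v c
    using that by (simp add: W_def matrix_vector_right_distrib vector_scalar_commute)
  have "closed W" unfolding W_def
    by (intro closed_Collect_eq continuous_intros linear_continuous_on matrix_vector_mul_bounded_linear)
  define K where "K = W \<inter> sphere 0 1"
  have "compact K" unfolding K_def
    using \<open>closed W\<close> by (intro closed_Int_compact compact_sphere)
  have "(1 / norm w) *\<^sub>R w \<in> K"
  proof -
    have "(1 / norm w) *\<^sub>R w = 0 + of_real (1 / norm w) *s w"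
      by (simp add: vec_eq_iff scaleR_conv_of_real[where 'a = complex])
    moreover have "0 \<in> W" "w \<in> W" using w by (auto simp: W_def)
    ultimately have "(1 / norm w) *\<^sub>R w \<in> W" using W_add[of 0 w] by metis
    moreover have "norm ((1 / norm w) *\<^sub>R w) = 1" using w by simp
    ultimately show ?thesis unfolding K_def by simp
  qed
  then have "K \<noteq> {}" by auto
  have Gpos: "Re (herm_prod G v v) > 0" if "v \<noteq> 0" for v
    using G that unfolding hermitian_pos_def_def by blast
  have "continuous_on K (\<lambda>v. Re (herm_prod H v v) / Re (herm_prod G v v))"
  proof (intro continuous_intros continuous_on_herm_prod ballI)
    fix v assume "v \<in> K"
    then have "v \<noteq> 0" by (auto simp: K_def)
    then show "Re (herm_prod G v v) \<noteq> 0" using Gpos[of v] by simp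
  qed
  then obtain x where x: "x \<in> K" and max: "\<And>y. y \<in> K \<Longrightarrow>
      Re (herm_prod H y y) / Re (herm_prod G y y) \<le> Re (herm_prod H x x) / Re (herm_prod G x x)"
    using continuous_attains_sup[OF \<open>compact K\<close> \<open>K \<noteq> {}\<close>] by blast
  have x0: "x \<noteq> 0" "x \<in> W" using x by (auto simp: K_def)
  define l where "l = Re (herm_prod H x x) / Re (herm_prod G x x)"
  \<comment> \<open>Maximality of the quotient means that this form is semidefinite on
    \<open>W\<close> with null vector \<open>x\<close>, so \<open>x\<close> is orthogonal to all of
    \<open>W\<close> with respect to it.\<close>
  define Q where "Q = (\<chi> i j. of_real l * G $ i $ j - H $ i $ j)"
  have Q: "herm_prod Q u v = of_real l * herm_prod G u v - herm_prod H u v" for u v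
    by (simp add: Q_def herm_prod_def algebra_simps sum_subtractf sum_distrib_left)
  have Gherm: "G $ i $ j = cnj (G $ j $ i)" for i j using G unfolding hermitian_pos_def_def by blast
  have Qsym: "Q $ i $ j = cnj (Q $ j $ i)" for i j
    using Gherm[of i j] H[of i j] by (simp add: Q_def)
  have Qpos: "0 \<le> Re (herm_prod Q y y)" if "y \<in> W" for y
  proof (cases "y = 0")
    case False
    define r where "r = 1 / norm y"
    have r: "r > 0" using False by (simp add: r_def)
    have "r *\<^sub>R y = 0 + of_real r *s y" by (simp add: vec_eq_iff scaleR_conv_of_real[where 'a = complex])
    moreover have "0 \<in> W" by (simp add: W_def)
    ultimately have "r *\<^sub>R y \<in> W" using W_add[of 0 y] that by metis
    moreover have "norm (r *\<^sub>R y) = 1" using False by (simp add: r_def)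
    ultimately have "r *\<^sub>R y \<in> K" unfolding K_def by simp
    from max[OF this] have "Re (herm_prod H y y) / Re (herm_prod G y y) \<le> l"
      using r by (simp add: herm_prod_scaleR_left herm_prod_scaleR_right l_def)
    with Gpos[OF False] show ?thesis by (simp add: Q field_simps)
  qed simp
  have Gx: "herm_prod G x x = of_real (Re (herm_prod G x x))"
    by (rule hermitian_pos_def_real[OF G])
  have Hx: "herm_prod H x x = of_real (Re (herm_prod H x x))"
    using herm_prod_cnj[OF H, of x x] by (simp add: complex_eq_iff)
  have Qx: "herm_prod Q x x = 0"
    using Gpos[OF x0(1)] by (subst Q, subst Gx, subst Hx) (simp add: l_def)
  have QW: "herm_prod Q y x = 0" if "y \<in> W" for y
    using psd_null_vector[OF refl Qsym _ Qx] Qpos W_add[OF x0(2) that] by blast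
  have xa: "herm_prod G x (a i) = 0" if "i \<in> I" for i
    using x0(2) M[of x i] that by (simp add: W_def)
  have Qv: "herm_prod Q v x = 0" for v
  proof -
    \<comment> \<open>The component of \<open>v\<close> along the earlier vectors. These are
      eigenvectors orthogonal to \<open>x\<close>, so both forms vanish between \<open>p\<close> and
      \<open>x\<close>, and the eigenvector equation extends from \<open>W\<close> to the whole
      space.\<close>
    define p where "p = (\<Sum>i\<in>I. herm_prod G v (a i) *s a i)"
    have "herm_prod G (v - p) (a j) = 0" if "j \<in> I" for j
    proof -
      have "herm_prod G p (a j) = (\<Sum>i\<in>I. if i = j then herm_prod G v (a i) else 0)"
        unfolding p_def herm_prod_sum_left
        by (intro sum.cong refl) (simp add: herm_prod_smult_left ON that)
      also have "\<dots> = herm_prod G v (a j)" using that by simp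
      finally show ?thesis
        using herm_prod_add_left[of G "v - p" p "a j"] by simp
    qed
    then have "v - p \<in> W"
      by (auto simp: W_def vec_eq_iff M)
    have "herm_prod G p x = 0" "herm_prod H p x = 0"
    proof -
      have 1: "herm_prod G (a i) x = 0" if "i \<in> I" for i
        using xa[OF that] hermitian_pos_def_cnj[OF G, of x "a i"] by simp
      have 2: "herm_prod H (a i) x = 0" if "i \<in> I" for i
        using eig[OF that, of x] xa[OF that] herm_prod_cnj[OF H, of x "a i"] by simp
      show "herm_prod G p x = 0" "herm_prod H p x = 0"
        by (simp_all add: p_def herm_prod_sum_left herm_prod_smult_left 1 2)
    qed
    then have "herm_prod Q p x = 0" by (simp add: Q)
    with QW[OF \<open>v - p \<in> W\<close>] show ?thesis
      using herm_prod_add_left[of Q "v - p" p x] by simp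
  qed
  define s where "s = 1 / sqrt (Re (herm_prod G x x))"
  have s: "s * s * Re (herm_prod G x x) = 1" "s > 0"
    using Gpos[OF x0(1)] by (auto simp: s_def field_simps)
  have "herm_prod G (s *\<^sub>R x) (s *\<^sub>R x) = of_real s * (of_real s * herm_prod G x x)"
    by (simp only: herm_prod_scaleR_left herm_prod_scaleR_right)
  also have "\<dots> = of_real (s * s * Re (herm_prod G x x))"
    by (subst Gx) (simp only: of_real_mult mult.assoc)
  finally have "herm_prod G (s *\<^sub>R x) (s *\<^sub>R x) = 1"
    unfolding s(1) by simp
  moreover have "\<forall>i\<in>I. herm_prod G (s *\<^sub>R x) (a i) = 0"
    by (simp add: herm_prod_scaleR_left xa)
  moreover have "herm_prod H v (s *\<^sub>R x) = of_real l * herm_prod G v (s *\<^sub>R x)" for v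
    using Qv[of v] by (simp add: herm_prod_scaleR_right Q)
  ultimately show ?thesis by blast
qed

text \<open>The induction over the index set carries the eigenvector equation against every
  \<open>v\<close>, which is more than diagonality on the vectors found so far; the next step needs
  it to leave the orthogonal complement.\<close>

lemma simultaneous_diagonalization:
  fixes G H :: "complex^'n::finite^'n"
  assumes G: "hermitian_pos_def G" and H: "\<And>i j. H $ i $ j = cnj (H $ j $ i)"
  shows "\<exists>a lam. unitary_frame G a \<and>
    (\<forall>i j. herm_prod H (a i) (a j) = (if i = j then of_real (lam i) else 0))"
proof -
  have "\<exists>a lam. (\<forall>i\<in>I. \<forall>j\<in>I. herm_prod G (a i) (a j) = (if i = j then 1 else 0)) \<and>
    (\<forall>i\<in>I. \<forall>v. herm_prod H v (a i) = of_real (lam i) * herm_prod G v (a i))" if "finite I" for I :: "'n set"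
    using that
  proof (induction I)
    case (insert k I)
    obtain a lam where IH0:
      "\<forall>i\<in>I. \<forall>j\<in>I. herm_prod G (a i) (a j) = (if i = j then 1 else 0)"
      "\<forall>i\<in>I. \<forall>v. herm_prod H v (a i) = of_real (lam i) * herm_prod G v (a i)"
      using insert.IH by blast
    then have IH: "\<And>i j. i \<in> I \<Longrightarrow> j \<in> I \<Longrightarrow> herm_prod G (a i) (a j) = (if i = j then 1 else 0)"
      "\<And>i v. i \<in> I \<Longrightarrow> herm_prod H v (a i) = of_real (lam i) * herm_prod G v (a i)"
      by blast+
    obtain x l where x: "herm_prod G x x = 1" "\<forall>i\<in>I. herm_prod G x (a i) = 0"
      "\<forall>v. herm_prod H v x = of_real l * herm_prod G v x"
      using simultaneous_diagonalization_step[OF G H IH insert.hyps(2)] by blast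
    have x': "herm_prod G (a i) x = 0" if "i \<in> I" for i
      using x(2) that hermitian_pos_def_cnj[OF G, of x "a i"] by simp
    show ?case
      by (rule exI[of _ "a(k := x)"], rule exI[of _ "lam(k := l)"])
        (use insert.hyps IH x x' in auto)
  qed simp
  from this[of UNIV] have "\<exists>(a :: 'n \<Rightarrow> complex^'n) (lam :: 'n \<Rightarrow> real). (\<forall>i j. herm_prod G (a i) (a j) = (if i = j then 1 else 0)) \<and>
    (\<forall>i v. herm_prod H v (a i) = of_real (lam i) * herm_prod G v (a i))" by simp
  then obtain a :: "'n \<Rightarrow> complex^'n" and lam :: "'n \<Rightarrow> real" where a: "\<forall>i j. herm_prod G (a i) (a j) = (if i = j then 1 else 0)"
    "\<forall>i v. herm_prod H v (a i) = of_real (lam i) * herm_prod G v (a i)"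
    by (elim exE conjE) (rule that)
  then show ?thesis by (intro exI[of _ a] exI[of _ lam]) (simp add: unitary_frame_def)
qed

lemma hermitian_pos_def_det_nz: "hermitian_pos_def (G :: complex^'n::finite^'n) \<Longrightarrow> det G \<noteq> 0"
proof -
  assume G: "hermitian_pos_def G"
  then have sym: "G $ i $ j = cnj (G $ j $ i)" for i j unfolding hermitian_pos_def_def by blast
  obtain b where "unitary_frame G b"
    using simultaneous_diagonalization[OF G sym] by (elim exE conjE) (rule that)
  then show ?thesis by (rule unitary_frame_matrix(4))
qed

lemma det_simultaneous:
  assumes "unitary_frame G a" "\<And>i j. herm_prod H (a i) (a j) = (if i = j then of_real (lam i) else 0)"
  shows "det H = (\<Prod>i\<in>UNIV. of_real (lam i)) * det G"
proof -
  have "det (frame_matrix a) * det G * det (frame_adjoint a) = 1"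
    unfolding det_frame_product[symmetric] using assms(1)
    by (simp add: unitary_frame_def det_diagonal)
  then have "det H = det H * (det (frame_matrix a) * det G * det (frame_adjoint a))" by simp
  also have "\<dots> = (det (frame_matrix a) * det H * det (frame_adjoint a)) * det G"
    by (simp add: mult_ac)
  also have "det (frame_matrix a) * det H * det (frame_adjoint a) = (\<Prod>i\<in>UNIV. of_real (lam i))"
    unfolding det_frame_product[symmetric] using assms(2) by (simp add: det_diagonal)
  finally show ?thesis .
qed

lemma diagonalization_pos:
  assumes "hermitian_pos_def H" "unitary_frame G a"
    "\<And>i j. herm_prod H (a i) (a j) = (if i = j then of_real (lam i) else 0)"
  shows "lam i > 0"
proof -
  have "a i \<noteq> 0" using assms(2) unfolding unitary_frame_def
    by (metis herm_prod_zero_left zero_neq_one)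
  then show ?thesis using assms(1,3) unfolding hermitian_pos_def_def by (metis Re_complex_of_real)
qed

lemma sum_sum_delta:
  fixes f :: "'n::finite \<Rightarrow> 'n \<Rightarrow> 'b::semiring_0"
  shows "(\<Sum>i\<in>UNIV. \<Sum>j\<in>UNIV. f i j * (if i = j then h i else 0)) = (\<Sum>i\<in>UNIV. f i i * h i)"
    and "(\<Sum>i\<in>UNIV. \<Sum>j\<in>UNIV. (if i = j then h i else 0) * f i j) = (\<Sum>i\<in>UNIV. h i * f i i)"
proof -
  have "(\<Sum>j\<in>UNIV. f i j * (if i = j then h i else 0)) = f i i * h i" for i
  proof -
    have "(\<Sum>j\<in>UNIV. f i j * (if i = j then h i else 0)) = (\<Sum>j\<in>UNIV. if i = j then f i j * h i else 0)"
      by (rule sum.cong) auto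
    also have "\<dots> = f i i * h i" by simp
    finally show ?thesis .
  qed
  moreover have "(\<Sum>j\<in>UNIV. (if i = j then h i else 0) * f i j) = h i * f i i" for i
  proof -
    have "(\<Sum>j\<in>UNIV. (if i = j then h i else 0) * f i j) = (\<Sum>j\<in>UNIV. if i = j then h i * f i j else 0)"
      by (rule sum.cong) auto
    also have "\<dots> = h i * f i i" by simp
    finally show ?thesis .
  qed
  ultimately show "(\<Sum>i\<in>UNIV. \<Sum>j\<in>UNIV. f i j * (if i = j then h i else 0)) = (\<Sum>i\<in>UNIV. f i i * h i)"
    "(\<Sum>i\<in>UNIV. \<Sum>j\<in>UNIV. (if i = j then h i else 0) * f i j) = (\<Sum>i\<in>UNIV. h i * f i i)"
    by simp_all
qed

text \<open>The trace of \<open>G\<^sup>-\<^sup>1 H\<close> is convex in \<open>G\<close>; the left-hand side is its tangent at the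
  metrics for which \<open>a\<close> is unitary.\<close>

lemma herm_trace_tangent:
  fixes G H :: "complex^'n::finite^'n" and a :: "'n \<Rightarrow> complex^'n"
  assumes G: "hermitian_pos_def G" and H: "hermitian_pos_def H"
  shows "Re (\<Sum>i\<in>UNIV. \<Sum>j\<in>UNIV. ((if i = j then 2 else 0) - herm_prod G (a j) (a i)) * herm_prod H (a i) (a j))
    \<le> herm_trace G H"
proof -
  have Hsym: "H $ i $ j = cnj (H $ j $ i)" for i j using H unfolding hermitian_pos_def_def by blast
  obtain c lam where c: "unitary_frame G c"
    and Hc': "\<forall>i j. herm_prod H (c i) (c j) = (if i = j then of_real (lam i) else 0)"
    using simultaneous_diagonalization[OF G Hsym] by (elim exE conjE) (rule that)
  then have Hc: "\<And>i j. herm_prod H (c i) (c j) = (if i = j then of_real (lam i) else 0)" by blast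
  \<comment> \<open>\<open>q\<close> is the matrix of \<open>a\<close> in the frame
    \<open>c\<close>. With P the Gram matrix of its columns, \<open>x\<close> are the diagonal
    entries of P and \<open>y\<close> the squared moduli of all its entries, so the claim reduces to
    the diagonal entries of 2 P - P P being at most 1. Keeping only the diagonal term of the row sum
    leaves \<open>2 * x - x\<^sup>2 \<le> 1\<close>.\<close>
  define q where "q = (\<lambda>i m. herm_prod G (a i) (c m))"
  define x where "x = (\<lambda>m. \<Sum>i\<in>UNIV. (norm (q i m))\<^sup>2)"
  have Gq: "herm_prod G (a j) (a i) = (\<Sum>m\<in>UNIV. q j m * cnj (q i m))" for i j
    by (subst herm_prod_expand[OF c])
      (simp only: c[unfolded unitary_frame_def, rule_format] sum_sum_delta q_def mult_1_right)
  have Hq: "herm_prod H (a i) (a j) = (\<Sum>m\<in>UNIV. of_real (lam m) * (q i m * cnj (q j m)))" for i j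
    by (subst herm_prod_expand[OF c]) (simp only: Hc sum_sum_delta q_def, simp only: mult_ac)
  have x: "(\<Sum>i\<in>UNIV. q i m * cnj (q i m)) = of_real (x m)" for m
    unfolding x_def of_real_sum complex_norm_square ..
  define y where "y = (\<lambda>m m'. (norm (\<Sum>i\<in>UNIV. q i m * cnj (q i m')))\<^sup>2)"
  have y: "of_real (y m m') = (\<Sum>i\<in>UNIV. \<Sum>j\<in>UNIV. q j m' * cnj (q i m') * (q i m * cnj (q j m)))" for m m'
  proof -
    have "of_real (y m m') = (\<Sum>i\<in>UNIV. q i m * cnj (q i m')) * (\<Sum>j\<in>UNIV. cnj (q j m) * q j m')"
      unfolding y_def complex_norm_square by simp
    then show ?thesis unfolding sum_product by (simp only: mult_ac)
  qed
  have "(\<Sum>i\<in>UNIV. \<Sum>j\<in>UNIV. ((if i = j then 2 else 0) - herm_prod G (a j) (a i)) * herm_prod H (a i) (a j))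
     = 2 * (\<Sum>i\<in>UNIV. herm_prod H (a i) (a i)) - (\<Sum>i\<in>UNIV. \<Sum>j\<in>UNIV. herm_prod G (a j) (a i) * herm_prod H (a i) (a j))"
    unfolding left_diff_distrib sum_subtractf sum_distrib_left
    using sum_sum_delta(2)[of "\<lambda>i. 2" "\<lambda>i j. herm_prod H (a i) (a j)"] by simp
  also have "(\<Sum>i\<in>UNIV. herm_prod H (a i) (a i)) = (\<Sum>m\<in>UNIV. of_real (lam m * x m))"
    unfolding Hq by (subst sum.swap) (simp add: sum_distrib_left[symmetric] x)
  also have "(\<Sum>i\<in>UNIV. \<Sum>j\<in>UNIV. herm_prod G (a j) (a i) * herm_prod H (a i) (a j))
     = (\<Sum>m\<in>UNIV. \<Sum>m'\<in>UNIV. of_real (lam m * y m m'))"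
  proof -
    have "(\<Sum>i\<in>UNIV. \<Sum>j\<in>UNIV. herm_prod G (a j) (a i) * herm_prod H (a i) (a j))
      = (\<Sum>i\<in>UNIV. \<Sum>j\<in>UNIV. \<Sum>m\<in>UNIV. \<Sum>m'\<in>UNIV. of_real (lam m) * (q j m' * cnj (q i m') * (q i m * cnj (q j m))))"
    proof (intro sum.cong refl)
      fix i j
      show "herm_prod G (a j) (a i) * herm_prod H (a i) (a j) =
        (\<Sum>m\<in>UNIV. \<Sum>m'\<in>UNIV. of_real (lam m) * (q j m' * cnj (q i m') * (q i m * cnj (q j m))))"
        unfolding Gq Hq by (subst mult.commute) (simp only: sum_product, simp only: mult_ac)
    qed
    also have "\<dots> = (\<Sum>m\<in>UNIV. \<Sum>m'\<in>UNIV. \<Sum>i\<in>UNIV. \<Sum>j\<in>UNIV. of_real (lam m) * (q j m' * cnj (q i m') * (q i m * cnj (q j m))))"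
      unfolding sum.cartesian_product
      by (rule sum.reindex_bij_witness[where i = "\<lambda>(m,m',i,j). (i,j,m,m')" and j = "\<lambda>(i,j,m,m'). (m,m',i,j)"]) auto
    finally show ?thesis by (simp add: y sum_distrib_left)
  qed
  finally have "Re (\<Sum>i\<in>UNIV. \<Sum>j\<in>UNIV. ((if i = j then 2 else 0) - herm_prod G (a j) (a i)) * herm_prod H (a i) (a j))
     = (\<Sum>m\<in>UNIV. lam m * (2 * x m - (\<Sum>m'\<in>UNIV. y m m')))"
    by (simp add: sum_distrib_left sum_subtractf right_diff_distrib mult_ac)
  also have "\<dots> \<le> (\<Sum>m\<in>UNIV. lam m * 1)"
  proof (rule sum_mono, rule mult_left_mono)
    fix m :: 'n
    show "0 \<le> lam m" using diagonalization_pos[OF H c Hc] by (simp add: less_imp_le)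
    have "(x m)\<^sup>2 = y m m" unfolding y_def x by simp
    also have "\<dots> \<le> (\<Sum>m'\<in>UNIV. y m m')" by (rule member_le_sum) (auto simp: y_def)
    finally have "2 * x m - (\<Sum>m'\<in>UNIV. y m m') \<le> 2 * x m - (x m)\<^sup>2" by simp
    also have "\<dots> \<le> 1" using zero_le_power2[of "x m - 1"] by (simp add: power2_diff)
    finally show "2 * x m - (\<Sum>m'\<in>UNIV. y m m') \<le> 1" .
  qed
  also have "\<dots> = herm_trace G H" by (simp add: herm_trace_frame[OF c] Hc)
  finally show ?thesis .
qed

section \<open>Derivatives of determinants and inverse matrices\<close>

lemma differentiable_prod_complex:
  fixes f :: "'i \<Rightarrow> 'v::real_normed_vector \<Rightarrow> complex"
  shows "(\<And>i. i \<in> I \<Longrightarrow> f i differentiable at z) \<Longrightarrow> (\<lambda>x. \<Prod>i\<in>I. f i x) differentiable at z"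
  by (induction I rule: infinite_finite_induct) (auto intro!: differentiable_mult)

lemma differentiable_det:
  fixes M :: "'v::real_normed_vector \<Rightarrow> complex^'n::finite^'n"
  assumes "\<And>i j. (\<lambda>x. M x $ i $ j) differentiable at z"
  shows "(\<lambda>x. det (M x)) differentiable at z"
  unfolding det_def
  by (intro differentiable_sum ballI differentiable_mult differentiable_const differentiable_prod_complex assms)
    (auto intro: finite_permutations)

text \<open>A permutation other than the identity moves at least two indices. After the Leibniz rule
  takes away one factor, an off-diagonal entry of the identity matrix, hence a zero, remains in its
  product.\<close>

lemma dd_det_mat1:
  fixes M :: "'v::real_normed_vector \<Rightarrow> complex^'n::finite^'n"
  assumes d: "\<And>i j. (\<lambda>x. M x $ i $ j) differentiable at z" and 1: "M z = mat 1"
  shows "dd v (\<lambda>x. det (M x)) z = (\<Sum>i\<in>UNIV. dd v (\<lambda>x. M x $ i $ i) z)"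
proof -
  have "((\<lambda>x. det (M x)) has_derivative (\<lambda>y. \<Sum>p | p permutes UNIV. of_int (sign p) *
      (\<Sum>i\<in>UNIV. dd y (\<lambda>x. M x $ i $ p i) z * (\<Prod>j\<in>UNIV - {i}. M z $ j $ p j)))) (at z)"
    unfolding det_def
    by (intro has_derivative_sum has_derivative_mult_right has_derivative_prod has_derivative_dd d)
  then have "dd v (\<lambda>x. det (M x)) z = (\<Sum>p | p permutes UNIV. of_int (sign p) *
      (\<Sum>i\<in>UNIV. dd v (\<lambda>x. M x $ i $ p i) z * (\<Prod>j\<in>UNIV - {i}. M z $ j $ p j)))"
    by (rule dd_eq)
  also have "\<dots> = (\<Sum>p\<in>{id :: 'n \<Rightarrow> 'n}. of_int (sign p) *
      (\<Sum>i\<in>UNIV. dd v (\<lambda>x. M x $ i $ p i) z * (\<Prod>j\<in>UNIV - {i}. M z $ j $ p j)))"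
  proof (rule sum.mono_neutral_right)
    show "finite {p. p permutes (UNIV :: 'n set)}" by (rule finite_permutations) simp
    show "{id} \<subseteq> {p. p permutes (UNIV :: 'n set)}" by (simp add: permutes_id)
    show "\<forall>p\<in>{p. p permutes UNIV} - {id}. of_int (sign p) *
      (\<Sum>i\<in>UNIV. dd v (\<lambda>x. M x $ i $ p i) z * (\<Prod>j\<in>UNIV - {i}. M z $ j $ p j)) = 0"
    proof
      fix p :: "'n \<Rightarrow> 'n" assume p: "p \<in> {p. p permutes UNIV} - {id}"
      then obtain k where k: "p k \<noteq> k" by (auto simp: fun_eq_iff)
      have "inj p" using p permutes_inj by blast
      then have pk: "p (p k) \<noteq> p k" using k by (auto dest: injD)
      have "(\<Prod>j\<in>UNIV - {i}. M z $ j $ p j) = 0" for i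
      proof (rule prod_zero)
        show "\<exists>j\<in>UNIV - {i}. M z $ j $ p j = 0"
          using k pk by (intro bexI[of _ "if i = k then p k else k"]) (auto simp: 1 mat_def)
      qed simp
      then show "of_int (sign p) *
        (\<Sum>i\<in>UNIV. dd v (\<lambda>x. M x $ i $ p i) z * (\<Prod>j\<in>UNIV - {i}. M z $ j $ p j)) = 0"
        by (simp del: prod_zero_iff)
    qed
  qed
  also have "\<dots> = (\<Sum>i\<in>UNIV. dd v (\<lambda>x. M x $ i $ i) z)"
    by (simp add: 1 mat_def)
  finally show ?thesis .
qed

text \<open>Jacobi's formula. Multiplying by the constant matrix \<open>matrix_inv (M z)\<close>
  reduces it to the case where the value at \<open>z\<close> is the identity.\<close>

lemma dd_det:
  fixes M :: "'v::real_normed_vector \<Rightarrow> complex^'n::finite^'n"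
  assumes d: "\<And>i j. (\<lambda>x. M x $ i $ j) differentiable at z" and inv: "det (M z) \<noteq> 0"
  shows "dd v (\<lambda>x. det (M x)) z =
    det (M z) * (\<Sum>k\<in>UNIV. \<Sum>l\<in>UNIV. matrix_inv (M z) $ k $ l * dd v (\<lambda>x. M x $ l $ k) z)"
proof -
  define N where "N = matrix_inv (M z)"
  have N: "N ** M z = mat 1" "M z ** N = mat 1"
    by (simp_all add: N_def inv matrix_inv_right)
  have detM: "det (M x) = det (M z) * det (N ** M x)" for x
    unfolding det_mul[symmetric] by (simp add: matrix_mul_assoc N)
  have entry: "(N ** M x) $ i $ j = (\<Sum>l\<in>UNIV. N $ i $ l * M x $ l $ j)" for x i j
    by (simp add: matrix_matrix_mult_def)
  have dc: "(\<lambda>x. N $ i $ l * M x $ l $ j) differentiable at z" for i j l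
    by (intro differentiable_mult differentiable_const d)
  have dN: "(\<lambda>x. (N ** M x) $ i $ j) differentiable at z" for i j
    unfolding entry by (intro differentiable_sum dc ballI) simp
  have "dd v (\<lambda>x. det (M z) * det (N ** M x)) z = det (M z) * dd v (\<lambda>x. det (N ** M x)) z"
    by (rule dd_bounded_linear[OF bounded_linear_mult_right differentiable_det[OF dN]])
  also have "dd v (\<lambda>x. det (N ** M x)) z = (\<Sum>i\<in>UNIV. dd v (\<lambda>x. (N ** M x) $ i $ i) z)"
    by (rule dd_det_mat1[OF dN N(1)])
  also have "\<dots> = (\<Sum>i\<in>UNIV. \<Sum>l\<in>UNIV. N $ i $ l * dd v (\<lambda>x. M x $ l $ i) z)"
  proof (rule sum.cong[OF refl])
    fix i
    have "((\<lambda>x. (N ** M x) $ i $ i) has_derivative (\<lambda>y. \<Sum>l\<in>UNIV. N $ i $ l * dd y (\<lambda>x. M x $ l $ i) z)) (at z)"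
      unfolding entry by (intro has_derivative_sum has_derivative_mult_right has_derivative_dd d)
    then show "dd v (\<lambda>x. (N ** M x) $ i $ i) z = (\<Sum>l\<in>UNIV. N $ i $ l * dd v (\<lambda>x. M x $ l $ i) z)"
      by (rule dd_eq)
  qed
  also have "(\<lambda>x. det (M z) * det (N ** M x)) = (\<lambda>x. det (M x))"
    by (rule ext) (rule detM[symmetric])
  finally show ?thesis unfolding N_def .
qed

text \<open>By Cramer's rule every entry of the inverse is a quotient of two determinants; in
  \<open>R\<close> the column \<open>k\<close> is replaced by a unit vector.\<close>

lemma differentiable_matrix_inv:
  fixes M :: "'v::real_normed_vector \<Rightarrow> complex^'n::finite^'n"
  assumes S: "open S" "z \<in> S" and d: "\<And>i j. (\<lambda>x. M x $ i $ j) differentiable at z"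
    and inv: "\<And>x. x \<in> S \<Longrightarrow> det (M x) \<noteq> 0"
  shows "(\<lambda>x. matrix_inv (M x) $ k $ l) differentiable at z"
proof -
  define R where "R = (\<lambda>x. \<chi> i j. if j = k then (axis l 1 :: complex^'n) $ i else M x $ i $ j)"
  have "matrix_inv (M x) $ k $ l = det (R x) * inverse (det (M x))" if "x \<in> S" for x
  proof -
    have "M x ** matrix_inv (M x) = mat 1"
      by (rule matrix_inv_right[OF inv[OF that]])
    then have "M x *v (\<chi> i. matrix_inv (M x) $ i $ l) = axis l 1"
      by (simp add: vec_eq_iff matrix_matrix_mult_def matrix_vector_mult_def mat_def axis_def)
    then have "(\<chi> i. matrix_inv (M x) $ i $ l) =
        (\<chi> k. det (\<chi> i j. if j = k then axis l 1 $ i else M x $ i $ j) / det (M x))"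
      using cramer[OF inv[OF that]] by blast
    from arg_cong[OF this, of "\<lambda>v. v $ k"] show ?thesis
      by (simp add: R_def divide_inverse)
  qed
  moreover have "(\<lambda>x. det (R x) * inverse (det (M x))) differentiable at z"
  proof (intro differentiable_mult differentiable_inverse differentiable_det d)
    show "(\<lambda>x. R x $ i $ j) differentiable at z" for i j
      using d[of i j] by (cases "j = k") (simp_all add: R_def)
    show "det (M z) \<noteq> 0" using inv S by simp
  qed
  ultimately show ?thesis
    using differentiable_cong_open[OF S, of "\<lambda>x. det (R x) * inverse (det (M x))"] by auto
qed

section \<open>The top exterior power of a (1,1)-form\<close>

text \<open>The value of the (1,1)-form on two vectors; for Hermitian \<open>G\<close> it is -2
  times the imaginary part of \<open>herm_prod G x y\<close>.\<close>

definition form11_pair :: "complex^'n^'n \<Rightarrow> complex^'n::finite \<Rightarrow> complex^'n \<Rightarrow> complex" where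
  "form11_pair G x y = \<i> * (herm_prod G x y - herm_prod G y x)"

lemma form11_eq: "form11 G v = form11_pair G (v 0) (v 1)"
proof -
  have *: "{\<sigma>. \<sigma> permutes {..<1 + 1 :: nat}} = {id, Transposition.transpose 0 1}"
  proof -
    have "{..<1 + 1 :: nat} = {0, 1}" by auto
    then show ?thesis using permutes_doubleton_iff[of _ "0::nat" 1] by auto
  qed
  have "id \<noteq> Transposition.transpose (0::nat) 1"
    by (metis id_apply transpose_apply_first zero_neq_one)
  then have w: "wedge 1 1 (dz i) (dzbar j) v = v 0 $ i * cnj (v 1 $ j) - v 1 $ i * cnj (v 0 $ j)" for i j
    unfolding wedge_def * by (simp add: dz_def dzbar_def sign_swap_id)
  show ?thesis
    unfolding form11_def form11_pair_def w herm_prod_def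
    by (simp add: right_diff_distrib sum_subtractf mult_ac)
qed

text \<open>Every term in the expansion of the power uses each of the vectors \<open>v 0\<close>,
  ..., \<open>v (2 * k - 1)\<close> in exactly one pairing, so the factors \<open>t\<close> always
  collect to the same product.\<close>

lemma wedge_power_rescale:
  assumes "\<And>r s. r < 2 * k \<Longrightarrow> s < 2 * k \<Longrightarrow>
    form11_pair H (v r) (v s) = t r * t s * form11_pair G (v r) (v s)"
  shows "wedge_power k (form11 H) v = (\<Prod>r<2 * k. t r) * wedge_power k (form11 G) v"
  using assms
proof (induction k arbitrary: v t)
  case (Suc k)
  have "of_int (sign \<sigma>) * form11 H (\<lambda>i. v (\<sigma> i)) * wedge_power k (form11 H) (\<lambda>i. v (\<sigma> (2 + i)))
      = (\<Prod>r<2 * Suc k. t r) * (of_int (sign \<sigma>) * form11 G (\<lambda>i. v (\<sigma> i)) * wedge_power k (form11 G) (\<lambda>i. v (\<sigma> (2 + i))))"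
    if \<sigma>: "\<sigma> permutes {..<2 + 2 * k}" for \<sigma>
  proof -
    have lt: "\<sigma> r < 2 * Suc k" if "r < 2 * Suc k" for r
      using permutes_in_image[OF \<sigma>, of r] that by auto
    have 1: "wedge_power k (form11 H) (\<lambda>i. v (\<sigma> (2 + i)))
      = (\<Prod>r<2 * k. t (\<sigma> (2 + r))) * wedge_power k (form11 G) (\<lambda>i. v (\<sigma> (2 + i)))"
      by (rule Suc.IH) (rule Suc.prems; rule lt; simp)
    have 2: "form11 H (\<lambda>i. v (\<sigma> i)) = t (\<sigma> 0) * t (\<sigma> 1) * form11 G (\<lambda>i. v (\<sigma> i))"
      unfolding form11_eq by (rule Suc.prems; rule lt; simp)
    have "(\<Prod>r<2 * Suc k. t r) = (\<Prod>r<2 + 2 * k. t (\<sigma> r))"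
      using prod.permute[OF \<sigma>, of t] by (simp add: o_def)
    also have "\<dots> = t (\<sigma> 0) * t (\<sigma> 1) * (\<Prod>r<2 * k. t (\<sigma> (2 + r)))"
      by (simp add: prod.lessThan_Suc_shift del: prod.lessThan_Suc)
    finally show ?thesis unfolding 1 2 by (simp only: mult_ac)
  qed
  then have "(\<Sum>\<sigma> | \<sigma> permutes {..<2 + 2 * k}. of_int (sign \<sigma>) * form11 H (\<lambda>i. v (\<sigma> i)) * wedge_power k (form11 H) (\<lambda>i. v (\<sigma> (2 + i))))
      = (\<Sum>\<sigma> | \<sigma> permutes {..<2 + 2 * k}. (\<Prod>r<2 * Suc k. t r) *
        (of_int (sign \<sigma>) * form11 G (\<lambda>i. v (\<sigma> i)) * wedge_power k (form11 G) (\<lambda>i. v (\<sigma> (2 + i)))))"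
    by (intro sum.cong refl) (simp only: mem_Collect_eq)
  then show ?case
    by (simp only: wedge_power.simps wedge_def sum_distrib_left[symmetric] times_divide_eq_right)
qed simp

text \<open>A permutation of the last \<open>q\<close> places extends to one that fixes 0 and 1 and
  has the same sign. Composing with it only reorders the sum over \<sigma>.\<close>

lemma sum_permutes_shift_two:
  fixes f :: "(nat \<Rightarrow> nat) \<Rightarrow> 'b::comm_ring_1"
  assumes \<tau>: "\<tau> permutes {..<q}"
    and f: "\<And>\<sigma> \<sigma>'. (\<And>i. i < 2 + q \<Longrightarrow> \<sigma> i = \<sigma>' i) \<Longrightarrow> f \<sigma> = f \<sigma>'"
  shows "(\<Sum>\<sigma> | \<sigma> permutes {..<2 + q}. of_int (sign \<sigma>) * of_int (sign \<tau>) *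
      f (\<lambda>i. if i < 2 then \<sigma> i else \<sigma> (2 + \<tau> (i - 2))))
    = (\<Sum>\<sigma> | \<sigma> permutes {..<2 + q}. of_int (sign \<sigma>) * f \<sigma>)"
proof -
  define \<rho> where "\<rho> = map_permutation {..<q} (\<lambda>i. 2 + i) \<tau>"
  have inj: "inj_on ((+) 2) {..<q}" by auto
  have "bij_betw ((+) 2) {..<q} {2..<2 + q}"
    by (rule bij_betwI[where g = "\<lambda>i. i - 2"]) auto
  then have \<rho>: "\<rho> permutes {2..<2 + q}"
    unfolding \<rho>_def by (rule map_permutation_permutes[OF _ \<tau>])
  then have \<rho>': "\<rho> permutes {..<2 + q}" by (rule permutes_subset) auto
  have sgn: "sign \<rho> = sign \<tau>"
    unfolding \<rho>_def by (rule sign_map_permutation[OF inj \<tau>]) simp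
  have \<rho>2: "\<rho> i = 2 + \<tau> (i - 2)" if "\<not> i < 2" "i < 2 + q" for i
  proof -
    have i: "i = 2 + (i - 2)" "i - 2 \<in> {..<q}" using that by auto
    have "\<rho> (2 + (i - 2)) = 2 + \<tau> (i - 2)"
      unfolding \<rho>_def by (rule map_permutation_apply[OF inj i(2)])
    then show ?thesis using i(1) by simp
  qed
  have \<rho>1: "\<rho> i = i" if "i < 2" for i
    using permutes_not_in[OF \<rho>, of i] that by auto
  have "(\<Sum>\<sigma> | \<sigma> permutes {..<2 + q}. of_int (sign \<sigma>) * f \<sigma>)
      = (\<Sum>\<sigma> | \<sigma> permutes {..<2 + q}. of_int (sign (\<sigma> \<circ> \<rho>)) * f (\<sigma> \<circ> \<rho>))"
    by (rule sum_permutations_compose_right[OF \<rho>'])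
  also have "\<dots> = (\<Sum>\<sigma> | \<sigma> permutes {..<2 + q}. of_int (sign \<sigma>) * of_int (sign \<tau>) *
      f (\<lambda>i. if i < 2 then \<sigma> i else \<sigma> (2 + \<tau> (i - 2))))"
  proof (rule sum.cong[OF refl])
    fix \<sigma> assume "\<sigma> \<in> {\<sigma>. \<sigma> permutes {..<2 + q}}"
    then have "sign (\<sigma> \<circ> \<rho>) = sign \<sigma> * sign \<tau>"
      using permutes_imp_permutation[OF finite_lessThan] \<rho>' by (simp add: sign_compose sgn)
    moreover have "f (\<sigma> \<circ> \<rho>) = f (\<lambda>i. if i < 2 then \<sigma> i else \<sigma> (2 + \<tau> (i - 2)))"
      by (rule f) (simp add: \<rho>1 \<rho>2)
    ultimately show "of_int (sign (\<sigma> \<circ> \<rho>)) * f (\<sigma> \<circ> \<rho>) = of_int (sign \<sigma>) * of_int (sign \<tau>) *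
      f (\<lambda>i. if i < 2 then \<sigma> i else \<sigma> (2 + \<tau> (i - 2)))" by simp
  qed
  finally show ?thesis ..
qed

text \<open>The recursion produces nested sums over permutations. Each inner permutation is absorbed
  into the outer one, so all \<open>fact q\<close> inner terms contribute the same amount. What
  remains is, up to a factor, the Pfaffian of the matrix of pairings; of the constant only
  \<open>c \<noteq> 0\<close> matters later.\<close>

lemma wedge_power_pfaffian:
  "\<exists>c. c \<noteq> 0 \<and> (\<forall>v. wedge_power k (form11 G) v = c * (\<Sum>\<sigma> | \<sigma> permutes {..<2 * k}.
     of_int (sign \<sigma>) * (\<Prod>m<k. form11_pair G (v (\<sigma> (2 * m))) (v (\<sigma> (2 * m + 1))))))"
proof (induction k)
  case 0
  show ?case by (intro exI[of _ 1]) simp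
next
  case (Suc k)
  then obtain c where c: "c \<noteq> 0" and IH: "\<And>v. wedge_power k (form11 G) v = c * (\<Sum>\<sigma> | \<sigma> permutes {..<2 * k}.
     of_int (sign \<sigma>) * (\<Prod>m<k. form11_pair G (v (\<sigma> (2 * m))) (v (\<sigma> (2 * m + 1)))))"
    by blast
  define q where "q = 2 * k"
  define d where "d = c / (fact 2 * fact q)"
  have "wedge_power (Suc k) (form11 G) v = (d * fact q) * (\<Sum>\<sigma> | \<sigma> permutes {..<2 * Suc k}.
     of_int (sign \<sigma>) * (\<Prod>m<Suc k. form11_pair G (v (\<sigma> (2 * m))) (v (\<sigma> (2 * m + 1)))))" for v
  proof -
    define f where "f = (\<lambda>\<sigma>. \<Prod>m<Suc k. form11_pair G (v (\<sigma> (2 * m))) (v (\<sigma> (2 * m + 1))))"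
    have f_cong: "f \<sigma> = f \<sigma>'" if "\<And>i. i < 2 + q \<Longrightarrow> \<sigma> i = \<sigma>' i" for \<sigma> \<sigma>'
      unfolding f_def using that by (intro prod.cong refl) (simp add: q_def)
    have trm: "form11 G (\<lambda>i. v (\<sigma> i)) *
        (\<Prod>m<k. form11_pair G (v (\<sigma> (2 + \<tau> (2 * m)))) (v (\<sigma> (2 + \<tau> (2 * m + 1)))))
      = f (\<lambda>i. if i < 2 then \<sigma> i else \<sigma> (2 + \<tau> (i - 2)))" for \<sigma> \<tau>
      unfolding f_def form11_eq prod.lessThan_Suc_shift by simp
    have "wedge_power (Suc k) (form11 G) v = (\<Sum>\<sigma> | \<sigma> permutes {..<2 + q}.
        of_int (sign \<sigma>) * form11 G (\<lambda>i. v (\<sigma> i)) * (c * (\<Sum>\<tau> | \<tau> permutes {..<q}.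
        of_int (sign \<tau>) * (\<Prod>m<k. form11_pair G (v (\<sigma> (2 + \<tau> (2 * m)))) (v (\<sigma> (2 + \<tau> (2 * m + 1)))))))) / (fact 2 * fact q)"
      unfolding wedge_power.simps wedge_def IH q_def ..
    also have "\<dots> = d * (\<Sum>\<sigma> | \<sigma> permutes {..<2 + q}. \<Sum>\<tau> | \<tau> permutes {..<q}.
        of_int (sign \<sigma>) * of_int (sign \<tau>) * f (\<lambda>i. if i < 2 then \<sigma> i else \<sigma> (2 + \<tau> (i - 2))))"
      unfolding trm[symmetric] d_def
      by (simp add: sum_distrib_left sum_distrib_right sum_divide_distrib mult_ac)
    also have "\<dots> = d * (\<Sum>\<tau> | \<tau> permutes {..<q}. \<Sum>\<sigma> | \<sigma> permutes {..<2 + q}.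
        of_int (sign \<sigma>) * of_int (sign \<tau>) * f (\<lambda>i. if i < 2 then \<sigma> i else \<sigma> (2 + \<tau> (i - 2))))"
      by (subst sum.swap) (rule refl)
    also have "\<dots> = d * (\<Sum>\<tau> | \<tau> permutes {..<q}. \<Sum>\<sigma> | \<sigma> permutes {..<2 + q}. of_int (sign \<sigma>) * f \<sigma>)"
    proof (rule arg_cong[where f = "(*) d"], rule sum.cong[OF refl])
      fix \<tau> assume "\<tau> \<in> {\<tau>. \<tau> permutes {..<q}}"
      then show "(\<Sum>\<sigma> | \<sigma> permutes {..<2 + q}. of_int (sign \<sigma>) * of_int (sign \<tau>) *
          f (\<lambda>i. if i < 2 then \<sigma> i else \<sigma> (2 + \<tau> (i - 2))))
        = (\<Sum>\<sigma> | \<sigma> permutes {..<2 + q}. of_int (sign \<sigma>) * f \<sigma>)"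
        using sum_permutes_shift_two[of \<tau> q f] f_cong by blast
    qed
    also have "\<dots> = d * (fact q * (\<Sum>\<sigma> | \<sigma> permutes {..<2 + q}. of_int (sign \<sigma>) * f \<sigma>))"
      by (simp add: card_permutations[OF refl])
    finally show ?thesis by (simp add: f_def q_def mult.assoc)
  qed
  moreover have "d * fact q \<noteq> 0" using c by (simp add: d_def)
  ultimately show ?case by blast
qed

text \<open>The standard symplectic pairing in the basis \<open>x\<^sub>0, y\<^sub>0, x\<^sub>1, y\<^sub>1, \<dots>\<close>.\<close>

definition symp :: "nat \<Rightarrow> nat \<Rightarrow> int" where
  "symp r s = (if even r \<and> s = Suc r then 1 else if even s \<and> r = Suc s then -1 else 0)"

lemma symp_alt: "symp r s = (if r div 2 = s div 2 then int (s mod 2) - int (r mod 2) else 0)"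
proof -
  have *: "symp (2 * a + b) (2 * c + d) = (if a = c then int d - int b else 0)"
    if "b = 0 \<or> b = 1" "d = 0 \<or> d = 1" for a b c d
    using that
  proof (elim disjE)
    assume "b = 0" "d = 0"
    then show ?thesis by (simp add: symp_def)
  next
    assume "b = 0" "d = 1"
    then show ?thesis by (simp add: symp_def)
  next
    assume "b = 1" "d = 0"
    then show ?thesis by (simp add: symp_def)
  next
    assume "b = 1" "d = 1"
    then show ?thesis by (simp add: symp_def)
  qed
  have "symp (2 * (r div 2) + r mod 2) (2 * (s div 2) + s mod 2)
      = (if r div 2 = s div 2 then int (s mod 2) - int (r mod 2) else 0)"
    by (rule *) linarith+
  then show ?thesis by simp
qed

text \<open>One signed term in the permutation expansion of the Pfaffian of the standard symplectic
  matrix, without the normalising factor.\<close>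

definition symp_term :: "nat \<Rightarrow> (nat \<Rightarrow> nat) \<Rightarrow> int" where
  "symp_term n \<sigma> = sign \<sigma> * (\<Prod>m<n. symp (\<sigma> (2 * m)) (\<sigma> (2 * m + 1)))"

lemma symp_term_fix_last:
  assumes "\<sigma> permutes {..<2 * Suc n}" "\<sigma> (2 * n) = 2 * n" "\<sigma> (2 * n + 1) = 2 * n + 1"
  shows "\<sigma> permutes {..<2 * n}" "symp_term (Suc n) \<sigma> = symp_term n \<sigma>"
proof -
  have "x = 2 * n \<or> x = 2 * n + 1" if "x \<in> {..<2 * Suc n} - {..<2 * n}" for x using that by auto
  then show "\<sigma> permutes {..<2 * n}"
    using assms by (intro permutes_superset[OF assms(1)]) auto
  show "symp_term (Suc n) \<sigma> = symp_term n \<sigma>"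
    using assms(2,3) by (simp add: symp_term_def symp_def)
qed

text \<open>Exchanging two coordinate planes is a symplectic map, and it is even because it is a
  product of two disjoint transpositions.\<close>

lemma symp_swap_blocks:
  assumes "j < n"
  defines "\<pi> \<equiv> Transposition.transpose (2 * j) (2 * n) \<circ> Transposition.transpose (2 * j + 1) (2 * n + 1)"
  shows "symp (\<pi> r) (\<pi> s) = symp r s" "sign \<pi> = 1" "\<pi> permutes {..<2 * Suc n}"
    "\<pi> (2 * j) = 2 * n" "\<pi> (2 * j + 1) = 2 * n + 1"
proof -
  have \<pi>: "\<pi> r = (if r div 2 = j then 2 * n + r mod 2 else if r div 2 = n then 2 * j + r mod 2 else r)" for r
  proof -
    have r: "r = 2 * (r div 2) + r mod 2" by simp
    have "r mod 2 = 0 \<or> r mod 2 = 1" by auto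
    then show ?thesis
      using assms(1) r unfolding \<pi>_def o_def Transposition.transpose_def by (auto split: if_splits)
  qed
  show "symp (\<pi> r) (\<pi> s) = symp r s"
    unfolding symp_alt \<pi> using assms(1) by auto
  show "sign \<pi> = 1"
    unfolding \<pi>_def using assms(1) by (subst sign_compose) (auto simp: permutation_swap_id sign_swap_id)
  show "\<pi> permutes {..<2 * Suc n}"
    unfolding \<pi>_def using assms(1) by (intro permutes_compose permutes_swap_id) auto
  show "\<pi> (2 * j) = 2 * n" "\<pi> (2 * j + 1) = 2 * n + 1" unfolding \<pi> by auto
qed

text \<open>Used with \<open>e = 1\<close> for an exchange of two planes and with
  \<open>e = -1\<close> for the swap inside the last plane, where the sign of the permutation and
  the last factor change together.\<close>

lemma symp_term_compose:
  assumes "\<sigma> permutes {..<2 * Suc n}" "\<pi> permutes {..<2 * Suc n}"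
    and e: "\<And>m. m < Suc n \<Longrightarrow> symp (\<pi> (\<sigma> (2 * m))) (\<pi> (\<sigma> (2 * m + 1)))
      = (if m = n then e else 1) * symp (\<sigma> (2 * m)) (\<sigma> (2 * m + 1))"
    and sgn: "sign \<pi> = e" "e * e = 1"
  shows "symp_term (Suc n) (\<pi> \<circ> \<sigma>) = symp_term (Suc n) \<sigma>"
proof -
  have "sign (\<pi> \<circ> \<sigma>) = e * sign \<sigma>"
    using permutes_imp_permutation[OF finite_lessThan] assms(1,2) by (simp add: sign_compose sgn)
  moreover have "(\<Prod>m<Suc n. symp ((\<pi> \<circ> \<sigma>) (2 * m)) ((\<pi> \<circ> \<sigma>) (2 * m + 1)))
      = e * (\<Prod>m<Suc n. symp (\<sigma> (2 * m)) (\<sigma> (2 * m + 1)))"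
  proof -
    have "(\<Prod>m<n. symp ((\<pi> \<circ> \<sigma>) (2 * m)) ((\<pi> \<circ> \<sigma>) (2 * m + 1))) = (\<Prod>m<n. symp (\<sigma> (2 * m)) (\<sigma> (2 * m + 1)))"
      using e by (intro prod.cong) auto
    then show ?thesis using e[of n] by simp
  qed
  ultimately show ?thesis using sgn(2) by (simp add: symp_term_def)
qed

text \<open>In a nonzero term the last pair of places is mapped onto a coordinate plane. An exchange
  of planes moves this plane to the end and, if the order inside it is reversed, a transposition
  corrects that; neither changes the term. Then the last plane is fixed pointwise and the induction
  hypothesis applies.\<close>

lemma symp_term_nonneg: "\<sigma> permutes {..<2 * n} \<Longrightarrow> 0 \<le> symp_term n \<sigma>"
proof (induction n arbitrary: \<sigma>)
  case (Suc n)
  show ?case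
  proof (cases "symp (\<sigma> (2 * n)) (\<sigma> (2 * n + 1)) = 0")
    case True
    then show ?thesis by (simp add: symp_term_def)
  next
    case False
    have lt: "\<sigma> (2 * n) < 2 * Suc n" "\<sigma> (2 * n + 1) < 2 * Suc n"
      using permutes_in_image[OF Suc.prems, of "2 * n"] permutes_in_image[OF Suc.prems, of "2 * n + 1"] by auto
    obtain j where j: "j \<le> n"
      "(\<sigma> (2 * n) = 2 * j \<and> \<sigma> (2 * n + 1) = 2 * j + 1) \<or> (\<sigma> (2 * n) = 2 * j + 1 \<and> \<sigma> (2 * n + 1) = 2 * j)"
    proof (cases "even (\<sigma> (2 * n)) \<and> \<sigma> (2 * n + 1) = Suc (\<sigma> (2 * n))")
      case True
      then show ?thesis using that[of "\<sigma> (2 * n) div 2"] lt by auto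
    next
      case 2: False
      then have "even (\<sigma> (2 * n + 1)) \<and> \<sigma> (2 * n) = Suc (\<sigma> (2 * n + 1))"
        using False by (auto simp: symp_def split: if_splits)
      then show ?thesis using that[of "\<sigma> (2 * n + 1) div 2"] lt by auto
    qed
    have "\<exists>\<sigma>1. \<sigma>1 permutes {..<2 * Suc n} \<and> symp_term (Suc n) \<sigma>1 = symp_term (Suc n) \<sigma> \<and>
      ((\<sigma>1 (2 * n) = 2 * n \<and> \<sigma>1 (2 * n + 1) = 2 * n + 1) \<or> (\<sigma>1 (2 * n) = 2 * n + 1 \<and> \<sigma>1 (2 * n + 1) = 2 * n))"
    proof (cases "j = n")
      case True
      then show ?thesis using j Suc.prems by (intro exI[of _ \<sigma>]) auto
    next
      case False
      then have jn: "j < n" using j by simp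
      define \<pi> where "\<pi> = Transposition.transpose (2 * j) (2 * n) \<circ> Transposition.transpose (2 * j + 1) (2 * n + 1)"
      note \<pi> = symp_swap_blocks[OF jn, folded \<pi>_def]
      have "symp_term (Suc n) (\<pi> \<circ> \<sigma>) = symp_term (Suc n) \<sigma>"
        using symp_term_compose[OF Suc.prems \<pi>(3), of 1] \<pi>(1,2) by simp
      then show ?thesis
        using j \<pi>(4,5) permutes_compose[OF Suc.prems \<pi>(3)] by (intro exI[of _ "\<pi> \<circ> \<sigma>"]) auto
    qed
    then obtain \<sigma>1 where \<sigma>1: "\<sigma>1 permutes {..<2 * Suc n}" "symp_term (Suc n) \<sigma>1 = symp_term (Suc n) \<sigma>"
      "(\<sigma>1 (2 * n) = 2 * n \<and> \<sigma>1 (2 * n + 1) = 2 * n + 1) \<or> (\<sigma>1 (2 * n) = 2 * n + 1 \<and> \<sigma>1 (2 * n + 1) = 2 * n)"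
      by blast
    have "\<exists>\<sigma>2. \<sigma>2 permutes {..<2 * Suc n} \<and> symp_term (Suc n) \<sigma>2 = symp_term (Suc n) \<sigma> \<and>
      \<sigma>2 (2 * n) = 2 * n \<and> \<sigma>2 (2 * n + 1) = 2 * n + 1"
    proof (cases "\<sigma>1 (2 * n) = 2 * n")
      case True
      then show ?thesis using \<sigma>1 by (intro exI[of _ \<sigma>1]) auto
    next
      case False
      then have s: "\<sigma>1 (2 * n) = 2 * n + 1" "\<sigma>1 (2 * n + 1) = 2 * n" using \<sigma>1(3) by auto
      define \<pi> where "\<pi> = Transposition.transpose (2 * n) (2 * n + 1)"
      have p: "\<pi> permutes {..<2 * Suc n}" unfolding \<pi>_def by (rule permutes_swap_id) auto
      have "symp (\<pi> (\<sigma>1 (2 * m))) (\<pi> (\<sigma>1 (2 * m + 1)))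
        = (if m = n then -1 else 1) * symp (\<sigma>1 (2 * m)) (\<sigma>1 (2 * m + 1))" if "m < Suc n" for m
      proof (cases "m = n")
        case True
        then show ?thesis using s by (simp add: \<pi>_def symp_def)
      next
        case False
        have "inj \<sigma>1" using \<sigma>1(1) permutes_inj by blast
        then have "\<sigma>1 r \<noteq> 2 * n \<and> \<sigma>1 r \<noteq> 2 * n + 1" if "r < 2 * n" for r
          using s that by (metis injD less_irrefl less_add_one not_less_iff_gr_or_eq trans_less_add1)
        then show ?thesis using that False by (simp add: \<pi>_def Transposition.transpose_def)
      qed
      then have "symp_term (Suc n) (\<pi> \<circ> \<sigma>1) = symp_term (Suc n) \<sigma>1"
        by (intro symp_term_compose[OF \<sigma>1(1) p, of "-1"]) (auto simp: \<pi>_def sign_swap_id)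
      then show ?thesis
        using s \<sigma>1(2) permutes_compose[OF \<sigma>1(1) p] by (intro exI[of _ "\<pi> \<circ> \<sigma>1"]) (auto simp: \<pi>_def)
    qed
    then show ?thesis using symp_term_fix_last Suc.IH by metis
  qed
qed (simp add: symp_term_def)

text \<open>There is no cancellation, and the identity contributes 1. This is what shows that the
  top power of a positive form does not vanish.\<close>

lemma sum_symp_term_pos: "0 < (\<Sum>\<sigma> | \<sigma> permutes {..<2 * n}. symp_term n \<sigma>)"
proof -
  have "symp_term n id = 1" by (simp add: symp_term_def symp_def)
  moreover have "symp_term n id \<le> (\<Sum>\<sigma> | \<sigma> permutes {..<2 * n}. symp_term n \<sigma>)"
    by (rule member_le_sum) (auto simp: permutes_id[unfolded id_def] symp_term_nonneg finite_permutations)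
  ultimately show ?thesis by simp
qed

text \<open>Both top powers are evaluated on the real basis underlying a frame that diagonalises
  \<open>G\<close> and \<open>H\<close> together. Passing from \<open>G\<close> to \<open>H\<close>
  multiplies the value by the product of the \<open>lam i\<close>, which is also the quotient of the
  determinants, and the value for \<open>G\<close> is nonzero.\<close>

lemma det_eq_of_wedge_power_eq:
  fixes G H :: "complex^'n::finite^'n"
  assumes G: "hermitian_pos_def G" and H: "hermitian_pos_def H"
    and eq: "\<And>v. wedge_power CARD('n) (form11 H) v = c * wedge_power CARD('n) (form11 G) v"
  shows "det H = c * det G"
proof -
  have Hsym: "H $ i $ j = cnj (H $ j $ i)" for i j using H unfolding hermitian_pos_def_def by blast
  obtain a lam where a: "unitary_frame G a"
    and lam: "\<forall>i j. herm_prod H (a i) (a j) = (if i = j then of_real (lam i) else 0)"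
    using simultaneous_diagonalization[OF G Hsym] by (elim exE conjE) (rule that)
  have Ha: "herm_prod H (a i) (a j) = (if i = j then of_real (lam i) else 0)" for i j
    using lam by blast
  have Ga: "herm_prod G (a i) (a j) = (if i = j then 1 else 0)" for i j
    using a unfolding unitary_frame_def by blast
  have pos: "lam i > 0" for i by (rule diagonalization_pos[OF H a Ha])
  define n where "n = CARD('n)"
  obtain e where e: "bij_betw e {..<n} (UNIV :: 'n set)"
    using ex_bij_betw_nat_finite[of "UNIV :: 'n set"] by (auto simp: n_def atLeast0LessThan)
  \<comment> \<open>The basis lists \<open>a (e k)\<close> and its multiple by the imaginary unit
    alternately, so the pairing for \<open>G\<close> becomes twice \<open>symp\<close>. The square
    roots in \<open>t\<close> are chosen so that the two vectors of one plane together contribute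
    the factor \<open>lam (e k)\<close>.\<close>
  define v where "v = (\<lambda>r. (if even r then 1 else \<i>) *s a (e (r div 2)))"
  define t where "t = (\<lambda>r. of_real (sqrt (lam (e (r div 2)))) :: complex)"
  have e_inj: "e (r div 2) = e (s div 2) \<longleftrightarrow> r div 2 = s div 2" if "r < 2 * n" "s < 2 * n" for r s
    using bij_betw_imp_inj_on[OF e] that by (auto simp: inj_on_eq_iff)
  have pair: "form11_pair G (v r) (v s) = 2 * of_int (symp r s)" if "r < 2 * n" "s < 2 * n" for r s
  proof -
    have sr: "symp r s = (if r div 2 = s div 2 then (if even r then 1 else 0) - (if even s then 1 else 0) else 0)"
      unfolding symp_alt by (auto simp: odd_iff_mod_2_eq_one even_iff_mod_2_eq_zero)
    show ?thesis
      unfolding form11_pair_def v_def sr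
      by (auto simp: herm_prod_smult_left herm_prod_smult_right Ga e_inj[OF that] e_inj[OF that(2,1)] complex_eq_iff)
  qed
  have scale: "form11_pair H (v r) (v s) = t r * t s * form11_pair G (v r) (v s)"
    if "r < 2 * n" "s < 2 * n" for r s
  proof (cases "r div 2 = s div 2")
    case True
    have "of_real (lam (e (s div 2))) = t r * t s"
      unfolding t_def True of_real_mult[symmetric] using pos[of "e (s div 2)"] by simp
    then show ?thesis
      unfolding form11_pair_def v_def True
      by (simp add: herm_prod_smult_left herm_prod_smult_right Ga Ha right_diff_distrib mult_ac)
  next
    case False
    then have "e (r div 2) \<noteq> e (s div 2)" using e_inj[OF that] by simp
    then show ?thesis unfolding form11_pair_def v_def
      by (simp add: herm_prod_smult_left herm_prod_smult_right Ga Ha)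
  qed
  have t_prod: "(\<Prod>r<2 * n. t r) = (\<Prod>i\<in>UNIV. of_real (lam i))"
  proof -
    have "(\<Prod>r<2 * m. t r) = (\<Prod>k<m. of_real (lam (e k)))" for m
    proof (induction m)
      case (Suc m)
      have "t (2 * m) * t (Suc (2 * m)) = of_real (lam (e m))"
        unfolding t_def of_real_mult[symmetric] using pos[of "e m"] by simp
      with Suc show ?case by (simp add: mult.assoc)
    qed simp
    then show ?thesis
      using prod.reindex_bij_betw[OF e, of "\<lambda>i. of_real (lam i) :: complex"] by simp
  qed
  obtain d where d: "d \<noteq> 0" "\<And>v. wedge_power n (form11 G) v = d * (\<Sum>\<sigma> | \<sigma> permutes {..<2 * n}.
     of_int (sign \<sigma>) * (\<Prod>m<n. form11_pair G (v (\<sigma> (2 * m))) (v (\<sigma> (2 * m + 1)))))"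
    using wedge_power_pfaffian[of n G] by blast
  have "wedge_power n (form11 G) v = d * (\<Sum>\<sigma> | \<sigma> permutes {..<2 * n}. 2 ^ n * of_int (symp_term n \<sigma>))"
    unfolding d(2)
  proof (rule arg_cong[where f = "(*) d"], rule sum.cong[OF refl])
    fix \<sigma> assume "\<sigma> \<in> {\<sigma>. \<sigma> permutes {..<2 * n}}"
    then have lt: "\<sigma> r < 2 * n" if "r < 2 * n" for r
      using permutes_in_image[of \<sigma> "{..<2 * n}" r] that by auto
    have "(\<Prod>m<n. form11_pair G (v (\<sigma> (2 * m))) (v (\<sigma> (2 * m + 1)))) =
        (\<Prod>m<n. 2 * of_int (symp (\<sigma> (2 * m)) (\<sigma> (2 * m + 1))))"
      by (intro prod.cong refl pair lt) auto
    then show "of_int (sign \<sigma>) * (\<Prod>m<n. form11_pair G (v (\<sigma> (2 * m))) (v (\<sigma> (2 * m + 1)))) =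
        2 ^ n * of_int (symp_term n \<sigma>)"
      by (simp add: symp_term_def prod.distrib)
  qed
  also have "\<dots> = d * 2 ^ n * of_int (\<Sum>\<sigma> | \<sigma> permutes {..<2 * n}. symp_term n \<sigma>)"
    by (simp add: sum_distrib_left mult.assoc)
  finally have nz: "wedge_power n (form11 G) v \<noteq> 0"
    using d(1) sum_symp_term_pos[of n] by (simp only: mult_eq_0_iff of_int_eq_0_iff) simp
  have "wedge_power n (form11 H) v = (\<Prod>i\<in>UNIV. of_real (lam i)) * wedge_power n (form11 G) v"
    using wedge_power_rescale[of n H v t G] scale t_prod by simp
  with nz eq[of v, folded n_def] have "c = (\<Prod>i\<in>UNIV. of_real (lam i))" by simp
  then show ?thesis using det_simultaneous[OF a Ha] by simp
qed

section \<open>Change of charts\<close>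

lemma smooth_on_of_real: "open S \<Longrightarrow> smooth_on f S \<Longrightarrow> smooth_on (\<lambda>w. complex_of_real (f w)) S"
  by (rule smooth_on_bounded_linear[OF _ bounded_linear_of_real])

lemma complex_hessian_form:
  assumes S: "open S" "z \<in> S" and f: "smooth_on f S"
  shows "herm_prod (complex_hessian f z) a b = del a (delbar b (\<lambda>w. complex_of_real (f w))) z"
proof -
  let ?f = "\<lambda>w. complex_of_real (f w)"
  have fc: "smooth_on ?f S" by (rule smooth_on_of_real[OF S(1) f])
  have d: "wirtbar j ?f differentiable at z" for j
    unfolding wirtbar_eq[abs_def] by (rule smooth_on_differentiable[OF smooth_on_wd[OF S(1) fc] S(2)])
  have "del a (delbar b ?f) z = del a (\<lambda>w. \<Sum>j\<in>UNIV. cnj (b $ j) * wirtbar j ?f w) z"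
    by (rule wd_cong_open[OF S]) (rule delbar_expand[OF smooth_on_differentiable[OF fc]])
  also have "\<dots> = (\<Sum>j\<in>UNIV. cnj (b $ j) * del a (wirtbar j ?f) z)"
    by (simp add: wd_sum wd_cmult d differentiable_mult)
  also have "\<dots> = (\<Sum>j\<in>UNIV. \<Sum>i\<in>UNIV. complex_hessian f z $ i $ j * a $ i * cnj (b $ j))"
    by (simp add: del_expand[OF d] complex_hessian_def sum_distrib_left mult_ac)
  also have "\<dots> = herm_prod (complex_hessian f z) a b"
    unfolding herm_prod_def by (rule sum.swap)
  finally show ?thesis ..
qed

lemma dd_of_real:
  fixes f :: "_ \<Rightarrow> real"
  shows "f differentiable at z \<Longrightarrow> dd v (\<lambda>w. complex_of_real (f w)) z = of_real (dd v f z)"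
  by (rule dd_bounded_linear[OF bounded_linear_of_real])

lemma differentiable_of_real:
  fixes f :: "_ \<Rightarrow> real"
  shows "f differentiable at z \<Longrightarrow> (\<lambda>w. complex_of_real (f w)) differentiable at z"
  by (rule differentiable_bounded_linear[OF bounded_linear_of_real])

lemma wd_of_real:
  "f differentiable at z \<Longrightarrow> wd e v (\<lambda>w. complex_of_real (f w)) z
    = (of_real (dd v f z) + e * of_real (dd (\<i> *s v) f z)) / 2"
  by (simp add: wd_def dd_of_real)

text \<open>The mixed second derivatives enter only the imaginary part, so their symmetry is not
  invoked. The regularity assumed is exactly what is established for \<open>Ur\<close>, to which
  this is applied besides smooth functions.\<close>

lemma Re_del_delbar:
  assumes S: "open S" "z \<in> S" and f: "\<And>w. w \<in> S \<Longrightarrow> f differentiable at w"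
    and ddf: "\<And>v. dd v f differentiable at z"
  shows "Re (del a (delbar a (\<lambda>w. complex_of_real (f w))) z) =
    (dd a (dd a f) z + dd (\<i> *s a) (dd (\<i> *s a) f) z) / 4"
proof -
  let ?h = "\<lambda>w. (1/2) * complex_of_real (dd a f w) + (\<i>/2) * complex_of_real (dd (\<i> *s a) f w)"
  have "dd v ?h z = (1/2) * of_real (dd v (dd a f) z) + (\<i>/2) * of_real (dd v (dd (\<i> *s a) f) z)" for v
  proof -
    note d = differentiable_of_real[OF ddf]
    note m = dd_bounded_linear[OF bounded_linear_mult_right d]
    show ?thesis
      unfolding dd_add[OF differentiable_mult[OF differentiable_const d] differentiable_mult[OF differentiable_const d]]
        m dd_of_real[OF ddf] ..
  qed
  note dh = this
  have "del a (delbar a (\<lambda>w. complex_of_real (f w))) z = del a ?h z"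
    by (rule wd_cong_open[OF S]) (simp add: wd_of_real[OF f] field_simps)
  then have "del a (delbar a (\<lambda>w. complex_of_real (f w))) z
      = (dd a ?h z + - \<i> * dd (\<i> *s a) ?h z) / 2" by (simp only: wd_def)
  then have "Re (del a (delbar a (\<lambda>w. complex_of_real (f w))) z)
      = Re ((dd a ?h z + - \<i> * dd (\<i> *s a) ?h z) / 2)" by (rule arg_cong)
  then show ?thesis unfolding dh by (simp add: field_simps)
qed

lemma Re_complex_hessian:
  assumes S: "open S" "z \<in> S" and f: "smooth_on f S"
  shows "Re (herm_prod (complex_hessian f z) a a) = (dd a (dd a f) z + dd (\<i> *s a) (dd (\<i> *s a) f) z) / 4"
  unfolding complex_hessian_form[OF S f]
  by (rule Re_del_delbar[OF S smooth_on_differentiable[OF f] smooth_on_differentiable[OF smooth_on_dd[OF f] S(2)]])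

section \<open>Second derivatives under a change of variables\<close>

lemmas dd_Basis_real = dd_Basis[where 'w = real, unfolded real_scaleR_def]

lemma has_real_derivative_along:
  fixes f :: "'v::euclidean_space \<Rightarrow> real"
  assumes "f differentiable at (\<gamma> s)" "(\<gamma> has_vector_derivative \<gamma>') (at s)"
  shows "((\<lambda>s. f (\<gamma> s)) has_real_derivative dd \<gamma>' f (\<gamma> s)) (at s)"
proof -
  have "((\<lambda>s. f (\<gamma> s)) has_derivative (\<lambda>h. dd (h *\<^sub>R \<gamma>') f (\<gamma> s))) (at s)"
    using diff_chain_at[OF assms(2)[unfolded has_vector_derivative_def] has_derivative_dd[OF assms(1)]]
    by (simp add: o_def)
  then show ?thesis
    by (simp add: dd_scaleR_dir[OF assms(1)] has_field_derivative_def mult_commute_abs)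
qed

text \<open>The second-order chain rule in terms of curves: a straight line for \<open>h\<close>
  becomes the curve \<gamma> for \<open>f\<close>, and its acceleration \<open>c\<close> contributes
  a first-order term.\<close>

lemma second_derivative_along:
  fixes f :: "'v::euclidean_space \<Rightarrow> real" and h :: "'u::real_normed_vector \<Rightarrow> real"
  assumes W: "open W" "z \<in> W" "smooth_on h W" and V: "open V" "smooth_on f V"
    and eps: "\<epsilon> > 0" "\<And>s. \<bar>s\<bar> < \<epsilon> \<Longrightarrow> z + s *\<^sub>R v \<in> W \<and> \<gamma> s \<in> V \<and> h (z + s *\<^sub>R v) = f (\<gamma> s)"
    and \<gamma>: "\<And>s. \<bar>s\<bar> < \<epsilon> \<Longrightarrow> (\<gamma> has_vector_derivative \<gamma>' s) (at s)" "(\<gamma>' has_vector_derivative c) (at 0)"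
  shows "dd v (dd v h) z = dd (\<gamma>' 0) (dd (\<gamma>' 0) f) (\<gamma> 0) + dd c f (\<gamma> 0)"
proof -
  define J where "J = {s :: real. \<bar>s\<bar> < \<epsilon>}"
  have J: "open J" "0 \<in> J"
    using eps(1) unfolding J_def by (auto intro!: open_Collect_less continuous_intros)
  have f: "f differentiable at (\<gamma> s)" if "s \<in> J" for s
    using eps(2)[of s] that smooth_on_differentiable[OF V(2)] by (auto simp: J_def)
  have ddf: "dd e f differentiable at (\<gamma> 0)" for e
    using eps(2)[of 0] eps(1) smooth_on_differentiable[OF smooth_on_dd[OF V(2)]] by auto
  have first: "dd v h (z + s *\<^sub>R v) = dd (\<gamma>' s) f (\<gamma> s)" if "s \<in> J" for s
  proof -
    have s: "\<bar>s\<bar> < \<epsilon>" using that by (simp add: J_def)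
    have "((\<lambda>s. h (z + s *\<^sub>R v)) has_real_derivative dd v h (z + s *\<^sub>R v)) (at s)"
      using eps(2)[OF s] smooth_on_differentiable[OF W(3)] by (intro has_real_derivative_line) auto
    moreover have "((\<lambda>s. f (\<gamma> s)) has_real_derivative dd (\<gamma>' s) f (\<gamma> s)) (at s)"
      by (rule has_real_derivative_along[OF f[OF that] \<gamma>(1)[OF s]])
    then have "((\<lambda>s. h (z + s *\<^sub>R v)) has_real_derivative dd (\<gamma>' s) f (\<gamma> s)) (at s)"
      by (rule has_field_derivative_transform_within_open[OF _ J(1) that]) (use eps(2) in \<open>auto simp: J_def\<close>)
    ultimately show ?thesis by (rule DERIV_unique)
  qed
  have 1: "((\<lambda>s. dd v h (z + s *\<^sub>R v)) has_real_derivative dd v (dd v h) z) (at 0)"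
    using has_real_derivative_line[of "dd v h" z 0 v] smooth_on_differentiable[OF smooth_on_dd[OF W(3)] W(2)] by simp
  have comp: "((\<lambda>s. \<gamma>' s \<bullet> e) has_real_derivative c \<bullet> e) (at 0)" for e
    using bounded_linear.has_vector_derivative[OF bounded_linear_inner_left \<gamma>(2)]
    by (simp add: has_real_derivative_iff_has_vector_derivative)
  \<comment> \<open>In \<open>dd (\<gamma>' s) f (\<gamma> s)\<close> both the direction and the
    point move with \<open>s\<close>; expanding the direction in a fixed basis turns this into a sum
    of ordinary products.\<close>
  have "((\<lambda>s. \<Sum>e\<in>Basis. (\<gamma>' s \<bullet> e) * dd e f (\<gamma> s)) has_real_derivative
      (\<Sum>e\<in>Basis. (c \<bullet> e) * dd e f (\<gamma> 0) + dd (\<gamma>' 0) (dd e f) (\<gamma> 0) * (\<gamma>' 0 \<bullet> e))) (at 0)"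
    using \<gamma>(1)[of 0] eps(1)
    by (intro DERIV_sum DERIV_mult comp has_real_derivative_along ddf) auto
  then have "((\<lambda>s. dd v h (z + s *\<^sub>R v)) has_real_derivative
      (\<Sum>e\<in>Basis. (c \<bullet> e) * dd e f (\<gamma> 0) + dd (\<gamma>' 0) (dd e f) (\<gamma> 0) * (\<gamma>' 0 \<bullet> e))) (at 0)"
    by (rule has_field_derivative_transform_within_open[OF _ J]) (simp add: first dd_Basis_real[OF f, symmetric])
  from DERIV_unique[OF 1 this] have "dd v (dd v h) z =
      (\<Sum>e\<in>Basis. (c \<bullet> e) * dd e f (\<gamma> 0)) + (\<Sum>e\<in>Basis. (\<gamma>' 0 \<bullet> e) * dd (\<gamma>' 0) (dd e f) (\<gamma> 0))"
    by (simp add: sum.distrib mult.commute)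
  also have "(\<Sum>e\<in>Basis. (c \<bullet> e) * dd e f (\<gamma> 0)) = dd c f (\<gamma> 0)"
    by (rule dd_Basis_real[symmetric, OF f[OF J(2)]])
  also have "(\<Sum>e\<in>Basis. (\<gamma>' 0 \<bullet> e) * dd (\<gamma>' 0) (dd e f) (\<gamma> 0)) = dd (\<gamma>' 0) (dd (\<gamma>' 0) f) (\<gamma> 0)"
  proof -
    have "((\<lambda>w. \<Sum>e\<in>Basis. (\<gamma>' 0 \<bullet> e) * dd e f w) has_derivative
        (\<lambda>y. \<Sum>e\<in>Basis. (\<gamma>' 0 \<bullet> e) * dd y (dd e f) (\<gamma> 0))) (at (\<gamma> 0))"
      by (intro has_derivative_sum has_derivative_mult_right has_derivative_dd ddf)
    then have "dd (\<gamma>' 0) (\<lambda>w. \<Sum>e\<in>Basis. (\<gamma>' 0 \<bullet> e) * dd e f w) (\<gamma> 0)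
        = (\<Sum>e\<in>Basis. (\<gamma>' 0 \<bullet> e) * dd (\<gamma>' 0) (dd e f) (\<gamma> 0))" by (rule dd_eq)
    moreover have "dd (\<gamma>' 0) (\<lambda>w. \<Sum>e\<in>Basis. (\<gamma>' 0 \<bullet> e) * dd e f w) (\<gamma> 0) = dd (\<gamma>' 0) (dd (\<gamma>' 0) f) (\<gamma> 0)"
      using eps(2)[of 0] eps(1)
      by (intro dd_cong_open[OF V(1)]) (auto simp: dd_Basis_real[OF smooth_on_differentiable[OF V(2)], of _ "\<gamma>' 0"])
    ultimately show ?thesis by simp
  qed
  finally show ?thesis by simp
qed

lemma bounded_linear_smult_axis: "bounded_linear (\<lambda>x :: complex. x *s (axis l 1 :: complex^'n::finite))"
  by (rule linear_conv_bounded_linear[THEN iffD1], rule linearI) (simp_all add: vec_eq_iff distrib_right)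

lemma has_vector_derivative_vec:
  fixes c :: "'n::finite \<Rightarrow> complex \<Rightarrow> complex"
  assumes "\<And>l. (c l has_field_derivative c' l) (at (u * of_real s))"
  shows "((\<lambda>s. \<chi> l. c l (u * of_real s)) has_vector_derivative u *s (\<chi> l. c' l)) (at s)"
proof -
  have 1: "((\<lambda>s. c l (u * of_real s)) has_vector_derivative u * c' l) (at s)" for l
  proof -
    have "((\<lambda>s. u * of_real s) has_vector_derivative u) (at s)"
      using has_vector_derivative_mult_right[OF has_vector_derivative_of_real[OF DERIV_ident], of u "at s"]
      by simp
    from field_vector_diff_chain_at[OF this assms[of l]] show ?thesis by (simp add: o_def)
  qed
  have *: "(\<chi> l. w l) = (\<Sum>l\<in>UNIV. w l *s axis l 1)" for w :: "'n \<Rightarrow> complex"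
    using basis_expansion[of "\<chi> l. w l"] by simp
  have "((\<lambda>s. \<Sum>l\<in>UNIV. c l (u * of_real s) *s axis l (1::complex)) has_vector_derivative
      (\<Sum>l\<in>UNIV. (u * c' l) *s axis l 1)) (at s)"
    by (intro has_vector_derivative_sum bounded_linear.has_vector_derivative[OF bounded_linear_smult_axis 1])
  then show ?thesis
    unfolding *[symmetric] by (simp add: vec_eq_iff vector_scalar_mult_def)
qed

text \<open>\<open>T\<close> is assumed only once differentiable, with complex linear derivative. On
  the complex line through \<open>z\<close> in direction \<open>v\<close> its components are
  holomorphic functions of one variable, so their second derivatives come for free, and they give
  accelerations of opposite sign along the two real directions of the line.\<close>

lemma complex_hessian_pullback:
  fixes f :: "complex^'n::finite \<Rightarrow> real" and T :: "complex^'n \<Rightarrow> complex^'n"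
  assumes W: "open W" "z \<in> W" "smooth_on h W" and V: "open V" "smooth_on f V"
    and T: "\<And>w. w \<in> W \<Longrightarrow> T w \<in> V \<and> h w = f (T w)"
    and D: "\<And>w. w \<in> W \<Longrightarrow> (T has_derivative D w) (at w)" "\<And>w c v. w \<in> W \<Longrightarrow> D w (c *s v) = c *s D w v"
  shows "Re (herm_prod (complex_hessian h z) v v) = Re (herm_prod (complex_hessian f (T z)) (D z v) (D z v))"
proof -
  define N where "N = (\<lambda>t. z + t *s v) -` W"
  have cont: "continuous_on UNIV (\<lambda>t. z + t *s v)"
    unfolding vector_scalar_mult_def by (intro continuous_intros)
  have N: "open N" "0 \<in> N"
    using open_vimage[OF W(1) cont] W(2) by (auto simp: N_def)
  define c where "c = (\<lambda>l t. T (z + t *s v) $ l)"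
  have c: "(c l has_field_derivative D (z + t *s v) v $ l) (at t)" if "t \<in> N" for l t
  proof -
    have "((\<lambda>t. z + t *s v) has_derivative (\<lambda>t. t *s v)) (at t)"
    proof -
      have "bounded_linear (\<lambda>t :: complex. t *s v)"
        by (rule linear_conv_bounded_linear[THEN iffD1], rule linearI) (simp_all add: vec_eq_iff distrib_right)
      then show ?thesis by (auto intro!: derivative_eq_intros bounded_linear_imp_has_derivative)
    qed
    from diff_chain_at[OF this D(1)] have "((\<lambda>t. T (z + t *s v)) has_derivative (\<lambda>h. D (z + t *s v) (h *s v))) (at t)"
      using that by (simp add: N_def o_def)
    from bounded_linear.has_derivative[OF bounded_linear_vec_nth this, of l]
    have "(c l has_derivative (\<lambda>h. h * D (z + t *s v) v $ l)) (at t)"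
      using that D(2) by (simp add: N_def c_def)
    then show ?thesis by (simp add: has_field_derivative_def mult_commute_abs)
  qed
  have hol: "c l holomorphic_on N" for l
    using c N(1) by (auto simp: holomorphic_on_open)
  have dc: "deriv (c l) t = D (z + t *s v) v $ l" if "t \<in> N" for l t
    by (rule DERIV_imp_deriv[OF c[OF that]])
  have c1: "(c l has_field_derivative deriv (c l) t) (at t)" if "t \<in> N" for l t
    using c[OF that] dc[OF that] by simp
  have c2: "(deriv (c l) has_field_derivative deriv (deriv (c l)) 0) (at 0)" for l
    by (rule holomorphic_derivI[OF holomorphic_deriv[OF hol N(1)] N])
  define c'' where "c'' = (\<chi> l. deriv (deriv (c l)) 0)"
  have c'0: "(\<chi> l. deriv (c l) 0) = D z v"
    using dc[OF N(2)] by (simp add: vec_eq_iff)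
  obtain r where r: "r > 0" "ball 0 r \<subseteq> N" using N open_contains_ball by blast
  \<comment> \<open>The terms with \<open>c''\<close> for \<open>u = 1\<close> and \<open>u = \<i>\<close> cancel.\<close>
  have key: "dd (u *s v) (dd (u *s v) h) z =
      dd (u *s D z v) (dd (u *s D z v) f) (T z) + dd ((u * u) *s c'') f (T z)" if u: "norm u = 1" for u
  proof -
    have inN: "u * of_real s \<in> N" if "\<bar>s\<bar> < r" for s
      using that u r(2) by (auto simp: norm_mult)
    have line: "z + s *\<^sub>R (u *s v) = z + (u * of_real s) *s v" for s
      by (simp add: vec_eq_iff scaleR_conv_of_real[where 'a = complex])
    have "dd (u *s v) (dd (u *s v) h) z =
        dd (u *s (\<chi> l. deriv (c l) (u * of_real 0))) (dd (u *s (\<chi> l. deriv (c l) (u * of_real 0))) f) (\<chi> l. c l (u * of_real 0))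
        + dd (u *s (u *s c'')) f (\<chi> l. c l (u * of_real 0))"
    proof (rule second_derivative_along[OF W V r(1),
          where \<gamma> = "\<lambda>s. \<chi> l. c l (u * of_real s)" and \<gamma>' = "\<lambda>s. u *s (\<chi> l. deriv (c l) (u * of_real s))"])
      fix s :: real assume s: "\<bar>s\<bar> < r"
      have "(\<chi> l. c l (u * of_real s)) = T (z + s *\<^sub>R (u *s v))"
        unfolding line by (simp add: c_def vec_eq_iff)
      moreover have "z + s *\<^sub>R (u *s v) \<in> W" using inN[OF s] by (simp add: line N_def)
      ultimately show "z + s *\<^sub>R (u *s v) \<in> W \<and> (\<chi> l. c l (u * of_real s)) \<in> V \<and>
          h (z + s *\<^sub>R (u *s v)) = f (\<chi> l. c l (u * of_real s))"
        using T by simp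
      show "((\<lambda>s. \<chi> l. c l (u * of_real s)) has_vector_derivative u *s (\<chi> l. deriv (c l) (u * of_real s))) (at s)"
        by (rule has_vector_derivative_vec[OF c1[OF inN[OF s]]])
    next
      have "((\<lambda>s. \<chi> l. deriv (c l) (u * of_real s)) has_vector_derivative u *s c'') (at 0)"
        unfolding c''_def by (rule has_vector_derivative_vec) (use c2 in simp)
      moreover have "bounded_linear (\<lambda>x :: complex^'n. u *s x)"
        by (rule linear_conv_bounded_linear[THEN iffD1], rule linearI) (simp_all add: vec_eq_iff distrib_left)
      ultimately show "((\<lambda>s. u *s (\<chi> l. deriv (c l) (u * of_real s))) has_vector_derivative u *s (u *s c'')) (at 0)"
        using bounded_linear.has_vector_derivative by blast
    qed
    moreover have "(\<chi> l. c l 0) = T z" by (simp add: c_def vec_eq_iff)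
    ultimately show ?thesis by (simp add: c'0 vector_smult_assoc)
  qed
  have Tz: "T z \<in> V" using T[OF W(2)] by simp
  have "(-1 :: complex) *s c'' = (-1) *\<^sub>R c''" by (simp add: vec_eq_iff)
  then have "dd ((-1 :: complex) *s c'') f (T z) = - dd c'' f (T z)"
    using dd_scaleR_dir[OF smooth_on_differentiable[OF V(2) Tz], of "-1" c''] by simp
  then have "dd v (dd v h) z + dd (\<i> *s v) (dd (\<i> *s v) h) z =
      dd (D z v) (dd (D z v) f) (T z) + dd (\<i> *s D z v) (dd (\<i> *s D z v) f) (T z)"
    using key[of 1] key[of \<i>] by (simp add: vector_smult_assoc)
  then show ?thesis
    unfolding Re_complex_hessian[OF W] Re_complex_hessian[OF V(1) Tz V(2)] by simp
qed

lemma chart_facts: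
  assumes M: "complex_manifold X \<A>" and \<kappa>: "\<kappa> \<in> \<A>"
  shows "openin X (fst \<kappa>)" "open (chart_image \<kappa>)" "fst \<kappa> \<subseteq> topspace X"
    "p \<in> fst \<kappa> \<Longrightarrow> chart_inv \<kappa> (snd \<kappa> p) = p"
    "p \<in> fst \<kappa> \<Longrightarrow> snd \<kappa> p \<in> chart_image \<kappa>"
    "z \<in> chart_image \<kappa> \<Longrightarrow> snd \<kappa> (chart_inv \<kappa> z) = z"
    "z \<in> chart_image \<kappa> \<Longrightarrow> chart_inv \<kappa> z \<in> fst \<kappa>"
    "openin X U \<Longrightarrow> U \<subseteq> fst \<kappa> \<Longrightarrow> open (snd \<kappa> ` U)"
    "open V \<Longrightarrow> openin X {p \<in> fst \<kappa>. snd \<kappa> p \<in> V}"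
proof -
  show 1: "openin X (fst \<kappa>)" and 2: "open (chart_image \<kappa>)"
    using M \<kappa> by (auto simp: complex_manifold_def)
  show 3: "fst \<kappa> \<subseteq> topspace X" using openin_subset[OF 1] .
  have hom: "homeomorphic_map (subtopology X (fst \<kappa>)) (top_of_set (chart_image \<kappa>)) (snd \<kappa>)"
    using M \<kappa> by (auto simp: complex_manifold_def)
  have top: "topspace (subtopology X (fst \<kappa>)) = fst \<kappa>" using 3 by auto
  have inj: "inj_on (snd \<kappa>) (fst \<kappa>)"
    using homeomorphic_imp_injective_map[OF hom] unfolding top .
  show "p \<in> fst \<kappa> \<Longrightarrow> chart_inv \<kappa> (snd \<kappa> p) = p"
    unfolding chart_inv_def by (rule inv_into_f_f[OF inj])
  show "p \<in> fst \<kappa> \<Longrightarrow> snd \<kappa> p \<in> chart_image \<kappa>" by (simp add: chart_image_def)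
  show "z \<in> chart_image \<kappa> \<Longrightarrow> snd \<kappa> (chart_inv \<kappa> z) = z"
    unfolding chart_inv_def chart_image_def by (rule f_inv_into_f)
  show "z \<in> chart_image \<kappa> \<Longrightarrow> chart_inv \<kappa> z \<in> fst \<kappa>"
    unfolding chart_inv_def chart_image_def by (rule inv_into_into)
  show "open (snd \<kappa> ` U)" if U: "openin X U" "U \<subseteq> fst \<kappa>"
  proof -
    have "openin (subtopology X (fst \<kappa>)) U"
      using U 1 by (simp add: openin_open_subtopology)
    then have "openin (top_of_set (chart_image \<kappa>)) (snd \<kappa> ` U)"
      using homeomorphic_imp_open_map[OF hom] unfolding open_map_def by blast
    then show ?thesis using 2 by (simp add: openin_open_eq)
  qed
  show "openin X {p \<in> fst \<kappa>. snd \<kappa> p \<in> V}" if V: "open V"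
  proof -
    have "continuous_map (subtopology X (fst \<kappa>)) euclidean (snd \<kappa>)"
      using homeomorphic_imp_continuous_map[OF hom] continuous_map_in_subtopology by blast
    then have "openin (subtopology X (fst \<kappa>)) {p \<in> topspace (subtopology X (fst \<kappa>)). snd \<kappa> p \<in> V}"
      using V unfolding continuous_map_def by simp
    then have "openin (subtopology X (fst \<kappa>)) {p \<in> fst \<kappa>. snd \<kappa> p \<in> V}"
      unfolding top .
    then show ?thesis using 1 by (simp add: openin_open_subtopology)
  qed
qed

text \<open>The derivative of the transition map is an isometry between the two representations of
  g, so it carries unitary frames to unitary frames, and the trace may be computed in any of them.
  Of the Hessian of \<phi> only the real diagonal values have to be transported.\<close>

lemma herm_trace_transition:
  fixes g :: "('a, 'n::finite) metric"
  assumes M: "complex_manifold X \<A>" and g: "hermitian_metric \<A> g" and \<phi>: "smooth_function \<A> \<phi>"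
    and \<kappa>: "\<kappa> \<in> \<A>" and \<mu>: "\<mu> \<in> \<A>" and p: "p \<in> fst \<kappa>" "p \<in> fst \<mu>"
  shows "herm_trace (g \<kappa> (snd \<kappa> p)) (perturbed_metric g \<phi> \<kappa> (snd \<kappa> p)) =
    herm_trace (g \<mu> (snd \<mu> p)) (perturbed_metric g \<phi> \<mu> (snd \<mu> p))"
proof -
  define W where "W = snd \<kappa> ` (fst \<kappa> \<inter> fst \<mu>)"
  define T where "T = transition \<kappa> \<mu>"
  define z where "z = snd \<kappa> p"
  note ck = chart_facts[OF M \<kappa>] and cm = chart_facts[OF M \<mu>]
  have W: "open W" unfolding W_def
    using ck(1) cm(1) by (intro ck(8) openin_Int) auto
  have zW: "z \<in> W" using p by (auto simp: W_def z_def)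
  have Wk: "W \<subseteq> chart_image \<kappa>" unfolding W_def chart_image_def by auto
  have T: "T (snd \<kappa> q) = snd \<mu> q" if "q \<in> fst \<kappa>" for q
    using that by (simp add: T_def transition_def ck(4))
  have TW: "T w \<in> chart_image \<mu> \<and> (\<phi> \<circ> chart_inv \<kappa>) w = (\<phi> \<circ> chart_inv \<mu>) (T w)" if "w \<in> W" for w
  proof -
    obtain q where q: "q \<in> fst \<kappa>" "q \<in> fst \<mu>" "w = snd \<kappa> q" using \<open>w \<in> W\<close> by (auto simp: W_def)
    then show ?thesis using T[OF q(1)] by (simp add: ck(4) cm(4) cm(5))
  qed
  have "holomorphic_map_on T W" using M \<kappa> \<mu> by (auto simp: complex_manifold_def T_def W_def)
  then have "\<forall>w\<in>W. \<exists>D. (T has_derivative D) (at w) \<and> (\<forall>c v. D (c *s v) = c *s D v)"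
    by (simp add: holomorphic_map_on_def)
  then obtain D where D': "\<forall>w\<in>W. (T has_derivative D w) (at w) \<and> (\<forall>c v. D w (c *s v) = c *s D w v)"
    by (rule bchoice[THEN exE])
  then have D: "\<And>w. w \<in> W \<Longrightarrow> (T has_derivative D w) (at w)" "\<And>w c v. w \<in> W \<Longrightarrow> D w (c *s v) = c *s D w v"
    by blast+
  have smooth_k: "smooth_on (\<phi> \<circ> chart_inv \<kappa>) (chart_image \<kappa>)" and smooth_m: "smooth_on (\<phi> \<circ> chart_inv \<mu>) (chart_image \<mu>)"
    using \<phi> \<kappa> \<mu> by (auto simp: smooth_function_def)
  have sub: "smooth_on h W" if "smooth_on h (chart_image \<kappa>)" for h :: "complex^'n \<Rightarrow> real"
  proof -
    have "Ck_on k h W" if "Ck_on k h (chart_image \<kappa>)" for k and h :: "complex^'n \<Rightarrow> real"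
      using that
    proof (induction k arbitrary: h)
      case 0 then show ?case using Wk continuous_on_subset by auto
    next
      case (Suc k) then show ?case using Wk by auto
    qed
    then show ?thesis using that by (simp add: smooth_on_def)
  qed
  have hess: "Re (herm_prod (complex_hessian (\<phi> \<circ> chart_inv \<kappa>) z) v v) =
      Re (herm_prod (complex_hessian (\<phi> \<circ> chart_inv \<mu>) (T z)) (D z v) (D z v))" for v
    by (rule complex_hessian_pullback[OF W zW sub[OF smooth_k] cm(2) smooth_m TW D])
  have wirt_T: "wirt i (\<lambda>w. T w $ k) z = D z (axis i 1) $ k" for i k
  proof -
    have "((\<lambda>w. T w $ k) has_derivative (\<lambda>v. D z v $ k)) (at z)"
      by (rule bounded_linear.has_derivative[OF bounded_linear_vec_nth D(1)[OF zW]])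
    then have "dd v (\<lambda>w. T w $ k) z = D z v $ k" for v by (rule dd_eq)
    moreover have "D z (\<i> *s axis i 1) = \<i> *s D z (axis i 1)" by (rule D(2)[OF zW])
    ultimately show ?thesis by (simp add: wirt_eq wd_def)
  qed
  have linD: "linear (D z)" by (rule has_derivative_linear[OF D(1)[OF zW]])
  have D_expand: "D z v = (\<Sum>i\<in>UNIV. v $ i *s D z (axis i 1))" for v
    using linear_sum[OF linD, of "\<lambda>i. v $ i *s axis i 1" UNIV] by (simp add: basis_expansion D(2)[OF zW])
  have gT: "g \<kappa> z $ i $ j = herm_prod (g \<mu> (T z)) (D z (axis i 1)) (D z (axis j 1))" for i j
  proof -
    have "g \<kappa> z $ i $ j =
          (\<Sum>k\<in>UNIV. \<Sum>l\<in>UNIV. g \<mu> (T z) $ k $ l *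
             wirt i (\<lambda>w. T w $ k) z * cnj (wirt j (\<lambda>w. T w $ l) z))"
      using g \<kappa> \<mu> zW unfolding hermitian_metric_def T_def W_def by blast
    then show ?thesis unfolding wirt_T herm_prod_def .
  qed
  have g_pull: "herm_prod (g \<kappa> z) u v = herm_prod (g \<mu> (T z)) (D z u) (D z v)" for u v
  proof -
    have "herm_prod (g \<mu> (T z)) (D z u) (D z v) = (\<Sum>j\<in>UNIV. \<Sum>i\<in>UNIV. g \<kappa> z $ i $ j * u $ i * cnj (v $ j))"
      unfolding D_expand[of u] D_expand[of v]
      by (simp add: herm_prod_sum_left herm_prod_sum_right herm_prod_smult_left herm_prod_smult_right gT
          sum_distrib_left mult_ac)
    also have "\<dots> = herm_prod (g \<kappa> z) u v"
      unfolding herm_prod_def by (rule sum.swap)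
    finally show ?thesis ..
  qed
  have pos: "hermitian_pos_def (g \<kappa> z)"
    using g \<kappa> zW Wk by (auto simp: hermitian_metric_def)
  then have sym: "g \<kappa> z $ i $ j = cnj (g \<kappa> z $ j $ i)" for i j
    unfolding hermitian_pos_def_def by blast
  obtain a where a: "unitary_frame (g \<kappa> z) a"
    using simultaneous_diagonalization[OF pos sym] by (elim exE conjE) (rule that)
  then have a': "unitary_frame (g \<mu> (T z)) (\<lambda>i. D z (a i))"
    by (simp add: unitary_frame_def g_pull)
  have "Re (herm_prod (perturbed_metric g \<phi> \<kappa> z) v v) = Re (herm_prod (perturbed_metric g \<phi> \<mu> (T z)) (D z v) (D z v))" for v
    by (simp add: perturbed_metric_def herm_prod_add_matrix hess g_pull)
  then have "herm_trace (g \<kappa> z) (perturbed_metric g \<phi> \<kappa> z) = herm_trace (g \<mu> (T z)) (perturbed_metric g \<phi> \<mu> (T z))"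
    unfolding herm_trace_frame[OF a] herm_trace_frame[OF a'] by simp
  moreover have "T z = snd \<mu> p" unfolding z_def by (rule T[OF p(1)])
  ultimately show ?thesis by (simp add: z_def)
qed

section \<open>The second-order inequality at a point\<close>

text \<open>The estimate for the Laplacian of log u as pure algebra at a point, in a frame where g
  is the identity and g' has eigenvalues \<open>lam\<close>. Here \<open>g1 i j k\<close> and
  \<open>h1 i j k\<close> stand for the derivatives in direction \<open>k\<close> of the components
  of g and g', \<open>g2 i k\<close> and \<open>h2 i k\<close> for the second derivatives of the
  diagonal components. The symmetries hold because g' - g is a complex Hessian, \<open>ma\<close> is
  the equation differentiated twice, and \<open>U1\<close>, \<open>U2\<close> are the derivatives of
  the trace \<open>U\<close>. In the conclusion \<open>5 * c\<^sup>2 * n\<^sup>2\<close> comes from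
  completing the square, \<open>n * b\<close> from \<open>ma\<close>, \<open>2 * c * n\<close> from
  interchanging indices and \<open>c\<close> from \<open>g2\<close>.\<close>

lemma second_order_algebra:
  fixes lam :: "'n::finite \<Rightarrow> real" and g1 h1 :: "'n \<Rightarrow> 'n \<Rightarrow> 'n \<Rightarrow> complex" and g2 h2 :: "'n \<Rightarrow> 'n \<Rightarrow> real"
  assumes lam: "\<And>i. 0 < lam i"
    and sym1: "\<And>i j k. h1 i j k - g1 i j k = h1 k j i - g1 k j i"
    and sym2: "\<And>i k. h2 i k - g2 i k = h2 k i - g2 k i"
    and b1: "\<And>i j k. norm (g1 i j k) \<le> c" and b2: "\<And>i k. \<bar>g2 i k\<bar> \<le> c"
    and ma: "\<And>i. - b \<le> (\<Sum>k\<in>UNIV. h2 k i / lam k) - (\<Sum>k\<in>UNIV. \<Sum>j\<in>UNIV. (norm (h1 k j i))\<^sup>2 / (lam k * lam j))"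
    and b: "0 \<le> b"
    and U: "U = (\<Sum>i\<in>UNIV. lam i)" "1 \<le> U" and s: "s = (\<Sum>i\<in>UNIV. 1 / lam i)"
    and U1: "\<And>k. U1 k = (\<Sum>i\<in>UNIV. h1 i i k) - (\<Sum>i\<in>UNIV. g1 i i k * lam i)"
    and U2: "\<And>k. U2 k = (\<Sum>i\<in>UNIV. h2 i k) - 2 * Re (\<Sum>i\<in>UNIV. \<Sum>j\<in>UNIV. cnj (g1 i j k) * h1 i j k)
      - (\<Sum>i\<in>UNIV. g2 i k * lam i)"
    and n: "n = real CARD('n)"
  shows "- (5 * c\<^sup>2 * n\<^sup>2 + n * b + 2 * c * n + c) * U * s - (4 * c * n / U) * (\<Sum>k\<in>UNIV. norm (U1 k) / lam k)
    \<le> (\<Sum>k\<in>UNIV. (U2 k - (norm (U1 k))\<^sup>2 / U) / lam k)"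
proof -
  have c: "0 \<le> c" using b1 norm_ge_zero order_trans by blast
  have n0: "0 \<le> n" by (simp add: n)
  have lamU: "lam i \<le> U" for i
    unfolding U by (rule member_le_sum) (auto simp: lam less_imp_le)
  have lams: "1 / lam i \<le> s" for i
    unfolding s by (rule member_le_sum) (auto simp: lam less_imp_le)
  have s0: "0 \<le> s" unfolding s by (intro sum_nonneg) (simp add: lam less_imp_le)
  \<comment> \<open>This and the next inequality lift every error to the common size
    \<open>U * s\<close>.\<close>
  have Us: "1 \<le> U * s"
  proof -
    fix i :: 'n
    have "1 = lam i * (1 / lam i)" using lam[of i] by simp
    also have "\<dots> \<le> U * s" using lamU[of i] lams[of i] lam[of i] U(2) by (intro mult_mono) auto
    finally show ?thesis .
  qed
  have sUs: "s \<le> U * s" using U(2) s0 by (simp add: mult_le_cancel_right1)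
  \<comment> \<open>\<open>T\<close> is the torsion of \<open>g\<close>; \<open>Y\<close> is, up to torsion, the Chern covariant derivative of \<open>g'\<close>,
    which completes the square in the third-order terms.\<close>
  define T where "T = (\<lambda>i k j. g1 k j i - g1 i j k)"
  define Y where "Y = (\<lambda>i k j. h1 k j i - g1 i j k * lam j)"
  define SY where "SY = (\<Sum>k\<in>UNIV. \<Sum>i\<in>UNIV. \<Sum>j\<in>UNIV. (norm (Y i k j))\<^sup>2 / (lam k * lam j))"
  have h1: "h1 i j k = h1 k j i - T i k j" for i j k
    using sym1[of i j k] by (simp add: T_def algebra_simps)
  have T: "norm (T i k j) \<le> 2 * c" for i k j
    unfolding T_def using norm_triangle_ineq4[of "g1 k j i" "g1 i j k"] b1[of k j i] b1[of i j k] by linarith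
  \<comment> \<open>Of the 5, one part comes from the square of \<open>g1\<close> left over when the
    square is completed, and four from its product with the torsion, raised by the factor
    \<open>U \<ge> 1\<close>.\<close>
  have pointwise: "(norm (Y i k j))\<^sup>2 / (lam k * lam j) - 5 * c\<^sup>2 * U / lam k
      \<le> (norm (h1 k j i))\<^sup>2 / (lam k * lam j) - 2 * Re (cnj (g1 i j k) * h1 i j k) / lam k" for i k j
  proof -
    let ?g = "g1 i j k" and ?h = "h1 k j i"
    have "(norm ?h)\<^sup>2 - 2 * lam j * Re (cnj ?g * (?h - T i k j))
      = (norm (?h - ?g * lam j))\<^sup>2 - (lam j)\<^sup>2 * (norm ?g)\<^sup>2 + 2 * lam j * Re (cnj ?g * T i k j)"
      unfolding cmod_power2 by (simp add: power2_eq_square algebra_simps)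
    then have eq: "(norm ?h)\<^sup>2 / (lam k * lam j) - 2 * Re (cnj ?g * h1 i j k) / lam k
      = (norm (Y i k j))\<^sup>2 / (lam k * lam j) - (lam j * (norm ?g)\<^sup>2 - 2 * Re (cnj ?g * T i k j)) / lam k"
      unfolding h1[of i j k] Y_def using lam[of k] lam[of j] by (simp add: field_simps power2_eq_square)
    have g: "(norm ?g)\<^sup>2 \<le> c\<^sup>2" by (rule power_mono[OF b1]) simp
    have "- Re (cnj ?g * T i k j) \<le> norm (cnj ?g * T i k j)"
      using abs_Re_le_cmod[of "cnj ?g * T i k j"] by linarith
    also have "\<dots> \<le> c * (2 * c)"
      unfolding norm_mult complex_mod_cnj by (intro mult_mono b1 T) (auto simp: c)
    finally have "- 2 * Re (cnj ?g * T i k j) \<le> 4 * c\<^sup>2" by (simp add: power2_eq_square)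
    moreover have "lam j * (norm ?g)\<^sup>2 \<le> U * c\<^sup>2"
      using lam[of j] U(2) by (intro mult_mono lamU g) auto
    moreover have "4 * c\<^sup>2 \<le> 4 * c\<^sup>2 * U" using U(2) by (simp add: mult_le_cancel_left1)
    ultimately have "lam j * (norm ?g)\<^sup>2 - 2 * Re (cnj ?g * T i k j) \<le> 5 * c\<^sup>2 * U" by (simp add: algebra_simps)
    then have "(lam j * (norm ?g)\<^sup>2 - 2 * Re (cnj ?g * T i k j)) / lam k \<le> 5 * c\<^sup>2 * U / lam k"
      using lam[of k] by (simp add: divide_right_mono)
    with eq show ?thesis by linarith
  qed
  have card: "(\<Sum>i\<in>(UNIV :: 'n set). x) = n * x" for x :: real by (simp add: n)
  define R where "R = (\<Sum>k\<in>UNIV. \<Sum>i\<in>UNIV. \<Sum>j\<in>UNIV. (norm (h1 k j i))\<^sup>2 / (lam k * lam j))"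
  define B where "B = (\<Sum>k\<in>UNIV. 2 * Re (\<Sum>i\<in>UNIV. \<Sum>j\<in>UNIV. cnj (g1 i j k) * h1 i j k) / lam k)"
  have "SY - 5 * c\<^sup>2 * n\<^sup>2 * U * s
     = (\<Sum>k\<in>UNIV. \<Sum>i\<in>UNIV. \<Sum>j\<in>UNIV. (norm (Y i k j))\<^sup>2 / (lam k * lam j) - 5 * c\<^sup>2 * U / lam k)"
    unfolding SY_def s sum_subtractf card by (simp add: sum_distrib_left power2_eq_square mult_ac)
  also have "\<dots> \<le> (\<Sum>k\<in>UNIV. \<Sum>i\<in>UNIV. \<Sum>j\<in>UNIV. (norm (h1 k j i))\<^sup>2 / (lam k * lam j) - 2 * Re (cnj (g1 i j k) * h1 i j k) / lam k)"
    by (intro sum_mono pointwise)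
  also have "\<dots> = R - B"
    unfolding R_def B_def sum_subtractf
    by (simp add: sum_distrib_left sum_divide_distrib)
  finally have RB: "SY - 5 * c\<^sup>2 * n\<^sup>2 * U * s \<le> R - B" .
  \<comment> \<open>Summing \<open>ma\<close> over \<open>i\<close> trades the third-order squares
    for second derivatives, but with the two indices in the wrong order; \<open>sym2\<close>
    interchanges them at the cost of \<open>2 * c\<close> each.\<close>
  have "R - n * b = (\<Sum>i\<in>UNIV. (\<Sum>k\<in>UNIV. \<Sum>j\<in>UNIV. (norm (h1 k j i))\<^sup>2 / (lam k * lam j)) - b)"
    unfolding R_def sum_subtractf card by (subst sum.swap) simp
  also have "\<dots> \<le> (\<Sum>i\<in>UNIV. \<Sum>k\<in>UNIV. h2 k i / lam k)"
  proof (rule sum_mono)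
    fix i show "(\<Sum>k\<in>UNIV. \<Sum>j\<in>UNIV. (norm (h1 k j i))\<^sup>2 / (lam k * lam j)) - b \<le> (\<Sum>k\<in>UNIV. h2 k i / lam k)"
      using ma[of i] by linarith
  qed
  also have "\<dots> = (\<Sum>k\<in>UNIV. \<Sum>i\<in>UNIV. h2 k i / lam k)" by (rule sum.swap)
  also have "\<dots> \<le> (\<Sum>k\<in>UNIV. \<Sum>i\<in>UNIV. h2 i k / lam k + 2 * c / lam k)"
  proof (intro sum_mono)
    fix i k
    have "h2 k i \<le> h2 i k + 2 * c" using sym2[of i k] b2[of i k] b2[of k i] by linarith
    then show "h2 k i / lam k \<le> h2 i k / lam k + 2 * c / lam k"
      unfolding add_divide_distrib[symmetric] using lam[of k] by (simp add: divide_right_mono)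
  qed
  also have "\<dots> = (\<Sum>k\<in>UNIV. \<Sum>i\<in>UNIV. h2 i k / lam k) + 2 * c * n * s"
    unfolding sum.distrib card s by (simp add: sum_distrib_left mult_ac)
  finally have Rh: "R - n * b \<le> (\<Sum>k\<in>UNIV. \<Sum>i\<in>UNIV. h2 i k / lam k) + 2 * c * n * s" .
  have "(\<Sum>k\<in>UNIV. (\<Sum>i\<in>UNIV. g2 i k * lam i) / lam k) \<le> (\<Sum>k\<in>UNIV. c * U / lam k)"
  proof (rule sum_mono)
    fix k
    have "(\<Sum>i\<in>UNIV. g2 i k * lam i) \<le> (\<Sum>i\<in>UNIV. c * lam i)"
    proof (rule sum_mono)
      fix i have "g2 i k \<le> c" using b2[of i k] by linarith
      then show "g2 i k * lam i \<le> c * lam i" using lam[of i] by (simp add: mult_right_mono)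
    qed
    also have "\<dots> = c * U" by (simp add: U(1) sum_distrib_left)
    finally show "(\<Sum>i\<in>UNIV. g2 i k * lam i) / lam k \<le> c * U / lam k"
      using lam[of k] by (simp add: divide_right_mono)
  qed
  also have "\<dots> = c * U * s" unfolding s by (simp add: sum_distrib_left)
  finally have G: "(\<Sum>k\<in>UNIV. (\<Sum>i\<in>UNIV. g2 i k * lam i) / lam k) \<le> c * U * s" .
  have "(\<Sum>k\<in>UNIV. U2 k / lam k) = (\<Sum>k\<in>UNIV. \<Sum>i\<in>UNIV. h2 i k / lam k) - B - (\<Sum>k\<in>UNIV. (\<Sum>i\<in>UNIV. g2 i k * lam i) / lam k)"
    unfolding U2 B_def diff_divide_distrib sum_subtractf by (simp add: sum_divide_distrib)
  moreover have "n * b \<le> n * b * (U * s)" using mult_left_mono[OF Us, of "n * b"] b n0 by simp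
  moreover have "2 * c * n * s \<le> 2 * c * n * (U * s)" using sUs c n0 by (intro mult_left_mono) auto
  ultimately have U2_lower: "SY - (5 * c\<^sup>2 * n\<^sup>2 + n * b + 2 * c * n + c) * U * s \<le> (\<Sum>k\<in>UNIV. U2 k / lam k)"
    using RB Rh G by (simp add: algebra_simps)
  \<comment> \<open>\<open>U1 k\<close> is the trace of \<open>Y\<close> up to the torsion trace
    \<open>t\<close>. The Cauchy-Schwarz inequality with weights \<open>lam i\<close>, whose sum is
    \<open>U\<close>, bounds the squared trace by \<open>U\<close> times the squares counted in
    \<open>SY\<close>. The cross term with \<open>t\<close> is what remains linear in the
    gradient.\<close>
  have grad: "(norm (U1 k))\<^sup>2 / U / lam k \<le> (\<Sum>i\<in>UNIV. \<Sum>j\<in>UNIV. (norm (Y i k j))\<^sup>2 / (lam k * lam j))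
      + (4 * c * n / U) * (norm (U1 k) / lam k)" for k
  proof -
    define t where "t = (\<Sum>i\<in>UNIV. T i k i)"
    have w: "(\<Sum>i\<in>UNIV. Y i k i) = U1 k + t"
      unfolding U1 t_def Y_def h1[of _ _ k] by (simp add: sum_subtractf)
    have "norm t \<le> (\<Sum>i\<in>(UNIV :: 'n set). 2 * c)"
      unfolding t_def by (rule sum_norm_le) (rule T)
    then have t: "norm t \<le> 2 * c * n" unfolding card by (simp add: mult_ac)
    have "(\<Sum>i\<in>UNIV. norm (Y i k i))\<^sup>2 = (\<Sum>i\<in>UNIV. sqrt (lam i) * (norm (Y i k i) / sqrt (lam i)))\<^sup>2"
      using lam by (simp add: less_imp_neq[symmetric])
    also have "\<dots> \<le> (\<Sum>i\<in>UNIV. (sqrt (lam i))\<^sup>2) * (\<Sum>i\<in>UNIV. (norm (Y i k i) / sqrt (lam i))\<^sup>2)"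
      by (rule Cauchy_Schwarz_ineq_sum)
    also have "\<dots> = U * (\<Sum>i\<in>UNIV. (norm (Y i k i))\<^sup>2 / lam i)"
      using lam by (simp add: U(1) power_divide less_imp_le)
    also have "\<dots> \<le> U * (\<Sum>i\<in>UNIV. \<Sum>j\<in>UNIV. (norm (Y i k j))\<^sup>2 / lam j)"
    proof (intro mult_left_mono sum_mono)
      fix i show "(norm (Y i k i))\<^sup>2 / lam i \<le> (\<Sum>j\<in>UNIV. (norm (Y i k j))\<^sup>2 / lam j)"
        by (rule member_le_sum[of i UNIV "\<lambda>j. (norm (Y i k j))\<^sup>2 / lam j"]) (auto simp: lam less_imp_le)
    qed (use U(2) in simp)
    finally have CS: "(\<Sum>i\<in>UNIV. norm (Y i k i))\<^sup>2 \<le> U * (\<Sum>i\<in>UNIV. \<Sum>j\<in>UNIV. (norm (Y i k j))\<^sup>2 / lam j)" .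
    have "norm (U1 k) \<le> norm (U1 k + t) + norm t"
      using norm_triangle_ineq4[of "U1 k + t" t] by simp
    then have "norm (U1 k) - norm t \<le> norm (U1 k + t)" by simp
    \<comment> \<open>The lower bound for \<open>norm (U1 k + t)\<close> may be squared only if it
      is nonnegative; otherwise \<open>norm t\<close> already exceeds
      \<open>norm (U1 k)\<close>.\<close>
    have q1: "(norm (U1 k))\<^sup>2 \<le> (norm (U1 k + t))\<^sup>2 + 2 * norm (U1 k) * norm t"
    proof (cases "norm t \<le> norm (U1 k)")
      case True
      then have "(norm (U1 k) - norm t)\<^sup>2 \<le> (norm (U1 k + t))\<^sup>2"
        using \<open>norm (U1 k) - norm t \<le> norm (U1 k + t)\<close> by (intro power_mono) auto
      then show ?thesis unfolding power2_diff using zero_le_power2[of "norm t"] by linarith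
    next
      case False
      then have "norm (U1 k) * norm (U1 k) \<le> norm (U1 k) * norm t" by (intro mult_left_mono) auto
      moreover have "0 \<le> norm (U1 k) * norm t" by simp
      ultimately show ?thesis
        unfolding power2_eq_square mult.assoc using zero_le_square[of "norm (U1 k + t)"] by linarith
    qed
    have q2: "(norm (U1 k + t))\<^sup>2 \<le> (\<Sum>i\<in>UNIV. norm (Y i k i))\<^sup>2"
      unfolding w[symmetric] by (intro power_mono norm_sum) simp
    have q3: "2 * norm (U1 k) * norm t \<le> 2 * norm (U1 k) * (2 * c * n)"
      using t by (intro mult_left_mono) auto
    have main: "(norm (U1 k))\<^sup>2 \<le> U * (\<Sum>i\<in>UNIV. \<Sum>j\<in>UNIV. (norm (Y i k j))\<^sup>2 / lam j) + 4 * c * n * norm (U1 k)"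
      using CS q1 q2 q3 by (simp add: algebra_simps)
    have "(norm (U1 k))\<^sup>2 / U / lam k \<le> (U * (\<Sum>i\<in>UNIV. \<Sum>j\<in>UNIV. (norm (Y i k j))\<^sup>2 / lam j) + 4 * c * n * norm (U1 k)) / U / lam k"
      using main U(2) lam[of k] by (intro divide_right_mono) auto
    also have "\<dots> = (\<Sum>i\<in>UNIV. \<Sum>j\<in>UNIV. (norm (Y i k j))\<^sup>2 / lam j) / lam k + (4 * c * n / U) * (norm (U1 k) / lam k)"
      using U(2) lam[of k] by (simp add: add_divide_distrib)
    also have "(\<Sum>i\<in>UNIV. \<Sum>j\<in>UNIV. (norm (Y i k j))\<^sup>2 / lam j) / lam k
        = (\<Sum>i\<in>UNIV. \<Sum>j\<in>UNIV. (norm (Y i k j))\<^sup>2 / (lam k * lam j))"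
      by (simp add: sum_divide_distrib mult.commute)
    finally show ?thesis .
  qed
  have "(\<Sum>k\<in>UNIV. (norm (U1 k))\<^sup>2 / U / lam k) \<le> SY + (4 * c * n / U) * (\<Sum>k\<in>UNIV. norm (U1 k) / lam k)"
    unfolding SY_def sum_distrib_left sum.distrib[symmetric] by (intro sum_mono grad)
  then show ?thesis
    using U2_lower unfolding diff_divide_distrib sum_subtractf by linarith
qed

text \<open>The case hypothesis \<open>U\<^sup>2 \<ge> (A + 1)\<^sup>2 b\<^sup>3\<close> makes the term \<open>h''\<close> of the auxiliary function
  \<open>h(s) = - A s + 1 / (s - m + 1)\<close> strong enough to absorb the torsion term.\<close>

lemma sum_inverse_bound_of_max:
  fixes lam :: "'n::finite \<Rightarrow> real"
  assumes lam: "\<And>i. 0 < lam i" and s: "s = (\<Sum>i\<in>UNIV. 1 / lam i)" and n: "n = real CARD('n)"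
    and lower: "- C1 * U * s - (2 * C2 / U) * (\<Sum>k\<in>UNIV. x k / lam k) \<le> (\<Sum>k\<in>UNIV. y k / lam k)"
    and max: "\<And>k. y k - U * (A + 1 / b\<^sup>2) * (lam k - 1) + U * (2 / b ^ 3) * (p k)\<^sup>2 \<le> 0"
    and x: "\<And>k. x k = U * (A + 1 / b\<^sup>2) * p k" and p: "\<And>k. 0 \<le> p k"
    and b: "1 \<le> b" and C: "0 \<le> C1" "0 \<le> C2" and A: "A = C1 + C2\<^sup>2 + 1"
    and U: "1 \<le> U" "(A + 1)\<^sup>2 * b ^ 3 \<le> U\<^sup>2"
  shows "s \<le> (A + 1) * n"
proof -
  define a where "a = A + 1 / b\<^sup>2"
  have A1: "1 \<le> A" using C by (simp add: A)
  have "1 / b\<^sup>2 \<le> 1" "0 < 1 / b\<^sup>2" using b by (simp_all add: field_simps one_le_power)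
  then have a: "A \<le> a" "a \<le> A + 1" "0 \<le> a" using A1 by (simp_all add: a_def)
  have b3: "0 < b ^ 3" using b by simp
  have pw: "y k / lam k \<le> U * a - U * a * (1 / lam k) - (2 / b ^ 3) * U * (p k)\<^sup>2 * (1 / lam k)" for k
  proof -
    have "y k \<le> U * a * (lam k - 1) - U * (2 / b ^ 3) * (p k)\<^sup>2" using max[of k] by (simp add: a_def)
    then have "y k / lam k \<le> (U * a * (lam k - 1) - U * (2 / b ^ 3) * (p k)\<^sup>2) / lam k"
      using lam[of k] by (simp add: divide_right_mono)
    also have "\<dots> = U * a - U * a * (1 / lam k) - (2 / b ^ 3) * U * (p k)\<^sup>2 * (1 / lam k)"
      using lam[of k] by (simp add: field_simps)
    finally show ?thesis .
  qed
  \<comment> \<open>The square of \<open>2 * U * q - C2 * a * b ^ 3\<close> is nonnegative. Its last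
    term is bounded using the case hypothesis on \<open>U\<close>, and the result is divided by
    \<open>2 * U * b ^ 3\<close>.\<close>
  have amgm: "2 * C2 * a * q \<le> (2 / b ^ 3) * U * q\<^sup>2 + C2\<^sup>2 * U" for q
  proof -
    have "C2\<^sup>2 * a\<^sup>2 * b ^ 3 \<le> C2\<^sup>2 * U\<^sup>2"
    proof -
      have "a\<^sup>2 * b ^ 3 \<le> (A + 1)\<^sup>2 * b ^ 3" using a b3 by (intro mult_right_mono power_mono) auto
      then show ?thesis using U(2) by (simp add: mult.assoc mult_left_mono)
    qed
    moreover have "0 \<le> (2 * U * q - C2 * a * b ^ 3)\<^sup>2" by simp
    then have "4 * U * q * C2 * a * b ^ 3 \<le> 4 * U\<^sup>2 * q\<^sup>2 + C2\<^sup>2 * a\<^sup>2 * b ^ 3 * b ^ 3"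
      by (simp add: power2_eq_square algebra_simps)
    moreover have "C2\<^sup>2 * a\<^sup>2 * b ^ 3 * b ^ 3 \<le> C2\<^sup>2 * U\<^sup>2 * b ^ 3"
      using calculation(1) b3 by (intro mult_right_mono) auto
    moreover have "C2\<^sup>2 * U\<^sup>2 * b ^ 3 \<le> 2 * C2\<^sup>2 * U\<^sup>2 * b ^ 3" using b3 by simp
    moreover have e1: "(2 * U * b ^ 3) * ((2 / b ^ 3) * U * q\<^sup>2 + C2\<^sup>2 * U) = 4 * U\<^sup>2 * q\<^sup>2 + 2 * C2\<^sup>2 * U\<^sup>2 * b ^ 3"
      using b by (simp add: distrib_left power2_eq_square)
    moreover have e2: "(2 * U * b ^ 3) * (2 * C2 * a * q) = 4 * U * q * C2 * a * b ^ 3" by simp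
    ultimately have "(2 * U * b ^ 3) * (2 * C2 * a * q) \<le> (2 * U * b ^ 3) * ((2 / b ^ 3) * U * q\<^sup>2 + C2\<^sup>2 * U)"
      unfolding e1 e2 by linarith
    moreover have "0 < 2 * U * b ^ 3" using U b3 by simp
    ultimately show ?thesis by (simp only: mult_le_cancel_left_pos)
  qed
  have "(\<Sum>k\<in>UNIV. y k / lam k) + (2 * C2 / U) * (\<Sum>k\<in>UNIV. x k / lam k)
      \<le> (\<Sum>k\<in>UNIV. U * a - U * a * (1 / lam k) + C2\<^sup>2 * U * (1 / lam k))"
    unfolding sum_distrib_left sum.distrib[symmetric]
  proof (rule sum_mono)
    fix k
    have "(2 * C2 / U) * (x k / lam k) = 2 * C2 * a * p k * (1 / lam k)"
      using U(1) unfolding x a_def[symmetric] by simp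
    also have "\<dots> \<le> ((2 / b ^ 3) * U * (p k)\<^sup>2 + C2\<^sup>2 * U) * (1 / lam k)"
      using amgm[of "p k"] lam[of k] by (intro mult_right_mono) auto
    finally show "y k / lam k + (2 * C2 / U) * (x k / lam k) \<le> U * a - U * a * (1 / lam k) + C2\<^sup>2 * U * (1 / lam k)"
      using pw[of k] by (simp add: algebra_simps)
  qed
  also have "\<dots> = U * a * n - U * a * s + C2\<^sup>2 * U * s"
    unfolding s n sum.distrib sum_subtractf sum_distrib_left[symmetric] by (simp add: mult_ac)
  finally have "- C1 * U * s \<le> U * a * n - U * a * s + C2\<^sup>2 * U * s" using lower by linarith
  then have "U * ((a - C1 - C2\<^sup>2) * s) \<le> U * (a * n)" by (simp add: algebra_simps)
  then have "(a - C1 - C2\<^sup>2) * s \<le> a * n" using U(1) by simp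
  \<comment> \<open>\<open>A\<close> was chosen so that, after \<open>C1\<close> and the cost
    \<open>C2\<^sup>2\<close> of absorbing the torsion, a coefficient of at least 1 is left for
    \<open>s\<close>.\<close>
  moreover have "s \<le> (a - C1 - C2\<^sup>2) * s"
  proof -
    have "0 \<le> s" unfolding s by (intro sum_nonneg) (simp add: lam less_imp_le)
    moreover have "1 \<le> a - C1 - C2\<^sup>2" using a(1) by (simp add: A)
    ultimately show ?thesis using mult_right_mono[of 1 "a - C1 - C2\<^sup>2" s] by simp
  qed
  moreover have "a * n \<le> (A + 1) * n" using a(2) by (intro mult_right_mono) (simp_all add: n)
  ultimately show ?thesis by linarith
qed

text \<open>Each \<open>lam i\<close> is the full product times the inverses of all the others, each
  of which is at most \<open>s\<close>. With \<open>E\<close> from the equation this converts a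
  bound for the trace of g with respect to g' into one for the trace of g' with respect to
  g.\<close>

lemma sum_le_of_prod_le:
  fixes lam :: "'n::finite \<Rightarrow> real"
  assumes lam: "\<And>i. 0 < lam i" and P: "(\<Prod>i\<in>UNIV. lam i) \<le> E" and s: "(\<Sum>i\<in>UNIV. 1 / lam i) \<le> s"
  shows "(\<Sum>i\<in>UNIV. lam i) \<le> real CARD('n) * (E * s ^ (CARD('n) - 1))"
proof -
  have "lam i \<le> E * s ^ (CARD('n) - 1)" for i
  proof -
    have inv: "1 / lam j \<le> s" for j
    proof -
      have "1 / lam j \<le> (\<Sum>i\<in>UNIV. 1 / lam i)"
        by (rule member_le_sum[of j UNIV "\<lambda>j. 1 / lam j"]) (auto simp: lam less_imp_le)
      with s show ?thesis by linarith
    qed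
    have pos: "0 < (\<Prod>j\<in>UNIV - {i}. lam j)" by (intro prod_pos) (simp add: lam)
    have "(\<Prod>i\<in>UNIV. lam i) = lam i * (\<Prod>j\<in>UNIV - {i}. lam j)"
      by (rule prod.remove) auto
    moreover have "(\<Prod>j\<in>UNIV - {i}. 1 / lam j) = 1 / (\<Prod>j\<in>UNIV - {i}. lam j)"
      by (simp add: prod_dividef)
    ultimately have "lam i = (\<Prod>i\<in>UNIV. lam i) * (\<Prod>j\<in>UNIV - {i}. 1 / lam j)"
      using pos by (simp del: prod_zero_iff)
    also have "\<dots> \<le> E * (\<Prod>j\<in>UNIV - {i}. s)"
    proof (intro mult_mono P prod_mono)
      have "0 < (\<Prod>i\<in>UNIV. lam i)" by (intro prod_pos) (simp add: lam)
      then show "0 \<le> E" using P by linarith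
    qed (auto simp: inv lam less_imp_le intro!: prod_nonneg)
    also have "\<dots> = E * s ^ (CARD('n) - 1)" by (simp add: card_Diff_singleton)
    finally show ?thesis .
  qed
  then have "(\<Sum>i\<in>UNIV. lam i) \<le> (\<Sum>i\<in>(UNIV :: 'n set). E * s ^ (CARD('n) - 1))" by (intro sum_mono)
  then show ?thesis by simp
qed

section \<open>The maximum principle\<close>

text \<open>\<open>f'\<close> is differentiable at 0 only, so no Taylor formula is used: for
  \<open>c > 0\<close> it would be positive just to the right of 0, and \<open>f\<close> would
  exceed its maximum there.\<close>

lemma second_derivative_test:
  fixes f f' :: "real \<Rightarrow> real"
  assumes e: "e > 0" and f: "\<And>s. \<bar>s\<bar> < e \<Longrightarrow> (f has_real_derivative f' s) (at s)"
    and f': "(f' has_real_derivative c) (at 0)" and max: "\<And>s. \<bar>s\<bar> < e \<Longrightarrow> f s \<le> f 0"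
  shows "f' 0 = 0" "c \<le> 0"
proof -
  show 0: "f' 0 = 0"
    by (rule DERIV_local_max[OF f[of 0] e]) (use e max in auto)
  show "c \<le> 0"
  proof (rule ccontr)
    assume "\<not> c \<le> 0"
    then obtain d where d: "d > 0" "\<And>h. 0 < h \<Longrightarrow> h < d \<Longrightarrow> f' 0 < f' (0 + h)"
      using DERIV_pos_inc_right[OF f'] by auto
    define t where "t = min d e / 2"
    have t: "0 < t" "t < d" "t < e" using d(1) e by (auto simp: t_def)
    have "(f has_real_derivative f' s) (at s)" if "0 \<le> s" "s \<le> t" for s
      using that t by (intro f) auto
    from MVT2[OF t(1) this] obtain s where s: "0 < s" "s < t" "f t - f 0 = (t - 0) * f' s" by blast
    have "0 < f' s" using d(2)[of s] s t 0 by simp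
    then have "0 < t * f' s" using t(1) by simp
    then have "f 0 < f t" using s(3) by simp
    with max[of t] t show False by simp
  qed
qed

text \<open>The condition for a maximum of \<open>log u + h p\<close>, written multiplicatively
  because \<open>u\<close> is positive at \<open>z\<close> but not necessarily elsewhere on
  \<open>S\<close>.\<close>

lemma max_along_line:
  fixes u p :: "'v::real_normed_vector \<Rightarrow> real"
  assumes S: "open S" "z \<in> S"
    and u: "\<And>w. w \<in> S \<Longrightarrow> u differentiable at w" "dd v u differentiable at z"
    and p: "\<And>w. w \<in> S \<Longrightarrow> p differentiable at w" "dd v p differentiable at z"
    and h: "\<And>w. w \<in> S \<Longrightarrow> (h has_real_derivative h1 (p w)) (at (p w))"
    and h1: "(h1 has_real_derivative h2) (at (p z))"
    and max: "\<And>w. w \<in> S \<Longrightarrow> u w * exp (h (p w)) \<le> u z * exp (h (p z))" and pos: "u z > 0"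
  shows "dd v u z = - u z * h1 (p z) * dd v p z"
    and "dd v (dd v u) z - (dd v u z)\<^sup>2 / u z + u z * h1 (p z) * dd v (dd v p) z + u z * h2 * (dd v p z)\<^sup>2 \<le> 0"
proof -
  have "open ((\<lambda>s :: real. z + s *\<^sub>R v) -` S)"
    by (intro open_vimage S continuous_intros)
  moreover have "0 \<in> (\<lambda>s :: real. z + s *\<^sub>R v) -` S" using S by simp
  ultimately obtain e where e: "e > 0" "ball 0 e \<subseteq> (\<lambda>s :: real. z + s *\<^sub>R v) -` S"
    using open_contains_ball by blast
  have inS: "z + s *\<^sub>R v \<in> S" if "\<bar>s\<bar> < e" for s
    using e(2) that by auto
  define E where "E = (\<lambda>s. exp (h (p (z + s *\<^sub>R v))))"
  \<comment> \<open>The derivative along the line is \<open>E s * k s\<close>. Since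
    \<open>k 0 = 0\<close> at the maximum, the second derivative there is \<open>E 0\<close> times
    the derivative of \<open>k\<close>.\<close>
  define k where "k = (\<lambda>s. dd v u (z + s *\<^sub>R v) + u (z + s *\<^sub>R v) * (h1 (p (z + s *\<^sub>R v)) * dd v p (z + s *\<^sub>R v)))"
  have du: "((\<lambda>s. u (z + s *\<^sub>R v)) has_real_derivative dd v u (z + s *\<^sub>R v)) (at s)"
    and dp: "((\<lambda>s. p (z + s *\<^sub>R v)) has_real_derivative dd v p (z + s *\<^sub>R v)) (at s)" if "\<bar>s\<bar> < e" for s
    using has_real_derivative_line u(1) p(1) inS[OF that] by blast+
  have dE: "(E has_real_derivative E s * (h1 (p (z + s *\<^sub>R v)) * dd v p (z + s *\<^sub>R v))) (at s)" if "\<bar>s\<bar> < e" for s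
    unfolding E_def
    using DERIV_chain2[OF DERIV_exp DERIV_chain2[OF h[OF inS[OF that]] dp[OF that]]] .
  have df: "((\<lambda>s. u (z + s *\<^sub>R v) * E s) has_real_derivative E s * k s) (at s)" if "\<bar>s\<bar> < e" for s
    using DERIV_mult[OF du[OF that] dE[OF that]] unfolding k_def by (simp add: algebra_simps)
  have ddu: "((\<lambda>s. dd v u (z + s *\<^sub>R v)) has_real_derivative dd v (dd v u) z) (at 0)"
    and ddp: "((\<lambda>s. dd v p (z + s *\<^sub>R v)) has_real_derivative dd v (dd v p) z) (at 0)"
    using has_real_derivative_line[of "dd v u" z 0 v] has_real_derivative_line[of "dd v p" z 0 v] u(2) p(2) by simp_all
  have dh1: "((\<lambda>s. h1 (p (z + s *\<^sub>R v))) has_real_derivative h2 * dd v p z) (at 0)"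
    using DERIV_chain2[OF _ dp[of 0], of h1 h2] h1 e(1) by simp
  define k' where "k' = dd v (dd v u) z + (dd v u z * (h1 (p z) * dd v p z) +
      (h2 * dd v p z * dd v p z + dd v (dd v p) z * h1 (p z)) * u z)"
  have dk: "(k has_real_derivative k') (at 0)"
    using DERIV_add[OF ddu DERIV_mult[OF du[of 0] DERIV_mult[OF dh1 ddp]]] e(1) unfolding k_def k'_def by simp
  have dEk: "((\<lambda>s. E s * k s) has_real_derivative E 0 * (h1 (p z) * dd v p z) * k 0 + k' * E 0) (at 0)"
    using DERIV_mult[OF dE[of 0] dk] e(1) by simp
  have max': "u (z + s *\<^sub>R v) * E s \<le> u (z + 0 *\<^sub>R v) * E 0" if "\<bar>s\<bar> < e" for s
    using max[OF inS[OF that]] by (simp add: E_def)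
  note test = second_derivative_test[OF e(1) df dEk max']
  have E0: "E 0 > 0" by (simp add: E_def)
  have k0: "k 0 = 0" using test(1) E0 by simp
  then show first: "dd v u z = - u z * h1 (p z) * dd v p z" by (simp add: k_def)
  have "k' \<le> 0" using test(2) E0 k0 by (simp add: mult_le_0_iff)
  \<comment> \<open>The first-order condition turns the mixed term into the negative gradient square
    that belongs to the second derivative of log u.\<close>
  moreover have "dd v u z * (h1 (p z) * dd v p z) = - (dd v u z)\<^sup>2 / u z"
    using pos by (simp add: first power2_eq_square)
  ultimately show "dd v (dd v u) z - (dd v u z)\<^sup>2 / u z + u z * h1 (p z) * dd v (dd v p) z + u z * h2 * (dd v p z)\<^sup>2 \<le> 0"
    unfolding k'_def by (simp add: algebra_simps power2_eq_square)
qed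

text \<open>Just enough regularity for a second-order test at the single point \<open>z\<close>; it
  passes to products by one application of the Leibniz rule.\<close>

definition twice_diff :: "'v::real_normed_vector set \<Rightarrow> 'v \<Rightarrow> ('v \<Rightarrow> 'w::real_normed_vector) \<Rightarrow> bool" where
  "twice_diff S z f \<longleftrightarrow> (\<forall>w\<in>S. f differentiable at w) \<and> (\<forall>v. dd v f differentiable at z)"

lemma twice_diffD: "twice_diff S z f \<Longrightarrow> w \<in> S \<Longrightarrow> f differentiable at w" "twice_diff S z f \<Longrightarrow> dd v f differentiable at z"
  by (auto simp: twice_diff_def)

lemma twice_diff_smooth: "smooth_on f S \<Longrightarrow> z \<in> S \<Longrightarrow> twice_diff S z f"
  unfolding twice_diff_def
  using smooth_on_differentiable smooth_on_differentiable[OF smooth_on_dd] by blast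

lemma twice_diff_mult:
  fixes f g :: "'v::real_normed_vector \<Rightarrow> complex"
  assumes S: "open S" "z \<in> S" and f: "twice_diff S z f" and g: "twice_diff S z g"
  shows "twice_diff S z (\<lambda>x. f x * g x)"
  unfolding twice_diff_def
proof (intro conjI ballI allI)
  show "(\<lambda>x. f x * g x) differentiable at w" if "w \<in> S" for w
    using twice_diffD(1)[OF f that] twice_diffD(1)[OF g that] by (rule differentiable_mult)
  fix v
  have "(\<lambda>x. dd v f x * g x + f x * dd v g x) differentiable at z"
    by (intro differentiable_add differentiable_mult twice_diffD[OF f] twice_diffD[OF g] S)
  then show "dd v (\<lambda>x. f x * g x) differentiable at z"
    by (rule differentiable_cong_open[OF S, rotated])
      (rule dd_mult[OF twice_diffD(1)[OF f] twice_diffD(1)[OF g], symmetric])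
qed

lemma twice_diff_add:
  assumes S: "open S" "z \<in> S" and f: "twice_diff S z f" and g: "twice_diff S z g"
  shows "twice_diff S z (\<lambda>x. f x + g x)"
  unfolding twice_diff_def
proof (intro conjI ballI allI)
  show "(\<lambda>x. f x + g x) differentiable at w" if "w \<in> S" for w
    using twice_diffD(1)[OF f that] twice_diffD(1)[OF g that] by (rule differentiable_add)
  fix v
  have "(\<lambda>x. dd v f x + dd v g x) differentiable at z"
    by (intro differentiable_add twice_diffD[OF f] twice_diffD[OF g])
  then show "dd v (\<lambda>x. f x + g x) differentiable at z"
    by (rule differentiable_cong_open[OF S, rotated])
      (rule dd_add[OF twice_diffD(1)[OF f] twice_diffD(1)[OF g], symmetric])
qed

lemma twice_diff_sum:
  assumes S: "open S" "z \<in> S" and f: "\<And>i. i \<in> I \<Longrightarrow> twice_diff S z (f i)"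
  shows "twice_diff S z (\<lambda>x. \<Sum>i\<in>I. f i x)"
  using f
proof (induction I rule: infinite_finite_induct)
  case (insert i I)
  then show ?case using twice_diff_add[OF S, of "f i" "\<lambda>x. \<Sum>i\<in>I. f i x"] by simp
qed (auto simp: twice_diff_smooth S)

lemma twice_diff_bounded_linear:
  assumes S: "open S" "z \<in> S" and f: "twice_diff S z f" and L: "bounded_linear L"
  shows "twice_diff S z (\<lambda>x. L (f x))"
  unfolding twice_diff_def
proof (intro conjI ballI allI)
  show "(\<lambda>x. L (f x)) differentiable at w" if "w \<in> S" for w
    by (rule differentiable_bounded_linear[OF L twice_diffD(1)[OF f that]])
  fix v
  have "(\<lambda>x. L (dd v f x)) differentiable at z"
    by (rule differentiable_bounded_linear[OF L twice_diffD(2)[OF f]])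
  then show "dd v (\<lambda>x. L (f x)) differentiable at z"
    by (rule differentiable_cong_open[OF S, rotated])
      (rule dd_bounded_linear[OF L twice_diffD(1)[OF f], symmetric])
qed

lemma differentiable_wd: "(\<And>v. dd v f differentiable at z) \<Longrightarrow> wd e v f differentiable at z"
  unfolding wd_alt by (intro differentiable_mult differentiable_add differentiable_const)

lemma wd_wd_mult:
  assumes S: "open S" "z \<in> S" and f: "twice_diff S z f" and g: "twice_diff S z g"
  shows "wd e v (wd e' v' (\<lambda>x. f x * g x)) z = wd e v (wd e' v' f) z * g z + wd e' v' f z * wd e v g z
    + (wd e v f z * wd e' v' g z + f z * wd e v (wd e' v' g) z)"
proof -
  note df = twice_diffD(1)[OF f S(2)] twice_diffD(1)[OF g S(2)]
    differentiable_wd[OF twice_diffD(2)[OF f], of e' v'] differentiable_wd[OF twice_diffD(2)[OF g], of e' v']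
  have "wd e v (wd e' v' (\<lambda>x. f x * g x)) z = wd e v (\<lambda>x. wd e' v' f x * g x + f x * wd e' v' g x) z"
    by (rule wd_cong_open[OF S]) (rule wd_mult[OF twice_diffD(1)[OF f] twice_diffD(1)[OF g]])
  also have "\<dots> = wd e v (\<lambda>x. wd e' v' f x * g x) z + wd e v (\<lambda>x. f x * wd e' v' g x) z"
    by (rule wd_add) (intro differentiable_mult df)+
  finally show ?thesis by (simp add: wd_mult df)
qed

lemma wd_wd_sum:
  assumes S: "open S" "z \<in> S" and f: "\<And>i. i \<in> I \<Longrightarrow> twice_diff S z (f i)"
  shows "wd e v (wd e' v' (\<lambda>x. \<Sum>i\<in>I. f i x)) z = (\<Sum>i\<in>I. wd e v (wd e' v' (f i)) z)"
proof -
  have "wd e v (wd e' v' (\<lambda>x. \<Sum>i\<in>I. f i x)) z = wd e v (\<lambda>x. \<Sum>i\<in>I. wd e' v' (f i) x) z"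
    by (rule wd_cong_open[OF S]) (rule wd_sum[OF twice_diffD(1)[OF f]])
  also have "\<dots> = (\<Sum>i\<in>I. wd e v (wd e' v' (f i)) z)"
    by (rule wd_sum) (rule differentiable_wd[OF twice_diffD(2)[OF f]])
  finally show ?thesis .
qed

lemma wd_wd_add:
  assumes S: "open S" "z \<in> S" and f: "twice_diff S z f" and g: "twice_diff S z g"
  shows "wd e v (wd e' v' (\<lambda>x. f x + g x)) z = wd e v (wd e' v' f) z + wd e v (wd e' v' g) z"
proof -
  have "wd e v (wd e' v' (\<lambda>x. f x + g x)) z = wd e v (\<lambda>x. wd e' v' f x + wd e' v' g x) z"
    by (rule wd_cong_open[OF S]) (rule wd_add[OF twice_diffD(1)[OF f] twice_diffD(1)[OF g]])
  also have "\<dots> = wd e v (wd e' v' f) z + wd e v (wd e' v' g) z"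
    by (rule wd_add) (rule differentiable_wd[OF twice_diffD(2)[OF f]] differentiable_wd[OF twice_diffD(2)[OF g]])+
  finally show ?thesis .
qed

text \<open>The trace of the inverse of M times the derivative of M, that is, the derivative of log
  det M, written without a branch of the complex logarithm.\<close>

definition logdet_deriv :: "complex \<Rightarrow> complex^'n \<Rightarrow> (complex^'n \<Rightarrow> complex^'n^'n) \<Rightarrow> complex^'n::finite \<Rightarrow> complex" where
  "logdet_deriv e v M w = (\<Sum>k\<in>UNIV. \<Sum>l\<in>UNIV. matrix_inv (M w) $ k $ l * wd e v (\<lambda>x. M x $ l $ k) w)"

lemma wd_det:
  assumes "\<And>i j. (\<lambda>x. M x $ i $ j) differentiable at w" "det (M w) \<noteq> 0"
  shows "wd e v (\<lambda>x. det (M x)) w = det (M w) * logdet_deriv e v M w"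
proof -
  define I where "I = matrix_inv (M w)"
  define d where "d = (\<lambda>v k l. dd v (\<lambda>x. M x $ l $ k) w)"
  have "wd e v (\<lambda>x. det (M x)) w = det (M w) * ((\<Sum>k\<in>UNIV. \<Sum>l\<in>UNIV. I $ k $ l * d v k l)
      + e * (\<Sum>k\<in>UNIV. \<Sum>l\<in>UNIV. I $ k $ l * d (\<i> *s v) k l)) / 2"
    unfolding wd_def dd_det[OF assms] I_def d_def by (simp add: algebra_simps)
  also have "(\<Sum>k\<in>UNIV. \<Sum>l\<in>UNIV. I $ k $ l * d v k l) + e * (\<Sum>k\<in>UNIV. \<Sum>l\<in>UNIV. I $ k $ l * d (\<i> *s v) k l)
      = 2 * (\<Sum>k\<in>UNIV. \<Sum>l\<in>UNIV. I $ k $ l * ((d v k l + e * d (\<i> *s v) k l) / 2))"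
    unfolding sum_distrib_left sum.distrib[symmetric] by (intro sum.cong refl) (simp add: algebra_simps)
  finally show ?thesis by (simp add: logdet_deriv_def wd_def I_def d_def)
qed

text \<open>Differentiating the product of the inverse with \<open>M\<close>, which is constant,
  gives the derivative of the inverse as minus inverse times derivative times inverse. At
  \<open>z\<close> both outer factors are diagonal, whence the denominators.\<close>

lemma wd_logdet_deriv_diagonal:
  fixes M :: "complex^'n::finite \<Rightarrow> complex^'n^'n"
  assumes S: "open S" "z \<in> S" and M: "\<And>i j. smooth_on (\<lambda>x. M x $ i $ j) S"
    and nz: "\<And>w. w \<in> S \<Longrightarrow> det (M w) \<noteq> 0"
    and diag: "\<And>i j. M z $ i $ j = (if i = j then d i else 0)" and d: "\<And>i. d i \<noteq> 0"
  shows "wd e' v' (logdet_deriv e v M) z = (\<Sum>k\<in>UNIV. wd e' v' (wd e v (\<lambda>x. M x $ k $ k)) z / d k)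
    - (\<Sum>k\<in>UNIV. \<Sum>l\<in>UNIV. wd e' v' (\<lambda>x. M x $ k $ l) z * wd e v (\<lambda>x. M x $ l $ k) z / (d k * d l))"
proof -
  note dM = smooth_on_differentiable[OF M S(2)]
  have dI: "(\<lambda>x. matrix_inv (M x) $ k $ l) differentiable at z" for k l
    by (rule differentiable_matrix_inv[OF S dM nz])
  have dwM: "wd e v (\<lambda>x. M x $ l $ k) differentiable at z" for k l
    by (rule smooth_on_differentiable[OF smooth_on_wd[OF S(1) M] S(2)])
  have Iz: "matrix_inv (M z) $ k $ l = (if k = l then 1 / d k else 0)" for k l
  proof -
    have "M z ** (\<chi> i j. if i = j then 1 / d i else 0) = mat 1"
    proof -
      have "(\<Sum>k\<in>UNIV. M z $ i $ k * (if k = j then 1 / d k else 0)) = (if i = j then 1 else 0)" for i j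
      proof -
        have "(\<Sum>k\<in>UNIV. M z $ i $ k * (if k = j then 1 / d k else 0)) = (\<Sum>k\<in>UNIV. if k = j then M z $ i $ k * (1 / d k) else 0)"
          by (rule sum.cong) auto
        also have "\<dots> = (if i = j then 1 else 0)" using d by (simp add: diag)
        finally show ?thesis .
      qed
      then show ?thesis by (simp add: matrix_matrix_mult_def mat_def vec_eq_iff)
    qed
    then show ?thesis by (simp add: matrix_inv_unique)
  qed
  have wI: "wd e' v' (\<lambda>x. matrix_inv (M x) $ k $ l) z = - wd e' v' (\<lambda>x. M x $ k $ l) z / (d k * d l)" for k l
  proof -
    have "wd e' v' (\<lambda>x. \<Sum>q\<in>UNIV. matrix_inv (M x) $ k $ q * M x $ q $ l) z = wd e' v' (\<lambda>x. if k = l then 1 else 0) z"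
    proof (rule wd_cong_open[OF S])
      fix x assume "x \<in> S"
      then have "(matrix_inv (M x) ** M x) $ k $ l = mat 1 $ k $ l"
        using matrix_inv_right(2)[OF nz] by simp
      then show "(\<Sum>q\<in>UNIV. matrix_inv (M x) $ k $ q * M x $ q $ l) = (if k = l then 1 else 0)"
        by (simp add: matrix_matrix_mult_def mat_def)
    qed
    then have "0 = wd e' v' (\<lambda>x. \<Sum>q\<in>UNIV. matrix_inv (M x) $ k $ q * M x $ q $ l) z" by simp
    also have "\<dots> = (\<Sum>q\<in>UNIV. wd e' v' (\<lambda>x. matrix_inv (M x) $ k $ q * M x $ q $ l) z)"
      by (rule wd_sum) (intro differentiable_mult dI dM)
    also have "\<dots> = (\<Sum>q\<in>UNIV. wd e' v' (\<lambda>x. matrix_inv (M x) $ k $ q) z * M z $ q $ l)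
        + (\<Sum>q\<in>UNIV. matrix_inv (M z) $ k $ q * wd e' v' (\<lambda>x. M x $ q $ l) z)"
      by (simp add: wd_mult[OF dI dM] sum.distrib)
    also have "(\<Sum>q\<in>UNIV. wd e' v' (\<lambda>x. matrix_inv (M x) $ k $ q) z * M z $ q $ l)
        = (\<Sum>q\<in>UNIV. if q = l then wd e' v' (\<lambda>x. matrix_inv (M x) $ k $ q) z * d l else 0)"
      by (rule sum.cong) (auto simp: diag)
    also have "(\<Sum>q\<in>UNIV. matrix_inv (M z) $ k $ q * wd e' v' (\<lambda>x. M x $ q $ l) z)
        = (\<Sum>q\<in>UNIV. if k = q then (1 / d k) * wd e' v' (\<lambda>x. M x $ q $ l) z else 0)"
      by (rule sum.cong) (auto simp: Iz)
    finally have "wd e' v' (\<lambda>x. matrix_inv (M x) $ k $ l) z * d l + (1 / d k) * wd e' v' (\<lambda>x. M x $ k $ l) z = 0"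
      by simp
    then show ?thesis using d[of k] d[of l] by (simp add: field_simps) (simp add: add_eq_0_iff2)
  qed
  have "wd e' v' (logdet_deriv e v M) z
      = (\<Sum>k\<in>UNIV. \<Sum>l\<in>UNIV. wd e' v' (\<lambda>w. matrix_inv (M w) $ k $ l * wd e v (\<lambda>x. M x $ l $ k) w) z)"
    unfolding logdet_deriv_def[abs_def]
    by (subst wd_sum, intro differentiable_sum ballI differentiable_mult dI dwM finite_class.finite_UNIV,
        intro sum.cong refl wd_sum differentiable_mult dI dwM)
  also have "\<dots> = (\<Sum>k\<in>UNIV. \<Sum>l\<in>UNIV. - (wd e' v' (\<lambda>x. M x $ k $ l) z * wd e v (\<lambda>x. M x $ l $ k) z / (d k * d l))
      + (if k = l then 1 / d k else 0) * wd e' v' (wd e v (\<lambda>x. M x $ l $ k)) z)"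
    by (intro sum.cong refl) (simp add: wd_mult[OF dI dwM] wI Iz)
  also have "\<dots> = - (\<Sum>k\<in>UNIV. \<Sum>l\<in>UNIV. wd e' v' (\<lambda>x. M x $ k $ l) z * wd e v (\<lambda>x. M x $ l $ k) z / (d k * d l))
      + (\<Sum>k\<in>UNIV. (1 / d k) * wd e' v' (wd e v (\<lambda>x. M x $ k $ k)) z)"
    unfolding sum.distrib sum_sum_delta(2) by (simp add: sum_negf)
  finally show ?thesis by simp
qed

lemma wd_exp_of_real:
  assumes "F differentiable at w"
  shows "wd e v (\<lambda>x. complex_of_real (exp (F x))) w = of_real (exp (F w)) * wd e v (\<lambda>x. of_real (F x)) w"
proof -
  have h: "((\<lambda>x. exp (F x)) has_derivative (\<lambda>y. exp (F w) * dd y F w)) (at w)"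
    using has_derivative_exp[OF has_derivative_dd[OF assms]] by (simp add: mult.commute)
  then have "(\<lambda>x. exp (F x)) differentiable at w" by (rule differentiableI)
  then show ?thesis using dd_eq[OF h] assms by (simp add: wd_of_real algebra_simps)
qed

lemma smooth_on_herm_prod:
  assumes "open S" "\<And>i j. smooth_on (\<lambda>w. G w $ i $ j) S"
  shows "smooth_on (\<lambda>w. herm_prod (G w) u v) S"
proof -
  have "smooth_on (\<lambda>w. \<Sum>i\<in>UNIV. \<Sum>j\<in>UNIV. (u $ i * cnj (v $ j)) * G w $ i $ j) S"
    by (intro smooth_on_sum smooth_on_cmult assms)
  then show ?thesis by (simp add: herm_prod_def mult_ac)
qed

text \<open>The local situation: \<open>G\<close> represents g, and \<open>G\<close> plus the
  Hessian represents g'. The vectors \<open>a i\<close> are constant on \<open>S\<close> and adapted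
  to the two metrics at \<open>z\<close> only, so components along them are differentiated without
  connection terms.\<close>

locale metric_pair =
  fixes S :: "(complex^'n::finite) set" and z G and \<phi> :: "complex^'n \<Rightarrow> real"
    and a :: "'n \<Rightarrow> complex^'n" and lam :: "'n \<Rightarrow> real"
  assumes S: "open S" "z \<in> S"
    and smooth_G: "\<And>i j. smooth_on (\<lambda>w. G w $ i $ j) S"
    and smooth_\<phi>: "smooth_on \<phi> S"
    and pos_G: "\<And>w. w \<in> S \<Longrightarrow> hermitian_pos_def (G w)"
    and pos_H: "\<And>w. w \<in> S \<Longrightarrow> hermitian_pos_def (G w + complex_hessian \<phi> w)"
    and frame: "unitary_frame (G z) a"
    and diag: "\<And>i j. herm_prod (G z + complex_hessian \<phi> z) (a i) (a j) = (if i = j then of_real (lam i) else 0)"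
begin

definition "\<phi>c = (\<lambda>w. complex_of_real (\<phi> w))"
definition "gf i j = (\<lambda>w. herm_prod (G w) (a i) (a j))"
definition "pf i j = del (a i) (delbar (a j) \<phi>c)"
definition "hf i j = (\<lambda>w. gf i j w + pf i j w)"

lemma smooth_\<phi>c: "smooth_on \<phi>c S"
  unfolding \<phi>c_def by (rule smooth_on_of_real[OF S(1) smooth_\<phi>])

lemma smooth_gf: "smooth_on (gf i j) S"
  unfolding gf_def by (rule smooth_on_herm_prod[OF S(1) smooth_G])

lemma smooth_pf: "smooth_on (pf i j) S"
  unfolding pf_def by (intro smooth_on_wd S smooth_\<phi>c)

lemma smooth_hf: "smooth_on (hf i j) S"
  unfolding hf_def by (intro smooth_on_add S smooth_gf smooth_pf)

lemmas td_gf = twice_diff_smooth[OF smooth_gf S(2)]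
  and td_pf = twice_diff_smooth[OF smooth_pf S(2)]
  and td_hf = twice_diff_smooth[OF smooth_hf S(2)]

lemma hf_eq: "w \<in> S \<Longrightarrow> hf i j w = herm_prod (G w + complex_hessian \<phi> w) (a i) (a j)"
  by (simp add: hf_def gf_def pf_def \<phi>c_def herm_prod_add_matrix complex_hessian_form[OF S(1) _ smooth_\<phi>])

lemma cnj_gf: "w \<in> S \<Longrightarrow> cnj (gf i j w) = gf j i w"
  unfolding gf_def by (rule hermitian_pos_def_cnj[OF pos_G])

lemma cnj_hf: "w \<in> S \<Longrightarrow> cnj (hf i j w) = hf j i w"
  unfolding hf_eq by (rule hermitian_pos_def_cnj[OF pos_H])

lemma gf_z: "gf i j z = (if i = j then 1 else 0)"
  using frame by (simp add: gf_def unitary_frame_def)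

lemma hf_z: "hf i j z = (if i = j then of_real (lam i) else 0)"
  by (simp add: hf_eq[OF S(2)] diag)

lemma lam_pos: "0 < lam i"
  by (rule diagonalization_pos[OF pos_H[OF S(2)] frame diag])

definition "g1 i j k = del (a k) (gf i j) z"
definition "h1 i j k = del (a k) (hf i j) z"
definition "g2 i k = Re (del (a k) (delbar (a k) (gf i i)) z)"
definition "h2 i k = Re (del (a k) (delbar (a k) (hf i i)) z)"

lemma delbar_gf: "delbar (a k) (gf i j) z = cnj (g1 j i k)"
proof -
  have "delbar (a k) (gf i j) z = delbar (a k) (\<lambda>w. cnj (gf j i w)) z"
    by (rule wd_cong_open[OF S]) (simp add: cnj_gf)
  then show ?thesis
    by (simp add: wd_cnj[OF smooth_on_differentiable[OF smooth_gf S(2)]] g1_def)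
qed

lemma delbar_hf: "delbar (a k) (hf i j) z = cnj (h1 j i k)"
proof -
  have "delbar (a k) (hf i j) z = delbar (a k) (\<lambda>w. cnj (hf j i w)) z"
    by (rule wd_cong_open[OF S]) (simp add: cnj_hf)
  then show ?thesis
    by (simp add: wd_cnj[OF smooth_on_differentiable[OF smooth_hf S(2)]] h1_def)
qed

text \<open>The components of g' - g are second derivatives of \<phi>, so \<open>h1 - g1\<close>
  consists of its third derivatives, in which the two unbarred directions commute. The next lemma
  does the same for fourth derivatives.\<close>

lemma sym1: "h1 i j k - g1 i j k = h1 k j i - g1 k j i"
proof -
  have "h1 i j k - g1 i j k = del (a k) (pf i j) z" for i j k
    unfolding h1_def g1_def hf_def
    by (simp add: wd_add[OF smooth_on_differentiable[OF smooth_gf S(2)] smooth_on_differentiable[OF smooth_pf S(2)]])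
  moreover have "del (a k) (pf i j) z = del (a i) (pf k j) z"
    unfolding pf_def by (rule wd_commute[OF S smooth_on_wd[OF S(1) smooth_\<phi>c]])
  ultimately show ?thesis by simp
qed

lemma sym2: "h2 i k - g2 i k = h2 k i - g2 k i"
proof -
  have 1: "h2 i k - g2 i k = Re (del (a k) (delbar (a k) (pf i i)) z)" for i k
    unfolding h2_def g2_def hf_def by (simp add: wd_wd_add[OF S td_gf td_pf])
  have sm: "smooth_on (wd e v (wd e' v' \<phi>c)) S" "smooth_on (wd e v \<phi>c) S" for e v e' v'
    by (intro smooth_on_wd S smooth_\<phi>c)+
  have "delbar (a k) (del (a i) (delbar (a i) \<phi>c)) w = del (a i) (delbar (a i) (delbar (a k) \<phi>c)) w" if "w \<in> S" for w
  proof -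
    have "delbar (a k) (del (a i) (delbar (a i) \<phi>c)) w = del (a i) (delbar (a k) (delbar (a i) \<phi>c)) w"
      by (rule wd_commute[OF S(1) that sm(2)])
    also have "\<dots> = del (a i) (delbar (a i) (delbar (a k) \<phi>c)) w"
      by (rule wd_cong_open[OF S(1) that]) (rule wd_commute[OF S(1) _ smooth_\<phi>c])
    finally show ?thesis .
  qed
  then have "del (a k) (delbar (a k) (pf i i)) z = del (a k) (del (a i) (delbar (a i) (delbar (a k) \<phi>c))) z"
    unfolding pf_def by (rule wd_cong_open[OF S])
  also have "\<dots> = del (a i) (del (a k) (delbar (a i) (delbar (a k) \<phi>c))) z"
    by (rule wd_commute[OF S sm(1)])
  also have "\<dots> = del (a i) (delbar (a i) (pf k k)) z"
    unfolding pf_def by (rule wd_cong_open[OF S]) (rule wd_commute[OF S(1) _ sm(2)])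
  finally show ?thesis unfolding 1 by simp
qed

text \<open>The identity log det g' = F + log det g is differentiated in direction
  \<open>a i\<close> and then in the conjugate direction. In the logarithm the second derivatives of
  a determinant split into a linear part and the squares of first derivatives.\<close>

lemma monge_ampere_second_order:
  assumes F: "smooth_on F S"
    and det: "\<And>w. w \<in> S \<Longrightarrow> det (G w + complex_hessian \<phi> w) = of_real (exp (F w)) * det (G w)"
  shows "(\<Sum>k\<in>UNIV. h2 k i / lam k) - (\<Sum>k\<in>UNIV. \<Sum>l\<in>UNIV. (norm (h1 k l i))\<^sup>2 / (lam k * lam l)) =
    Re (del (a i) (delbar (a i) (\<lambda>w. of_real (F w))) z) + (\<Sum>k\<in>UNIV. g2 k i) - (\<Sum>k\<in>UNIV. \<Sum>l\<in>UNIV. (norm (g1 k l i))\<^sup>2)"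
proof -
  \<comment> \<open>The components along the frame change both determinants by the same nonzero
    constant, and at \<open>z\<close> they make the matrices diagonal.\<close>
  define MG where "MG = (\<lambda>w. \<chi> i j. gf i j w)"
  define MH where "MH = (\<lambda>w. \<chi> i j. hf i j w)"
  let ?F = "\<lambda>w. complex_of_real (F w)"
  have smF: "smooth_on ?F S" by (rule smooth_on_of_real[OF S(1) F])
  have MG: "MG w $ i $ j = gf i j w" and MH: "MH w $ i $ j = hf i j w" for w i j
    by (simp_all add: MG_def MH_def)
  have smMG: "smooth_on (\<lambda>x. MG x $ i $ j) S" and smMH: "smooth_on (\<lambda>x. MH x $ i $ j) S" for i j
    unfolding MG MH using smooth_gf smooth_hf by simp_all
  have frame_nz: "det (frame_matrix a) \<noteq> 0" "det (frame_adjoint a) \<noteq> 0"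
  proof -
    have "det (frame_matrix a) * det (G z) * det (frame_adjoint a) = 1"
      unfolding det_frame_product[symmetric] using frame by (simp add: unitary_frame_def det_diagonal)
    then show "det (frame_matrix a) \<noteq> 0" "det (frame_adjoint a) \<noteq> 0" by auto
  qed
  have detG: "det (MG w) = det (frame_matrix a) * det (G w) * det (frame_adjoint a)" for w
    unfolding MG_def gf_def by (rule det_frame_product)
  have detH: "det (MH w) = of_real (exp (F w)) * det (MG w)" if "w \<in> S" for w
  proof -
    have "det (MH w) = det (\<chi> i j. herm_prod (G w + complex_hessian \<phi> w) (a i) (a j))"
      unfolding MH_def by (simp add: hf_eq[OF that])
    then show ?thesis unfolding det_frame_product det[OF that] detG by simp
  qed
  have detG_nz: "det (MG w) \<noteq> 0" if w: "w \<in> S" for w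
    using hermitian_pos_def_det_nz[OF pos_G[OF w]] frame_nz by (simp add: detG)
  have detH_nz: "det (MH w) \<noteq> 0" if "w \<in> S" for w
    using detG_nz[OF that] by (simp add: detH[OF that])
  \<comment> \<open>The equation after one differentiation, valid on all of \<open>S\<close> so that
    it can be differentiated once more at \<open>z\<close>.\<close>
  have first: "logdet_deriv (- \<i>) (a i) MH w = del (a i) ?F w + logdet_deriv (- \<i>) (a i) MG w" if w: "w \<in> S" for w
  proof -
    note dG = smooth_on_differentiable[OF smMG w] and dH = smooth_on_differentiable[OF smMH w]
      and dF = smooth_on_differentiable[OF F w]
    have dexp: "(\<lambda>w. complex_of_real (exp (F w))) differentiable at w"
      by (rule differentiable_of_real) (rule differentiableI[OF has_derivative_exp[OF has_derivative_dd[OF dF]]])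
    have "det (MH w) * logdet_deriv (- \<i>) (a i) MH w = del (a i) (\<lambda>w. det (MH w)) w"
      by (rule wd_det[OF dH detH_nz[OF w], symmetric])
    also have "\<dots> = del (a i) (\<lambda>w. of_real (exp (F w)) * det (MG w)) w"
      by (rule wd_cong_open[OF S(1) w]) (rule detH)
    also have "\<dots> = (of_real (exp (F w)) * del (a i) ?F w) * det (MG w)
        + of_real (exp (F w)) * (det (MG w) * logdet_deriv (- \<i>) (a i) MG w)"
      by (simp only: wd_mult[OF dexp differentiable_det[OF dG]] wd_exp_of_real[OF dF] wd_det[OF dG detG_nz[OF w]])
    also have "\<dots> = det (MH w) * (del (a i) ?F w + logdet_deriv (- \<i>) (a i) MG w)"
      by (simp add: detH[OF w] algebra_simps)
    finally show ?thesis using detH_nz[OF w] by simp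
  qed
  have dld: "logdet_deriv (- \<i>) (a i) MG differentiable at z"
    unfolding logdet_deriv_def[abs_def]
    by (intro differentiable_sum ballI differentiable_mult differentiable_matrix_inv[OF S]
        smooth_on_differentiable[OF smMG S(2)] detG_nz smooth_on_differentiable[OF smooth_on_wd[OF S(1) smMG] S(2)]) auto
  have dF: "del (a i) ?F differentiable at z"
    by (rule smooth_on_differentiable[OF smooth_on_wd[OF S(1) smF] S(2)])
  have "delbar (a i) (logdet_deriv (- \<i>) (a i) MH) z
      = delbar (a i) (\<lambda>w. del (a i) ?F w + logdet_deriv (- \<i>) (a i) MG w) z"
    by (rule wd_cong_open[OF S first])
  also have "\<dots> = delbar (a i) (del (a i) ?F) z + delbar (a i) (logdet_deriv (- \<i>) (a i) MG) z"
    by (rule wd_add[OF dF dld])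
  also have "delbar (a i) (del (a i) ?F) z = del (a i) (delbar (a i) ?F) z"
    by (rule wd_commute[OF S smF])
  also have "delbar (a i) (logdet_deriv (- \<i>) (a i) MG) z
     = (\<Sum>k\<in>UNIV. delbar (a i) (del (a i) (\<lambda>x. MG x $ k $ k)) z / 1)
    - (\<Sum>k\<in>UNIV. \<Sum>l\<in>UNIV. delbar (a i) (\<lambda>x. MG x $ k $ l) z * del (a i) (\<lambda>x. MG x $ l $ k) z / (1 * 1))"
    by (rule wd_logdet_deriv_diagonal[OF S smMG detG_nz]) (simp_all add: MG gf_z)
  also have "delbar (a i) (logdet_deriv (- \<i>) (a i) MH) z
     = (\<Sum>k\<in>UNIV. delbar (a i) (del (a i) (\<lambda>x. MH x $ k $ k)) z / of_real (lam k))
    - (\<Sum>k\<in>UNIV. \<Sum>l\<in>UNIV. delbar (a i) (\<lambda>x. MH x $ k $ l) z * del (a i) (\<lambda>x. MH x $ l $ k) z / (of_real (lam k) * of_real (lam l)))"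
    by (rule wd_logdet_deriv_diagonal[OF S smMH detH_nz]) (use lam_pos in \<open>simp_all add: MH hf_z less_imp_neq[symmetric]\<close>)
  finally have eq: "(\<Sum>k\<in>UNIV. delbar (a i) (del (a i) (hf k k)) z / of_real (lam k))
    - (\<Sum>k\<in>UNIV. \<Sum>l\<in>UNIV. cnj (h1 l k i) * h1 l k i / (of_real (lam k) * of_real (lam l)))
    = del (a i) (delbar (a i) ?F) z + ((\<Sum>k\<in>UNIV. delbar (a i) (del (a i) (gf k k)) z)
    - (\<Sum>k\<in>UNIV. \<Sum>l\<in>UNIV. cnj (g1 l k i) * g1 l k i))"
    unfolding MG MH delbar_gf delbar_hf h1_def[symmetric] g1_def[symmetric] div_by_1 mult_1_right by simp
  have c1: "delbar (a i) (del (a i) (hf k k)) z = del (a i) (delbar (a i) (hf k k)) z"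
    and c2: "delbar (a i) (del (a i) (gf k k)) z = del (a i) (delbar (a i) (gf k k)) z" for k
    using wd_commute[OF S smooth_hf] wd_commute[OF S smooth_gf] by simp_all
  have n1: "cnj x * x = of_real ((norm x)\<^sup>2)" for x :: complex
    using complex_norm_square[of x] by (simp add: mult.commute)
  have "Re (\<Sum>k\<in>UNIV. del (a i) (delbar (a i) (hf k k)) z / of_real (lam k)) = (\<Sum>k\<in>UNIV. h2 k i / lam k)"
    by (simp add: h2_def)
  moreover have "Re (\<Sum>k\<in>UNIV. del (a i) (delbar (a i) (gf k k)) z) = (\<Sum>k\<in>UNIV. g2 k i)"
    by (simp add: g2_def)
  moreover have "(\<Sum>k\<in>UNIV. \<Sum>l\<in>UNIV. cnj (h1 l k i) * h1 l k i / (of_real (lam k) * of_real (lam l)))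
      = of_real (\<Sum>k\<in>UNIV. \<Sum>l\<in>UNIV. (norm (h1 k l i))\<^sup>2 / (lam k * lam l))"
    unfolding n1 by (subst sum.swap) (simp add: mult.commute)
  moreover have "(\<Sum>k\<in>UNIV. \<Sum>l\<in>UNIV. cnj (g1 l k i) * g1 l k i) = of_real (\<Sum>k\<in>UNIV. \<Sum>l\<in>UNIV. (norm (g1 k l i))\<^sup>2)"
    unfolding n1 by (subst sum.swap) simp
  ultimately show ?thesis
    using arg_cong[OF eq[unfolded c1 c2], of Re] by simp
qed

text \<open>At \<open>z\<close> this agrees with the trace, elsewhere it is at most the trace, so that it may replace the
  trace in the maximum principle; \<open>G\<^sup>-\<^sup>1\<close> need not be differentiated.\<close>

definition "Uc w = (\<Sum>i\<in>UNIV. \<Sum>j\<in>UNIV. ((if i = j then 2 else 0) - gf j i w) * hf i j w)"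
definition "Ur w = Re (Uc w)"

lemma Uc_real: "w \<in> S \<Longrightarrow> Uc w = of_real (Ur w)"
proof -
  assume w: "w \<in> S"
  have "cnj (Uc w) = (\<Sum>i\<in>UNIV. \<Sum>j\<in>UNIV. ((if i = j then 2 else 0) - gf i j w) * hf j i w)"
    unfolding Uc_def cnj_sum complex_cnj_mult complex_cnj_diff cnj_gf[OF w] cnj_hf[OF w]
    by (intro sum.cong refl) simp
  also have "\<dots> = Uc w"
    unfolding Uc_def by (subst sum.swap) (intro sum.cong refl, simp)
  finally show ?thesis by (simp add: Ur_def complex_eq_iff)
qed

lemma Ur_le: "w \<in> S \<Longrightarrow> Ur w \<le> herm_trace (G w) (G w + complex_hessian \<phi> w)"
  unfolding Ur_def Uc_def hf_eq gf_def by (rule herm_trace_tangent[OF pos_G pos_H])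

lemma Ur_z: "Ur z = (\<Sum>i\<in>UNIV. lam i)" "herm_trace (G z) (G z + complex_hessian \<phi> z) = (\<Sum>i\<in>UNIV. lam i)"
proof -
  have "Uc z = (\<Sum>i\<in>UNIV. \<Sum>j\<in>UNIV. ((if i = j then 2 else 0) - gf j i z) * (if i = j then of_real (lam i) else 0))"
    unfolding Uc_def hf_z ..
  also have "\<dots> = (\<Sum>i\<in>UNIV. of_real (lam i))"
    unfolding sum_sum_delta(1) by (simp add: gf_z)
  finally show "Ur z = (\<Sum>i\<in>UNIV. lam i)" by (simp add: Ur_def)
  show "herm_trace (G z) (G z + complex_hessian \<phi> z) = (\<Sum>i\<in>UNIV. lam i)"
    unfolding herm_trace_frame[OF frame] by (simp add: diag)
qed

definition "qf i j = (\<lambda>w. (if i = j then 2 else 0) + (- 1) * gf j i w)"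

lemma smooth_qf: "smooth_on (qf i j) S"
  unfolding qf_def by (intro smooth_on_add smooth_on_cmult smooth_on_const S smooth_gf)

lemmas td_qf = twice_diff_smooth[OF smooth_qf S(2)]

lemma Uc_alt: "Uc = (\<lambda>w. \<Sum>i\<in>UNIV. \<Sum>j\<in>UNIV. qf i j w * hf i j w)"
  by (simp add: Uc_def qf_def fun_eq_iff)

lemma wd_qf: "w \<in> S \<Longrightarrow> wd e v (qf i j) w = - wd e v (gf j i) w"
proof -
  assume w: "w \<in> S"
  note d = smooth_on_differentiable[OF smooth_gf w]
  have "wd e v (qf i j) w = wd e v (\<lambda>w. if i = j then 2 else 0) w + wd e v (\<lambda>w. (- 1) * gf j i w) w"
    unfolding qf_def by (rule wd_add[OF differentiable_const differentiable_mult[OF differentiable_const d]])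
  then show ?thesis unfolding wd_cmult[OF d] wd_const by simp
qed

lemma wd_wd_qf: "wd e v (wd e' v' (qf i j)) z = - wd e v (wd e' v' (gf j i)) z"
proof -
  have "wd e v (wd e' v' (qf i j)) z = wd e v (\<lambda>w. (- 1) * wd e' v' (gf j i) w) z"
    by (rule wd_cong_open[OF S]) (simp add: wd_qf)
  also have "\<dots> = - wd e v (wd e' v' (gf j i)) z"
    by (subst wd_cmult[OF smooth_on_differentiable[OF smooth_on_wd[OF S(1) smooth_gf] S(2)]]) simp
  finally show ?thesis .
qed

lemma td_prod: "twice_diff S z (\<lambda>w. qf i j w * hf i j w)"
  by (rule twice_diff_mult[OF S td_qf td_hf])

lemma td_Uc: "twice_diff S z Uc"
  unfolding Uc_alt by (intro twice_diff_sum S td_prod)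

lemma del_Uc: "del (a k) Uc z = (\<Sum>i\<in>UNIV. h1 i i k) - (\<Sum>i\<in>UNIV. g1 i i k * lam i)"
proof -
  note dq = smooth_on_differentiable[OF smooth_qf S(2)] and dh = smooth_on_differentiable[OF smooth_hf S(2)]
  have "del (a k) Uc z = (\<Sum>i\<in>UNIV. \<Sum>j\<in>UNIV. del (a k) (\<lambda>w. qf i j w * hf i j w) z)"
    unfolding Uc_alt
    by (subst wd_sum, intro differentiable_sum ballI differentiable_mult dq dh finite_class.finite_UNIV,
        intro sum.cong refl wd_sum differentiable_mult dq dh)
  also have "\<dots> = (\<Sum>i\<in>UNIV. \<Sum>j\<in>UNIV. (- g1 j i k) * (if i = j then of_real (lam i) else 0)
      + (if i = j then 1 else 0) * h1 i j k)"
    unfolding wd_mult[OF dq dh] wd_qf[OF S(2)] hf_z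
    by (intro sum.cong refl) (simp add: g1_def h1_def qf_def gf_z)
  also have "\<dots> = (\<Sum>i\<in>UNIV. h1 i i k) - (\<Sum>i\<in>UNIV. g1 i i k * lam i)"
    unfolding sum.distrib sum_sum_delta(1)[of "\<lambda>i j. - g1 j i k" "\<lambda>i. of_real (lam i)"]
      sum_sum_delta(2)[of "\<lambda>i. 1" "\<lambda>i j. h1 i j k"] by (simp add: sum_negf)
  finally show ?thesis .
qed

text \<open>The substitute for the inverse of g is affine in g, so no square of first derivatives of
  g appears. The two mixed terms of the Leibniz rule are conjugate to each other, which gives twice
  the real part.\<close>

lemma del_delbar_Uc:
  "Re (del (a k) (delbar (a k) Uc) z) = (\<Sum>i\<in>UNIV. h2 i k)
    - 2 * Re (\<Sum>i\<in>UNIV. \<Sum>j\<in>UNIV. cnj (g1 i j k) * h1 i j k) - (\<Sum>i\<in>UNIV. g2 i k * lam i)"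
proof -
  define D where "D = (\<lambda>f. del (a k) (delbar (a k) f) z)"
  have "D Uc = (\<Sum>i\<in>UNIV. D (\<lambda>w. \<Sum>j\<in>UNIV. qf i j w * hf i j w))"
    unfolding Uc_alt D_def by (rule wd_wd_sum[OF S twice_diff_sum[OF S td_prod]])
  also have "\<dots> = (\<Sum>i\<in>UNIV. \<Sum>j\<in>UNIV. D (\<lambda>w. qf i j w * hf i j w))"
    unfolding D_def by (intro sum.cong refl wd_wd_sum[OF S td_prod])
  also have "\<dots> = (\<Sum>i\<in>UNIV. \<Sum>j\<in>UNIV. (- D (gf j i)) * (if i = j then of_real (lam i) else 0)
      - cnj (g1 i j k) * h1 i j k - g1 j i k * cnj (h1 j i k) + (if i = j then 1 else 0) * D (hf i j))"
    unfolding D_def wd_wd_mult[OF S td_qf td_hf] wd_qf[OF S(2)] wd_wd_qf hf_z delbar_gf delbar_hf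
      g1_def[symmetric] h1_def[symmetric]
    by (intro sum.cong refl) (simp add: qf_def gf_z)
  also have "\<dots> = - (\<Sum>i\<in>UNIV. D (gf i i) * of_real (lam i)) - (\<Sum>i\<in>UNIV. \<Sum>j\<in>UNIV. cnj (g1 i j k) * h1 i j k)
      - (\<Sum>i\<in>UNIV. \<Sum>j\<in>UNIV. g1 j i k * cnj (h1 j i k)) + (\<Sum>i\<in>UNIV. D (hf i i))"
    unfolding sum.distrib sum_subtractf sum_sum_delta(1)[of "\<lambda>i j. - D (gf j i)" "\<lambda>i. of_real (lam i)"]
      sum_sum_delta(2)[of "\<lambda>i. 1" "\<lambda>i j. D (hf i j)"] by (simp add: sum_negf)
  also have "(\<Sum>i\<in>UNIV. \<Sum>j\<in>UNIV. g1 j i k * cnj (h1 j i k)) = cnj (\<Sum>i\<in>UNIV. \<Sum>j\<in>UNIV. cnj (g1 i j k) * h1 i j k)"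
    by (subst sum.swap) simp
  finally show ?thesis unfolding D_def by (simp add: h2_def g2_def)
qed

lemma Ur_diff: "twice_diff S z Ur"
  unfolding Ur_def[abs_def] by (rule twice_diff_bounded_linear[OF S td_Uc bounded_linear_Re])

lemma norm_del_of_real:
  assumes "f differentiable at w"
  shows "(norm (del v (\<lambda>w. complex_of_real (f w)) w))\<^sup>2 = ((dd v f w)\<^sup>2 + (dd (\<i> *s v) f w)\<^sup>2) / 4"
  unfolding wd_of_real[OF assms] cmod_power2 by (simp add: field_simps power2_eq_square)

text \<open>The line inequalities for \<open>a k\<close> and for its multiple by the imaginary unit
  are added; the common factor 1/4 turns real derivatives into \<open>del\<close> and
  \<open>delbar\<close>. The factors \<open>A + 1 / b\<^sup>2\<close> and \<open>2 / b ^ 3\<close>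
  are minus the first and plus the second derivative of \<open>h\<close> at
  \<open>\<phi> z\<close>.\<close>

lemma max_principle:
  assumes m: "\<And>w. w \<in> S \<Longrightarrow> m \<le> \<phi> w"
    and max: "\<And>w. w \<in> S \<Longrightarrow>
      herm_trace (G w) (G w + complex_hessian \<phi> w) * exp (- A * \<phi> w + 1 / (\<phi> w - m + 1))
      \<le> herm_trace (G z) (G z + complex_hessian \<phi> z) * exp (- A * \<phi> z + 1 / (\<phi> z - m + 1))"
    and A: "0 \<le> A"
  defines "b \<equiv> \<phi> z - m + 1" and "U \<equiv> \<Sum>i\<in>UNIV. lam i"
  shows "norm (del (a k) Uc z) = U * (A + 1 / b\<^sup>2) * norm (del (a k) \<phi>c z)"
    and "Re (del (a k) (delbar (a k) Uc) z) - (norm (del (a k) Uc z))\<^sup>2 / U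
      - U * (A + 1 / b\<^sup>2) * (lam k - 1) + U * (2 / b ^ 3) * (norm (del (a k) \<phi>c z))\<^sup>2 \<le> 0"
proof -
  define h where "h = (\<lambda>s. - A * s + 1 / (s - m + 1))"
  define h1 where "h1 = (\<lambda>s. - A - 1 / (s - m + 1)\<^sup>2)"
  have b: "b \<ge> 1" using m[OF S(2)] by (simp add: b_def)
  have U: "U > 0" unfolding U_def by (rule sum_pos) (auto simp: lam_pos)
  have Uz: "Ur z = U" unfolding U_def by (rule Ur_z)
  have dh: "(h has_real_derivative h1 s) (at s)" if "m \<le> s" for s
    unfolding h_def h1_def using that
    by (auto intro!: derivative_eq_intros simp: power2_eq_square)
  have dh1: "(h1 has_real_derivative 2 / b ^ 3) (at (\<phi> z))"
  proof -
    have "((\<lambda>t. - A - 1 / t\<^sup>2) has_real_derivative 2 / b ^ 3) (at b)"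
      using b by (auto intro!: derivative_eq_intros simp: field_simps power2_eq_square power3_eq_cube)
    moreover have "((\<lambda>s. s - m + 1) has_real_derivative 1) (at (\<phi> z))"
      by (auto intro!: derivative_eq_intros)
    ultimately show ?thesis
      using DERIV_chain2[of "\<lambda>t. - A - 1 / t\<^sup>2" "2 / b ^ 3" "\<lambda>s. s - m + 1" "\<phi> z" 1 UNIV]
      unfolding h1_def b_def by simp
  qed
  have max': "Ur w * exp (h (\<phi> w)) \<le> Ur z * exp (h (\<phi> z))" if "w \<in> S" for w
  proof -
    have "Ur w * exp (h (\<phi> w)) \<le> herm_trace (G w) (G w + complex_hessian \<phi> w) * exp (h (\<phi> w))"
      by (rule mult_right_mono[OF Ur_le[OF that]]) simp
    also have "\<dots> \<le> herm_trace (G z) (G z + complex_hessian \<phi> z) * exp (h (\<phi> z))"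
      using max[OF that] by (simp add: h_def)
    finally show ?thesis by (simp add: Ur_z)
  qed
  have td: "twice_diff S z \<phi>" by (rule twice_diff_smooth[OF smooth_\<phi> S(2)])
  note line = max_along_line[OF S twice_diffD[OF Ur_diff] twice_diffD[OF td] dh[OF m] dh1 max']
  have Upos: "Ur z > 0" using U Uz by simp
  have l1: "dd v Ur z = - U * h1 (\<phi> z) * dd v \<phi> z" for v
    using line(1)[OF _ _ _ _ Upos] Uz by simp
  have l2: "dd v (dd v Ur) z - (dd v Ur z)\<^sup>2 / U + U * h1 (\<phi> z) * dd v (dd v \<phi>) z + U * (2 / b ^ 3) * (dd v \<phi> z)\<^sup>2 \<le> 0" for v
    using line(2)[OF _ _ _ _ Upos] Uz by simp
  have h1z: "h1 (\<phi> z) = - (A + 1 / b\<^sup>2)" by (simp add: h1_def b_def)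
  have r: "0 \<le> A + 1 / b\<^sup>2" using A by simp
  have nU: "(norm (del v Uc z))\<^sup>2 = ((dd v Ur z)\<^sup>2 + (dd (\<i> *s v) Ur z)\<^sup>2) / 4" for v
  proof -
    have "del v Uc z = del v (\<lambda>w. complex_of_real (Ur w)) z"
      by (rule wd_cong_open[OF S Uc_real])
    then show ?thesis by (simp add: norm_del_of_real[OF twice_diffD(1)[OF Ur_diff S(2)]])
  qed
  have n\<phi>: "(norm (del v \<phi>c z))\<^sup>2 = ((dd v \<phi> z)\<^sup>2 + (dd (\<i> *s v) \<phi> z)\<^sup>2) / 4" for v
    unfolding \<phi>c_def by (rule norm_del_of_real[OF twice_diffD(1)[OF td S(2)]])
  have DU: "Re (del v (delbar v Uc) z) = (dd v (dd v Ur) z + dd (\<i> *s v) (dd (\<i> *s v) Ur) z) / 4" for v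
  proof -
    have "delbar v Uc w = delbar v (\<lambda>w. complex_of_real (Ur w)) w" if "w \<in> S" for w
      by (rule wd_cong_open[OF S(1) that Uc_real])
    then have "del v (delbar v Uc) z = del v (delbar v (\<lambda>w. complex_of_real (Ur w))) z"
      by (rule wd_cong_open[OF S])
    then show ?thesis using Re_del_delbar[OF S twice_diffD[OF Ur_diff]] by simp
  qed
  have D\<phi>: "(dd v (dd v \<phi>) z + dd (\<i> *s v) (dd (\<i> *s v) \<phi>) z) / 4 = Re (del v (delbar v \<phi>c) z)" for v
    unfolding \<phi>c_def by (rule Re_del_delbar[OF S twice_diffD[OF td], symmetric])
  have lam1: "Re (del (a k) (delbar (a k) \<phi>c) z) = lam k - 1"
  proof -
    have "1 + del (a k) (delbar (a k) \<phi>c) z = of_real (lam k)"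
      using hf_z[of k k] gf_z[of k k] by (simp add: hf_def pf_def)
    from arg_cong[OF this, of Re] show ?thesis by simp
  qed
  have "(norm (del (a k) Uc z))\<^sup>2 = (U * (A + 1 / b\<^sup>2) * norm (del (a k) \<phi>c z))\<^sup>2"
  proof -
    define q where "q = A + 1 / b\<^sup>2"
    show ?thesis
      unfolding power_mult_distrib nU n\<phi> l1 h1z q_def[symmetric] by (simp add: field_simps power2_eq_square)
  qed
  then show "norm (del (a k) Uc z) = U * (A + 1 / b\<^sup>2) * norm (del (a k) \<phi>c z)"
    using U r by (simp add: power2_eq_iff_nonneg)
  have "Re (del (a k) (delbar (a k) Uc) z) - (norm (del (a k) Uc z))\<^sup>2 / U
      - U * (A + 1 / b\<^sup>2) * (lam k - 1) + U * (2 / b ^ 3) * (norm (del (a k) \<phi>c z))\<^sup>2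
    = ((dd (a k) (dd (a k) Ur) z - (dd (a k) Ur z)\<^sup>2 / U + U * h1 (\<phi> z) * dd (a k) (dd (a k) \<phi>) z + U * (2 / b ^ 3) * (dd (a k) \<phi> z)\<^sup>2)
      + (dd (\<i> *s a k) (dd (\<i> *s a k) Ur) z - (dd (\<i> *s a k) Ur z)\<^sup>2 / U + U * h1 (\<phi> z) * dd (\<i> *s a k) (dd (\<i> *s a k) \<phi>) z + U * (2 / b ^ 3) * (dd (\<i> *s a k) \<phi> z)\<^sup>2)) / 4"
    unfolding DU nU n\<phi> lam1[symmetric] D\<phi>[symmetric] h1z by (simp add: algebra_simps add_divide_distrib diff_divide_distrib)
  also have "\<dots> \<le> 0" using l2[of "a k"] l2[of "\<i> *s a k"] by simp
  finally show "Re (del (a k) (delbar (a k) Uc) z) - (norm (del (a k) Uc z))\<^sup>2 / U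
      - U * (A + 1 / b\<^sup>2) * (lam k - 1) + U * (2 / b ^ 3) * (norm (del (a k) \<phi>c z))\<^sup>2 \<le> 0" .
qed

text \<open>The differential inequality and the conditions at the maximum bound the trace of g with
  respect to g'; the equation fixes the product of the eigenvalues, and together they bound
  \<open>U\<close>. The choice of \<open>C2\<close> makes \<open>2 * C2\<close> the torsion
  coefficient \<open>4 * c * n\<close>.\<close>

lemma trace_bound_at_max:
  assumes F: "smooth_on F S"
    and det: "\<And>w. w \<in> S \<Longrightarrow> det (G w + complex_hessian \<phi> w) = of_real (exp (F w)) * det (G w)"
    and c1: "\<And>i j k. norm (del (a k) (\<lambda>w. herm_prod (G w) (a i) (a j)) z) \<le> c"
    and c2: "\<And>i k. norm (del (a k) (delbar (a k) (\<lambda>w. herm_prod (G w) (a i) (a i))) z) \<le> c"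
    and c3: "\<And>i. \<bar>Re (del (a i) (delbar (a i) (\<lambda>w. of_real (F w))) z)\<bar> \<le> c"
    and n: "n = real CARD('n)"
    and C1: "C1 = 5 * c\<^sup>2 * n\<^sup>2 + n * (c + n * c + n\<^sup>2 * c\<^sup>2) + 2 * c * n + c"
    and C2: "C2 = 2 * c * n" and A: "A = C1 + C2\<^sup>2 + 1"
    and m: "\<And>w. w \<in> S \<Longrightarrow> m \<le> \<phi> w"
    and max: "\<And>w. w \<in> S \<Longrightarrow>
      herm_trace (G w) (G w + complex_hessian \<phi> w) * exp (- A * \<phi> w + 1 / (\<phi> w - m + 1))
      \<le> herm_trace (G z) (G z + complex_hessian \<phi> z) * exp (- A * \<phi> z + 1 / (\<phi> z - m + 1))"
    and U: "U = herm_trace (G z) (G z + complex_hessian \<phi> z)"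
      "1 \<le> U" "(A + 1)\<^sup>2 * (\<phi> z - m + 1) ^ 3 \<le> U\<^sup>2"
  shows "U \<le> n * (exp (F z) * ((A + 1) * n) ^ (CARD('n) - 1))"
proof -
  have c: "0 \<le> c" using c3 abs_ge_zero order_trans by blast
  have n0: "0 \<le> n" by (simp add: n)
  have C10: "0 \<le> C1" "0 \<le> C2" unfolding C1 C2 using c n0 by simp_all
  have A0: "0 \<le> A" unfolding A using C10 by simp
  have U': "U = (\<Sum>i\<in>UNIV. lam i)" unfolding U(1) by (rule Ur_z)
  have b1: "norm (g1 i j k) \<le> c" for i j k using c1 by (simp add: g1_def gf_def)
  have b2: "\<bar>g2 i k\<bar> \<le> c" for i k
    unfolding g2_def gf_def using c2[of k i] abs_Re_le_cmod order_trans by blast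
  \<comment> \<open>The three summands bound the Hessian of \<open>F\<close>, the \<open>n\<close>
    second derivatives \<open>g2\<close>, and the squares of the derivatives \<open>g1\<close>, of
    which there are \<open>n\<^sup>2\<close>.\<close>
  have ma: "- (c + n * c + n\<^sup>2 * c\<^sup>2) \<le> (\<Sum>k\<in>UNIV. h2 k i / lam k) - (\<Sum>k\<in>UNIV. \<Sum>j\<in>UNIV. (norm (h1 k j i))\<^sup>2 / (lam k * lam j))" for i
  proof -
    have "\<bar>Re (del (a i) (delbar (a i) (\<lambda>w. of_real (F w))) z)\<bar> \<le> c"
      by (rule c3)
    moreover have "\<bar>\<Sum>k\<in>UNIV. g2 k i\<bar> \<le> (\<Sum>k\<in>(UNIV :: 'n set). c)"
      by (rule order_trans[OF sum_abs]) (intro sum_mono b2)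
    moreover have "(\<Sum>k\<in>UNIV. \<Sum>l\<in>UNIV. (norm (g1 k l i))\<^sup>2) \<le> (\<Sum>k\<in>(UNIV :: 'n set). \<Sum>l\<in>(UNIV :: 'n set). c\<^sup>2)"
      by (intro sum_mono power_mono b1) simp
    moreover have "(\<Sum>k\<in>(UNIV :: 'n set). c) = n * c"
      "(\<Sum>k\<in>(UNIV :: 'n set). \<Sum>l\<in>(UNIV :: 'n set). c\<^sup>2) = n\<^sup>2 * c\<^sup>2"
      by (simp_all add: n power2_eq_square)
    ultimately show ?thesis
      using monge_ampere_second_order[OF F det, of i] by linarith
  qed
  have b0: "0 \<le> c + n * c + n\<^sup>2 * c\<^sup>2" using c n0 by simp
  define s where "s = (\<Sum>i\<in>UNIV. 1 / lam i)"
  have lower: "- C1 * U * s - (2 * C2 / U) * (\<Sum>k\<in>UNIV. norm (del (a k) Uc z) / lam k)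
    \<le> (\<Sum>k\<in>UNIV. (Re (del (a k) (delbar (a k) Uc) z) - (norm (del (a k) Uc z))\<^sup>2 / U) / lam k)"
    using second_order_algebra[OF lam_pos sym1 sym2 b1 b2 ma b0 U' U(2) s_def del_Uc del_delbar_Uc n]
    unfolding C1 C2 by (simp add: mult_ac)
  have "s \<le> (A + 1) * n"
  proof (rule sum_inverse_bound_of_max[OF lam_pos s_def n lower])
    show "1 \<le> \<phi> z - m + 1" using m[OF S(2)] by simp
    show "(Re (del (a k) (delbar (a k) Uc) z) - (norm (del (a k) Uc z))\<^sup>2 / U)
      - U * (A + 1 / (\<phi> z - m + 1)\<^sup>2) * (lam k - 1) + U * (2 / (\<phi> z - m + 1) ^ 3) * (norm (del (a k) \<phi>c z))\<^sup>2 \<le> 0" for k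
      using max_principle(2)[OF m max A0, of k] unfolding U' by simp
    show "norm (del (a k) Uc z) = U * (A + 1 / (\<phi> z - m + 1)\<^sup>2) * norm (del (a k) \<phi>c z)" for k
      using max_principle(1)[OF m max A0, of k] unfolding U' by simp
  qed (use C10 A U in auto)
  moreover have "(\<Prod>i\<in>UNIV. lam i) = exp (F z)"
  proof -
    have "(\<Prod>i\<in>UNIV. complex_of_real (lam i)) * det (G z) = of_real (exp (F z)) * det (G z)"
      unfolding det_simultaneous[OF frame diag, symmetric] by (rule det[OF S(2)])
    then have "complex_of_real (\<Prod>i\<in>UNIV. lam i) = of_real (exp (F z))"
      unfolding mult_right_cancel[OF unitary_frame_matrix(4)[OF frame]] of_real_prod .
    then show ?thesis by (simp only: of_real_eq_iff)
  qed
  ultimately show ?thesis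
    unfolding U' n using sum_le_of_prod_le[of lam "exp (F z)", OF lam_pos] by (simp add: s_def n)
qed

end

section \<open>Uniform bounds\<close>

text \<open>Continuity bounds the derivatives in the finitely many basis directions; linearity in
  the direction gives all others with one constant.\<close>

lemma dd_bound_compact:
  fixes f :: "'v::euclidean_space \<Rightarrow> complex"
  assumes S: "open S" "K \<subseteq> S" "compact K" and f: "smooth_on f S"
  shows "\<exists>b\<ge>0. \<forall>z\<in>K. \<forall>x. norm (dd x f z) \<le> b * norm x"
proof -
  have "\<exists>B. \<forall>z\<in>K. norm (dd e f z) \<le> B" for e
  proof -
    have "continuous_on K (dd e f)"
      using smooth_on_continuous[OF smooth_on_dd[OF f]] S(2) continuous_on_subset by blast
    from compact_imp_bounded[OF compact_continuous_image[OF this S(3)]] show ?thesis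
      by (auto simp: bounded_iff)
  qed
  then obtain B where B: "\<forall>e. \<forall>z\<in>K. norm (dd e f z) \<le> B e"
    by (rule choice[THEN exE, OF allI])
  define b where "b = (\<Sum>e\<in>Basis. \<bar>B e\<bar>)"
  have "norm (dd x f z) \<le> b * norm x" if z: "z \<in> K" for x z
  proof -
    have "f differentiable at z" using smooth_on_differentiable[OF f] S z by blast
    then have "norm (dd x f z) = norm (\<Sum>e\<in>Basis. (x \<bullet> e) *\<^sub>R dd e f z)"
      using dd_Basis[of f z x] by simp
    also have "\<dots> \<le> (\<Sum>e\<in>Basis. norm x * \<bar>B e\<bar>)"
    proof (rule sum_norm_le)
      fix e :: 'v assume "e \<in> Basis"
      then have "\<bar>x \<bullet> e\<bar> \<le> norm x" by (rule Basis_le_norm)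
      moreover have "norm (dd e f z) \<le> \<bar>B e\<bar>" using B z abs_ge_self order_trans by blast
      ultimately show "norm ((x \<bullet> e) *\<^sub>R dd e f z) \<le> norm x * \<bar>B e\<bar>"
        unfolding norm_scaleR by (intro mult_mono) auto
    qed
    also have "\<dots> = b * norm x" by (simp add: b_def sum_distrib_left[symmetric] mult.commute)
    finally show ?thesis .
  qed
  moreover have "0 \<le> b" by (simp add: b_def sum_nonneg)
  ultimately show ?thesis by blast
qed

lemma dd_dd_bound_compact:
  fixes f :: "'v::euclidean_space \<Rightarrow> complex"
  assumes S: "open S" "K \<subseteq> S" "compact K" and f: "smooth_on f S"
  shows "\<exists>b\<ge>0. \<forall>z\<in>K. \<forall>x y. norm (dd x (dd y f) z) \<le> b * norm x * norm y"
proof -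
  have "\<exists>b. 0 \<le> b \<and> (\<forall>z\<in>K. \<forall>x. norm (dd x (dd e f) z) \<le> b * norm x)" for e
    using dd_bound_compact[OF S smooth_on_dd[OF f, of e]] by blast
  then obtain B where B: "\<forall>e. 0 \<le> B e \<and> (\<forall>z\<in>K. \<forall>x. norm (dd x (dd e f) z) \<le> B e * norm x)"
    by (rule choice[THEN exE, OF allI])
  define b where "b = (\<Sum>e\<in>Basis. B e)"
  have "norm (dd x (dd y f) z) \<le> b * norm x * norm y" if z: "z \<in> K" for x y z
  proof -
    have zS: "z \<in> S" using S z by blast
    have "dd x (dd y f) z = dd x (\<lambda>w. \<Sum>e\<in>Basis. (y \<bullet> e) *\<^sub>R dd e f w) z"
      by (rule dd_cong_open[OF S(1) zS]) (rule dd_Basis[OF smooth_on_differentiable[OF f]])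
    also have "\<dots> = (\<Sum>e\<in>Basis. (y \<bullet> e) *\<^sub>R dd x (dd e f) z)"
      by (rule dd_eq) (intro has_derivative_sum has_derivative_scaleR_right has_derivative_dd
          smooth_on_differentiable[OF smooth_on_dd[OF f] zS])
    finally have "norm (dd x (dd y f) z) = norm (\<Sum>e\<in>Basis. (y \<bullet> e) *\<^sub>R dd x (dd e f) z)" by simp
    also have "\<dots> \<le> (\<Sum>e\<in>Basis. norm y * (B e * norm x))"
    proof (rule sum_norm_le)
      fix e :: 'v assume "e \<in> Basis"
      then have "\<bar>y \<bullet> e\<bar> \<le> norm y" by (rule Basis_le_norm)
      moreover have "norm (dd x (dd e f) z) \<le> B e * norm x" using B z by blast
      ultimately show "norm ((y \<bullet> e) *\<^sub>R dd x (dd e f) z) \<le> norm y * (B e * norm x)"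
        unfolding norm_scaleR by (intro mult_mono) auto
    qed
    also have "\<dots> = b * norm x * norm y"
      by (simp add: b_def sum_distrib_left sum_distrib_right mult_ac)
    finally show ?thesis .
  qed
  moreover have "0 \<le> b" using B by (simp add: b_def sum_nonneg)
  ultimately show ?thesis by blast
qed

lemma herm_prod_dd_bound_compact:
  fixes G :: "complex^'n::finite \<Rightarrow> complex^'n^'n"
  assumes S: "open S" "K \<subseteq> S" "compact K" and G: "\<And>i j. smooth_on (\<lambda>w. G w $ i $ j) S"
  shows "\<exists>b\<ge>0. \<forall>z\<in>K. \<forall>x y u v. norm (dd x (\<lambda>w. herm_prod (G w) u v) z) \<le> b * norm x * norm u * norm v \<and>
    norm (dd x (dd y (\<lambda>w. herm_prod (G w) u v)) z) \<le> b * norm x * norm y * norm u * norm v"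
proof -
  have "\<exists>b. 0 \<le> b \<and> (\<forall>z\<in>K. \<forall>x. norm (dd x (\<lambda>w. G w $ fst kl $ snd kl) z) \<le> b * norm x)" for kl
    using dd_bound_compact[OF S G[of "fst kl" "snd kl"]] by blast
  then obtain B1 where B1: "\<forall>kl. 0 \<le> B1 kl \<and> (\<forall>z\<in>K. \<forall>x. norm (dd x (\<lambda>w. G w $ fst kl $ snd kl) z) \<le> B1 kl * norm x)"
    by (rule choice[THEN exE, OF allI])
  have "\<exists>b. 0 \<le> b \<and> (\<forall>z\<in>K. \<forall>x y. norm (dd x (dd y (\<lambda>w. G w $ fst kl $ snd kl)) z) \<le> b * norm x * norm y)" for kl
    using dd_dd_bound_compact[OF S G[of "fst kl" "snd kl"]] by blast
  then obtain B2 where B2: "\<forall>kl. 0 \<le> B2 kl \<and> (\<forall>z\<in>K. \<forall>x y. norm (dd x (dd y (\<lambda>w. G w $ fst kl $ snd kl)) z) \<le> B2 kl * norm x * norm y)"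
    by (rule choice[THEN exE, OF allI])
  define b where "b = (\<Sum>k\<in>UNIV. \<Sum>l\<in>UNIV. B1 (k, l) + B2 (k, l))"
  have b0: "0 \<le> b" unfolding b_def using B1 B2 by (intro sum_nonneg) (simp add: add_nonneg_nonneg)
  have B12: "B1 kl \<le> B1 kl + B2 kl" "B2 kl \<le> B1 kl + B2 kl" for kl
  proof -
    have "0 \<le> B1 kl" "0 \<le> B2 kl" using B1 B2 by blast+
    then show "B1 kl \<le> B1 kl + B2 kl" "B2 kl \<le> B1 kl + B2 kl" by simp_all
  qed
  have uv: "norm ((u $ k * cnj (v $ l)) * t) \<le> (B1 (k, l) + B2 (k, l)) * (s * norm u * norm v)"
    if t: "norm t \<le> (B1 (k, l) + B2 (k, l)) * s" "0 \<le> s" for u v :: "complex^'n" and k l t s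
  proof -
    have "norm ((u $ k * cnj (v $ l)) * t) \<le> (norm u * norm v) * ((B1 (k, l) + B2 (k, l)) * s)"
      unfolding norm_mult complex_mod_cnj
      by (intro mult_mono t Finite_Cartesian_Product.norm_nth_le) (auto intro!: mult_nonneg_nonneg)
    then show ?thesis by (simp add: mult_ac)
  qed
  have "norm (dd x (\<lambda>w. herm_prod (G w) u v) z) \<le> b * norm x * norm u * norm v"
    and "norm (dd x (dd y (\<lambda>w. herm_prod (G w) u v)) z) \<le> b * norm x * norm y * norm u * norm v"
    if z: "z \<in> K" for z x y u v
  proof -
    have zS: "z \<in> S" using S z by blast
    have h: "(\<lambda>w. herm_prod (G w) u v) = (\<lambda>w. \<Sum>k\<in>UNIV. \<Sum>l\<in>UNIV. (u $ k * cnj (v $ l)) * G w $ k $ l)"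
      by (simp add: herm_prod_def fun_eq_iff mult_ac)
    have d1: "dd x (\<lambda>w. herm_prod (G w) u v) w = (\<Sum>k\<in>UNIV. \<Sum>l\<in>UNIV. (u $ k * cnj (v $ l)) * dd x (\<lambda>w. G w $ k $ l) w)"
      if "w \<in> S" for x w
      unfolding h by (rule dd_eq) (intro has_derivative_sum has_derivative_mult_right has_derivative_dd
          smooth_on_differentiable[OF G that])
    have d2: "dd x (dd y (\<lambda>w. herm_prod (G w) u v)) z
        = (\<Sum>k\<in>UNIV. \<Sum>l\<in>UNIV. (u $ k * cnj (v $ l)) * dd x (dd y (\<lambda>w. G w $ k $ l)) z)"
    proof -
      have "dd x (dd y (\<lambda>w. herm_prod (G w) u v)) z
        = dd x (\<lambda>w. \<Sum>k\<in>UNIV. \<Sum>l\<in>UNIV. (u $ k * cnj (v $ l)) * dd y (\<lambda>w. G w $ k $ l) w) z"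
        by (rule dd_cong_open[OF S(1) zS d1])
      also have "\<dots> = (\<Sum>k\<in>UNIV. \<Sum>l\<in>UNIV. (u $ k * cnj (v $ l)) * dd x (dd y (\<lambda>w. G w $ k $ l)) z)"
        by (rule dd_eq) (intro has_derivative_sum has_derivative_mult_right has_derivative_dd
          smooth_on_differentiable[OF smooth_on_dd[OF G] zS])
      finally show ?thesis .
    qed
    have "norm (dd x (\<lambda>w. herm_prod (G w) u v) z) \<le> (\<Sum>k\<in>UNIV. \<Sum>l\<in>UNIV. (B1 (k, l) + B2 (k, l)) * (norm x * norm u * norm v))"
      unfolding d1[OF zS]
    proof (intro sum_norm_le uv)
      fix k l :: 'n
      have "norm (dd x (\<lambda>w. G w $ k $ l) z) \<le> B1 (k, l) * norm x" using B1[rule_format, of "(k, l)"] z by simp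
      also have "\<dots> \<le> (B1 (k, l) + B2 (k, l)) * norm x" by (intro mult_right_mono B12) simp
      finally show "norm (dd x (\<lambda>w. G w $ k $ l) z) \<le> (B1 (k, l) + B2 (k, l)) * norm x" .
    qed simp
    then show "norm (dd x (\<lambda>w. herm_prod (G w) u v) z) \<le> b * norm x * norm u * norm v"
      by (simp add: b_def sum_distrib_right mult.assoc)
    have "norm (dd x (dd y (\<lambda>w. herm_prod (G w) u v)) z)
        \<le> (\<Sum>k\<in>UNIV. \<Sum>l\<in>UNIV. (B1 (k, l) + B2 (k, l)) * ((norm x * norm y) * norm u * norm v))"
      unfolding d2
    proof (intro sum_norm_le uv)
      fix k l :: 'n
      have "norm (dd x (dd y (\<lambda>w. G w $ k $ l)) z) \<le> B2 (k, l) * norm x * norm y"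
        using B2[rule_format, of "(k, l)"] z by simp
      also have "\<dots> \<le> (B1 (k, l) + B2 (k, l)) * norm x * norm y" by (intro mult_right_mono B12) simp_all
      finally show "norm (dd x (dd y (\<lambda>w. G w $ k $ l)) z) \<le> (B1 (k, l) + B2 (k, l)) * (norm x * norm y)"
        by (simp add: mult.assoc)
    qed simp
    then show "norm (dd x (dd y (\<lambda>w. herm_prod (G w) u v)) z) \<le> b * norm x * norm y * norm u * norm v"
      by (simp add: b_def sum_distrib_right mult.assoc)
  qed
  with b0 show ?thesis by blast
qed

text \<open>The quadratic form has a positive minimum over \<open>K\<close> times the unit sphere,
  and a vector on which it equals 1 cannot be longer than the inverse square root of that minimum.
  The bound covers all frames at once, as required for a frame that depends on \<phi>.\<close>

lemma unitary_frame_bound_compact: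
  fixes G :: "complex^'n::finite \<Rightarrow> complex^'n^'n"
  assumes K: "compact K" and G: "\<And>i j. continuous_on K (\<lambda>w. G w $ i $ j)"
    and pos: "\<And>w. w \<in> K \<Longrightarrow> hermitian_pos_def (G w)"
  shows "\<exists>R>0. \<forall>z\<in>K. \<forall>a. unitary_frame (G z) a \<longrightarrow> (\<forall>i. norm (a i) \<le> R)"
proof (cases "K = {}")
  case False
  define f where "f = (\<lambda>p :: (complex^'n) \<times> (complex^'n). Re (herm_prod (G (fst p)) (snd p) (snd p)))"
  have "continuous_on (K \<times> sphere 0 1) f"
    unfolding f_def herm_prod_def
    by (intro continuous_intros continuous_on_compose2[OF G continuous_on_fst[OF continuous_on_id]]) auto
  moreover have "compact (K \<times> sphere (0 :: complex^'n) 1)" by (intro compact_Times K compact_sphere)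
  moreover have "K \<times> sphere (0 :: complex^'n) 1 \<noteq> {}"
    using False by simp
  ultimately obtain p where p: "p \<in> K \<times> sphere 0 1" "\<And>q. q \<in> K \<times> sphere 0 1 \<Longrightarrow> f p \<le> f q"
    using continuous_attains_inf by metis
  have fp: "f p > 0"
  proof -
    have "fst p \<in> K" "norm (snd p) = 1" using p(1) by (auto simp: mem_Times_iff)
    moreover from this have "snd p \<noteq> 0" by auto
    ultimately show ?thesis using pos unfolding f_def hermitian_pos_def_def by blast
  qed
  define R where "R = 1 / sqrt (f p)"
  have R: "R > 0" using fp by (simp add: R_def)
  have "norm (a i) \<le> R" if z: "z \<in> K" and a: "unitary_frame (G z) a" for z a i
  proof -
    have one: "herm_prod (G z) (a i) (a i) = 1" using a by (simp add: unitary_frame_def)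
    then have "a i \<noteq> 0" by auto
    then have na: "norm (a i) > 0" by simp
    define v where "v = (1 / norm (a i)) *\<^sub>R a i"
    have "norm v = 1" using na by (simp add: v_def)
    then have "f p \<le> f (z, v)" using p(2)[of "(z, v)"] z by simp
    also have "f (z, v) = (1 / norm (a i))\<^sup>2"
      by (simp add: f_def v_def herm_prod_scaleR_left herm_prod_scaleR_right one power2_eq_square)
    finally have "f p * (norm (a i))\<^sup>2 \<le> 1" using na by (simp add: field_simps power_divide)
    then have "(sqrt (f p) * norm (a i))\<^sup>2 \<le> 1\<^sup>2" using fp by (simp add: power_mult_distrib)
    then have "sqrt (f p) * norm (a i) \<le> 1" by (rule power2_le_imp_le) simp
    then show ?thesis using fp by (simp add: R_def field_simps)
  qed
  with R show ?thesis by blast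
qed (auto intro: exI[of _ 1])

lemma norm_i_smult [simp]: "norm (\<i> *s (a :: complex^'n::finite)) = norm a"
  by (simp add: norm_vec_def norm_mult)

lemma norm_del_le:
  assumes "norm (dd a f z) \<le> t" "norm (dd (\<i> *s a) f z) \<le> t"
  shows "norm (del a f z) \<le> t"
proof -
  have "norm (dd a f z + - \<i> * dd (\<i> *s a) f z) \<le> t + t"
    by (rule norm_triangle_mono) (use assms in \<open>simp_all add: norm_mult\<close>)
  then show ?thesis by (simp add: wd_def norm_divide)
qed

lemma dd_wd:
  assumes S: "open S" "z \<in> S" and f: "smooth_on f S"
  shows "dd v (wd e b f) z = (dd v (dd b f) z + e * dd v (dd (\<i> *s b) f) z) / 2"
proof -
  note d = smooth_on_differentiable[OF smooth_on_dd[OF f] S(2)]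
  have "((\<lambda>z. (1/2) * (dd b f z + e * dd (\<i> *s b) f z)) has_derivative
      (\<lambda>v. (1/2) * (dd v (dd b f) z + e * dd v (dd (\<i> *s b) f) z))) (at z)"
    by (intro has_derivative_mult_right has_derivative_add has_derivative_dd d)
  then show ?thesis unfolding wd_alt by (simp add: dd_eq)
qed

lemma norm_del_delbar_le:
  assumes S: "open S" "z \<in> S" and f: "smooth_on f S"
    and t: "\<And>x y. x \<in> {a, \<i> *s a} \<Longrightarrow> y \<in> {a, \<i> *s a} \<Longrightarrow> norm (dd x (dd y f) z) \<le> t"
  shows "norm (del a (delbar a f) z) \<le> t"
proof -
  have "norm (dd v (delbar a f) z) \<le> t" if v: "v \<in> {a, \<i> *s a}" for v
  proof -
    have "norm (dd v (dd a f) z + \<i> * dd v (dd (\<i> *s a) f) z) \<le> t + t"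
      by (rule norm_triangle_mono) (use t v in \<open>simp_all add: norm_mult\<close>)
    then show ?thesis unfolding dd_wd[OF S f] by (simp add: norm_divide)
  qed
  then show ?thesis by (intro norm_del_le) simp_all
qed

section \<open>From \<open>cm_norm\<close> to coordinate derivatives\<close>

lemma orthonormal_frame_expand:
  assumes B: "orthonormal_frame h B" and lin: "\<And>y. linear (\<lambda>x. h x y)"
  shows "x = (\<Sum>b\<in>B. h x b *\<^sub>R b)"
proof -
  have fin: "finite B" and sp: "span B = UNIV" and on: "\<And>u v. u \<in> B \<Longrightarrow> v \<in> B \<Longrightarrow> h u v = (if u = v then 1 else 0)"
    using B by (auto simp: orthonormal_frame_def)
  have "x \<in> span B" using sp by simp
  then obtain c where c: "x = (\<Sum>b\<in>B. c b *\<^sub>R b)"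
    unfolding span_finite[OF fin] by auto
  have "h x b = c b" if b: "b \<in> B" for b
  proof -
    have "h x b = (\<Sum>u\<in>B. h (c u *\<^sub>R u) b)" unfolding c by (rule linear_sum[OF lin])
    also have "\<dots> = (\<Sum>u\<in>B. if u = b then c u else 0)"
      by (rule sum.cong) (simp_all add: linear_scale[OF lin] on b)
    also have "\<dots> = c b" using b fin by simp
    finally show ?thesis .
  qed
  then show ?thesis using c by simp
qed

text \<open>\<open>Q\<close> is the right-hand side of the Koszul formula. Being linear in
  \<open>y\<close>, it is represented by exactly one vector, which can be read off in an orthonormal
  frame; this resolves the description operator.\<close>

lemma christoffel_orthonormal:
  assumes B: "orthonormal_frame (h z) B" and lin: "\<And>y. linear (\<lambda>x. h z x y)"
    and sym: "\<And>x y. h z x y = h z y x" and Q: "linear Q"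
    and Q_def: "\<And>y. Q y = frechet_derivative (\<lambda>x. h x v y) (at z) u
     + frechet_derivative (\<lambda>x. h x u y) (at z) v - frechet_derivative (\<lambda>x. h x u v) (at z) y"
  shows "christoffel h z u v = (\<Sum>b\<in>B. (Q b / 2) *\<^sub>R b)"
  unfolding christoffel_def Q_def[symmetric]
proof (rule the_equality)
  define w where "w = (\<Sum>b\<in>B. (Q b / 2) *\<^sub>R b)"
  have w: "2 * h z w y = Q y" for y
  proof -
    have "h z w y = (\<Sum>b\<in>B. (Q b / 2) * h z b y)"
      unfolding w_def linear_sum[OF lin] by (simp add: linear_scale[OF lin])
    also have "\<dots> = (\<Sum>b\<in>B. Q (h z y b *\<^sub>R b)) / 2"
      by (simp add: linear_scale[OF Q] sum_divide_distrib sym mult.commute)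
    also have "(\<Sum>b\<in>B. Q (h z y b *\<^sub>R b)) = Q y"
      using linear_sum[OF Q, of "\<lambda>b. h z y b *\<^sub>R b" B] orthonormal_frame_expand[OF B lin, of y] by simp
    finally show ?thesis by simp
  qed
  then show "\<forall>y. 2 * h z (\<Sum>b\<in>B. (Q b / 2) *\<^sub>R b) y = Q y" by (simp add: w_def)
  fix w' assume w': "\<forall>y. 2 * h z w' y = Q y"
  have "w' = (\<Sum>b\<in>B. h z w' b *\<^sub>R b)" by (rule orthonormal_frame_expand[OF B lin])
  also have "\<dots> = (\<Sum>b\<in>B. (Q b / 2) *\<^sub>R b)"
  proof (rule sum.cong[OF refl])
    fix b
    have "2 * h z w' b = Q b" using w' by blast
    then show "h z w' b *\<^sub>R b = (Q b / 2) *\<^sub>R b" by (simp add: field_simps)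
  qed
  finally show "w' = (\<Sum>b\<in>B. (Q b / 2) *\<^sub>R b)" .
qed

lemma linear_riem: "linear (\<lambda>x. riem g \<kappa> z x y)" "linear (\<lambda>y. riem g \<kappa> z x y)"
  by (auto intro!: linearI simp: riem_def herm_prod_add_left herm_prod_add_right herm_prod_scaleR_left
      herm_prod_scaleR_right algebra_simps)

lemma riem_sym: "hermitian_pos_def (g \<kappa> z) \<Longrightarrow> riem g \<kappa> z x y = riem g \<kappa> z y x"
  using hermitian_pos_def_cnj[of "g \<kappa> z" x y] by (simp add: riem_def complex_eq_iff)

text \<open>The factor \<open>1 / sqrt 2\<close> compensates the factor 2 in
  \<open>riem\<close>.\<close>

definition real_frame :: "('n \<Rightarrow> complex^'n) \<Rightarrow> (complex^'n::finite) set" where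
  "real_frame a = (\<lambda>p. (1 / sqrt 2) *\<^sub>R (snd p *s a (fst p))) ` (UNIV \<times> {1, \<i>})"

lemma orthonormal_real_frame:
  assumes a: "unitary_frame (g \<kappa> z) a"
  shows "orthonormal_frame (riem g \<kappa> z) (real_frame a)"
proof -
  define r where "r = (\<lambda>i s. (1 / sqrt 2) *\<^sub>R (s *s a i))"
  have h: "riem g \<kappa> z (r i s) (r j t) = (if i = j then Re (s * cnj t) else 0)" for i j s t
  proof -
    have "herm_prod (g \<kappa> z) (r i s) (r j t) = of_real (1 / sqrt 2) * (of_real (1 / sqrt 2) * (s * (cnj t * (if i = j then 1 else 0))))"
      unfolding r_def herm_prod_scaleR_left herm_prod_scaleR_right herm_prod_smult_left herm_prod_smult_right
      using a by (simp add: unitary_frame_def)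
    also have "\<dots> = (of_real (1 / sqrt 2) * of_real (1 / sqrt 2)) * (s * (cnj t * (if i = j then 1 else 0)))"
      by (simp only: mult.assoc)
    also have "complex_of_real (1 / sqrt 2) * of_real (1 / sqrt 2) = of_real (1 / 2)"
      unfolding of_real_mult[symmetric] by simp
    finally have eq: "herm_prod (g \<kappa> z) (r i s) (r j t) = of_real (1 / 2) * (s * (cnj t * (if i = j then 1 else 0)))" .
    show ?thesis unfolding riem_def eq by simp
  qed
  have frame: "real_frame a = {r i s | i s. s = 1 \<or> s = \<i>}"
    by (force simp: real_frame_def r_def)
  have "v \<in> span (real_frame a)" for v
  proof -
    have eq: "c *s a i = (Re c * sqrt 2) *\<^sub>R r i 1 + (Im c * sqrt 2) *\<^sub>R r i \<i>" for c i
      by (simp add: r_def vec_eq_iff complex_eq_iff)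
    have "c *s a i \<in> span (real_frame a)" for c i
      unfolding frame eq[of c i] by (intro span_add span_scale span_base) auto
    then have "(\<Sum>i\<in>UNIV. herm_prod (g \<kappa> z) v (a i) *s a i) \<in> span (real_frame a)"
      by (intro span_sum)
    then show ?thesis using unitary_frame_expand[OF a, of v] by simp
  qed
  moreover have "riem g \<kappa> z u v = (if u = v then 1 else 0)" if uv: "u \<in> real_frame a" "v \<in> real_frame a" for u v
  proof -
    obtain i s j t where u: "u = r i s" "s = 1 \<or> s = \<i>" and v: "v = r j t" "t = 1 \<or> t = \<i>"
      using uv unfolding frame by blast
    have vv: "riem g \<kappa> z v v = 1" using v by (auto simp: h)
    show ?thesis
    proof (cases "i = j \<and> s = t")
      case True
      then show ?thesis using u v vv by simp
    next
      case False
      then have "riem g \<kappa> z u v = 0" using u v by (auto simp: h)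
      then show ?thesis using vv by auto
    qed
  qed
  moreover have "finite (real_frame a)" by (simp add: real_frame_def)
  ultimately show ?thesis by (auto simp: orthonormal_frame_def)
qed

lemma norm_real_frame_le:
  assumes "\<And>i. norm (a i) \<le> R" "b \<in> real_frame a"
  shows "norm b \<le> R"
proof -
  obtain p where p: "p \<in> UNIV \<times> {1, \<i>}" "b = (1 / sqrt 2) *\<^sub>R (snd p *s a (fst p))"
    using assms(2) unfolding real_frame_def by blast
  define i where "i = fst p"
  have "norm (snd p *s a i) = norm (a i)" using p(1) by (cases p) auto
  then have "norm b = (1 / sqrt 2) * norm (a i)" unfolding p(2) i_def by simp
  also have "\<dots> \<le> 1 * norm (a i)" by (intro mult_right_mono) (auto simp: field_simps)
  finally show ?thesis using assms(1)[of i] by simp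
qed

lemma card_real_frame: "card (real_frame (a :: 'n \<Rightarrow> complex^'n::finite)) \<le> 2 * CARD('n)"
proof -
  have "card (real_frame a) \<le> card ((UNIV :: 'n set) \<times> {1, \<i>})"
    unfolding real_frame_def by (rule card_image_le) simp
  also have "\<dots> = 2 * CARD('n)" by (simp add: card_cartesian_product)
  finally show ?thesis .
qed

text \<open>Every layer of the norm is a supremum, or a sum of nonnegative terms, so it dominates
  each single component in an orthonormal frame.\<close>

lemma cov_deriv_bound:
  assumes cm: "cm_norm \<A> g m f \<le> ennreal C" and C: "0 \<le> C" and \<kappa>: "\<kappa> \<in> \<A>" "z \<in> chart_image \<kappa>"
    and B: "orthonormal_frame (riem g \<kappa> z) B" and vs: "set vs \<subseteq> B" "length vs \<le> m"
  shows "\<bar>cov_deriv (riem g \<kappa>) (f \<circ> chart_inv \<kappa>) vs z\<bar> \<le> C"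
proof -
  let ?T = "\<lambda>\<kappa> z vs. cov_deriv (riem g \<kappa>) (f \<circ> chart_inv \<kappa>) vs z"
  let ?s = "\<lambda>k. SUP \<kappa>\<in>\<A>. SUP z\<in>chart_image \<kappa>. tensor_norm (riem g \<kappa> z) k (?T \<kappa> z)"
  define k where "k = length vs"
  have fin: "finite {vs. set vs \<subseteq> B \<and> length vs = k}"
    using B finite_lists_length_eq by (auto simp: orthonormal_frame_def)
  have "ennreal (sqrt (\<Sum>vs | set vs \<subseteq> B \<and> length vs = k. (?T \<kappa> z vs)\<^sup>2)) \<le> tensor_norm (riem g \<kappa> z) k (?T \<kappa> z)"
    unfolding tensor_norm_def by (rule SUP_upper) (simp add: B)
  also have "\<dots> \<le> (SUP z\<in>chart_image \<kappa>. tensor_norm (riem g \<kappa> z) k (?T \<kappa> z))"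
    by (rule SUP_upper[OF \<kappa>(2)])
  also have "\<dots> \<le> ?s k"
    by (rule SUP_upper[OF \<kappa>(1), where f = "\<lambda>\<kappa>. SUP z\<in>chart_image \<kappa>. tensor_norm (riem g \<kappa> z) k (?T \<kappa> z)"])
  also have "\<dots> \<le> (\<Sum>k\<le>m. ?s k)"
    by (rule member_le_sum[where f = ?s]) (use vs in \<open>auto simp: k_def\<close>)
  also have "\<dots> \<le> ennreal C" using cm unfolding cm_norm_def .
  finally have sq: "sqrt (\<Sum>vs | set vs \<subseteq> B \<and> length vs = k. (?T \<kappa> z vs)\<^sup>2) \<le> C"
    using C by (simp add: ennreal_le_iff)
  have "\<bar>?T \<kappa> z vs\<bar> = sqrt ((?T \<kappa> z vs)\<^sup>2)" by simp
  also have "\<dots> \<le> sqrt (\<Sum>vs | set vs \<subseteq> B \<and> length vs = k. (?T \<kappa> z vs)\<^sup>2)"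
    by (intro real_sqrt_le_mono member_le_sum[where f = "\<lambda>vs. (?T \<kappa> z vs)\<^sup>2"]) (use fin vs in \<open>auto simp: k_def\<close>)
  finally show ?thesis using sq by linarith
qed

lemma dd_herm_prod:
  fixes G :: "complex^'n::finite \<Rightarrow> complex^'n^'n"
  assumes "\<And>i j. (\<lambda>w. G w $ i $ j) differentiable at z"
  shows "dd x (\<lambda>w. herm_prod (G w) u v) z = herm_prod (\<chi> i j. dd x (\<lambda>w. G w $ i $ j) z) u v"
    and "(\<lambda>w. herm_prod (G w) u v) differentiable at z"
proof -
  have h: "(\<lambda>w. herm_prod (G w) u v) = (\<lambda>w. \<Sum>k\<in>UNIV. \<Sum>l\<in>UNIV. (u $ k * cnj (v $ l)) * G w $ k $ l)"
    by (simp add: herm_prod_def fun_eq_iff mult_ac)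
  have d: "((\<lambda>w. herm_prod (G w) u v) has_derivative
      (\<lambda>x. \<Sum>k\<in>UNIV. \<Sum>l\<in>UNIV. (u $ k * cnj (v $ l)) * dd x (\<lambda>w. G w $ k $ l) z)) (at z)"
    unfolding h by (intro has_derivative_sum has_derivative_mult_right has_derivative_dd assms)
  then show "dd x (\<lambda>w. herm_prod (G w) u v) z = herm_prod (\<chi> i j. dd x (\<lambda>w. G w $ i $ j) z) u v"
    by (subst dd_eq) (auto simp: herm_prod_def mult_ac)
  from d show "(\<lambda>w. herm_prod (G w) u v) differentiable at z" by (rule differentiableI)
qed

lemma dd_riem:
  fixes g :: "('a, 'n::finite) metric"
  assumes "\<And>i j. (\<lambda>w. g \<kappa> w $ i $ j) differentiable at z"
  shows "dd x (\<lambda>w. riem g \<kappa> w u v) z = 2 * Re (dd x (\<lambda>w. herm_prod (g \<kappa> w) u v) z)"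
proof -
  have "bounded_linear (\<lambda>c. 2 * Re c)"
    by (rule bounded_linear_compose[OF bounded_linear_mult_right bounded_linear_Re])
  then show ?thesis
    unfolding riem_def by (rule dd_bounded_linear[OF _ dd_herm_prod(2)[OF assms]])
qed

text \<open>An ordinary second derivative is the covariant one, bounded by \<open>K2\<close>, plus a
  first derivative along the Christoffel vector. That vector has at most
  \<open>2 * real CARD('n)\<close> components, each at most \<open>3 * b * R ^ 3\<close>: half of
  the three Koszul terms, which are at most \<open>2 * b * R ^ 3\<close> each.\<close>

lemma second_derivative_bound:
  fixes g :: "('a, 'n::finite) metric"
  assumes V: "open (chart_image \<kappa>)" "z \<in> chart_image \<kappa>" and \<kappa>: "\<kappa> \<in> \<A>"
    and g: "\<And>i j. smooth_on (\<lambda>w. g \<kappa> w $ i $ j) (chart_image \<kappa>)" and pos: "hermitian_pos_def (g \<kappa> z)"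
    and f: "smooth_on (f \<circ> chart_inv \<kappa>) (chart_image \<kappa>)"
    and K1: "cm_norm \<A> g 1 f \<le> ennreal K1" "0 \<le> K1" and K2: "cm_norm \<A> g 2 f \<le> ennreal K2" "0 \<le> K2"
    and a: "unitary_frame (g \<kappa> z) a" and R: "\<And>i. norm (a i) \<le> R"
    and b: "0 \<le> b" "\<And>x u v. norm (dd x (\<lambda>w. herm_prod (g \<kappa> w) u v) z) \<le> b * norm x * norm u * norm v"
  shows "\<bar>Re (del (a i) (delbar (a i) (\<lambda>w. of_real ((f \<circ> chart_inv \<kappa>) w))) z)\<bar>
    \<le> K2 + 2 * real CARD('n) * (3 * b * R ^ 3 * K1)"
proof -
  define B where "B = real_frame a"
  define h where "h = riem g \<kappa>"
  define \<psi> where "\<psi> = f \<circ> chart_inv \<kappa>"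
  note dg = smooth_on_differentiable[OF g V(2)]
  note d\<psi> = smooth_on_differentiable[OF f[folded \<psi>_def]]
  have R0: "0 \<le> R" using R norm_ge_zero order_trans by blast
  have B: "orthonormal_frame (h z) B" unfolding B_def h_def by (rule orthonormal_real_frame[of g \<kappa> z, OF a])
  have finB: "finite B" using B by (simp add: orthonormal_frame_def)
  have normB: "norm x \<le> R" if "x \<in> B" for x
    using norm_real_frame_le[of a R x] R that by (simp add: B_def)
  have "cov_deriv h \<psi> [] = \<psi>" by (rule ext) simp
  then have cd1: "cov_deriv h \<psi> [u] x = dd u \<psi> x" for u x by (simp add: dd_def)
  have cd2: "cov_deriv h \<psi> [u, v] x = dd u (dd v \<psi>) x - dd (christoffel h x u v) \<psi> x" for u v x
  proof -
    have e1: "(\<lambda>x. cov_deriv h \<psi> [v] x) = dd v \<psi>" by (rule ext) (rule cd1)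
    have "(\<Sum>i<length [v]. cov_deriv h \<psi> ([v][i := christoffel h x u ([v] ! i)]) x)
        = cov_deriv h \<psi> [christoffel h x u v] x"
      by (simp del: cov_deriv.simps)
    then show ?thesis
      unfolding cov_deriv.simps(2)[of h \<psi> u "[v]"] e1 cd1 by (simp only: dd_def[of u])
  qed
  have b1: "\<bar>dd u \<psi> z\<bar> \<le> K1" if "u \<in> B" for u
    using cov_deriv_bound[OF K1 \<kappa> V(2) B[unfolded h_def], of "[u]"] that
    unfolding cd1[unfolded h_def \<psi>_def] \<psi>_def by simp
  have bh: "\<bar>dd x (\<lambda>w. h w u v) z\<bar> \<le> 2 * (b * R * R * R)" if "x \<in> B" "u \<in> B" "v \<in> B" for x u v
  proof -
    have "\<bar>dd x (\<lambda>w. h w u v) z\<bar> \<le> 2 * norm (dd x (\<lambda>w. herm_prod (g \<kappa> w) u v) z)"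
      unfolding h_def dd_riem[of g \<kappa>, OF dg] using abs_Re_le_cmod by (simp add: abs_mult)
    also have "\<dots> \<le> 2 * (b * norm x * norm u * norm v)" using b(2) by simp
    also have "\<dots> \<le> 2 * (b * R * R * R)"
      using normB that b(1) R0 by (intro mult_left_mono mult_mono) auto
    finally show ?thesis .
  qed
  have X: "\<bar>dd u (dd u \<psi>) z\<bar> \<le> K2 + 2 * real CARD('n) * (3 * b * R ^ 3 * K1)" if u: "u \<in> B" for u
  proof -
    define Q where "Q = (\<lambda>y. dd u (\<lambda>x. h x u y) z + dd u (\<lambda>x. h x u y) z - dd y (\<lambda>x. h x u u) z)"
    have dh: "dd x (\<lambda>w. h w p q) z = 2 * Re (herm_prod (\<chi> i j. dd x (\<lambda>w. g \<kappa> w $ i $ j) z) p q)" for x p q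
      unfolding h_def dd_riem[of g \<kappa>, OF dg] dd_herm_prod(1)[OF dg] ..
    have dfh: "(\<lambda>x. h x u u) differentiable at z"
    proof -
      have "bounded_linear (\<lambda>c. 2 * Re c)"
        by (rule bounded_linear_compose[OF bounded_linear_mult_right bounded_linear_Re])
      then show ?thesis
        unfolding h_def riem_def by (rule differentiable_bounded_linear[OF _ dd_herm_prod(2)[OF dg]])
    qed
    have "linear (\<lambda>y. dd u (\<lambda>x. h x u y) z)"
      unfolding dh by (auto intro!: linearI simp: herm_prod_add_right herm_prod_scaleR_right algebra_simps)
    then have Q: "linear Q"
      unfolding Q_def by (intro linear_compose_sub linear_compose_add linear_dd dfh)
    have chr: "christoffel h z u u = (\<Sum>b\<in>B. (Q b / 2) *\<^sub>R b)"
    proof (rule christoffel_orthonormal[where h = h and z = z, OF B _ _ Q])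
      show "linear (\<lambda>x. h z x y)" for y unfolding h_def by (rule linear_riem)
      show "h z x y = h z y x" for x y unfolding h_def by (rule riem_sym[of g \<kappa>, OF pos])
    qed (simp add: Q_def dd_def)
    have "dd (christoffel h z u u) \<psi> z = (\<Sum>b\<in>B. (Q b / 2) * dd b \<psi> z)"
      unfolding chr linear_sum[OF linear_dd[OF d\<psi>[OF V(2)]]] by (simp add: dd_scaleR_dir[OF d\<psi>[OF V(2)]])
    also have "\<bar>\<dots>\<bar> \<le> (\<Sum>x\<in>B. 3 * b * R ^ 3 * K1)"
    proof (rule order_trans[OF sum_abs], rule sum_mono)
      fix y assume y: "y \<in> B"
      have "\<bar>Q y\<bar> \<le> 6 * (b * R * R * R)"
        unfolding Q_def using bh[OF u u y] bh[OF y u u] by linarith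
      then have "\<bar>Q y / 2\<bar> \<le> 3 * b * R ^ 3" by (simp add: power3_eq_cube)
      then show "\<bar>Q y / 2 * dd y \<psi> z\<bar> \<le> 3 * b * R ^ 3 * K1"
        unfolding abs_mult using b1[OF y] b(1) R0 by (intro mult_mono) auto
    qed
    also have "\<dots> = real (card B) * (3 * b * R ^ 3 * K1)" by simp
    also have "\<dots> \<le> 2 * real CARD('n) * (3 * b * R ^ 3 * K1)"
    proof (rule mult_right_mono)
      show "real (card B) \<le> 2 * real CARD('n)" using card_real_frame[of a] unfolding B_def by linarith
      show "0 \<le> 3 * b * R ^ 3 * K1" using b(1) R0 K1(2) by simp
    qed
    finally have "\<bar>dd (christoffel h z u u) \<psi> z\<bar> \<le> 2 * real CARD('n) * (3 * b * R ^ 3 * K1)" .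
    moreover have "\<bar>dd u (dd u \<psi>) z - dd (christoffel h z u u) \<psi> z\<bar> \<le> K2"
      using cov_deriv_bound[OF K2 \<kappa> V(2) B[unfolded h_def], of "[u, u]"] u
      unfolding cd2[unfolded h_def \<psi>_def] \<psi>_def h_def by simp
    ultimately show ?thesis by linarith
  qed
  \<comment> \<open>This undoes the factor \<open>1 / sqrt 2\<close> of the real frame. The factor 2
    and the two real directions cancel the 1/4 in \<open>Re_del_delbar\<close>.\<close>
  have double: "dd (sqrt 2 *\<^sub>R u) (dd (sqrt 2 *\<^sub>R u) \<psi>) z = 2 * dd u (dd u \<psi>) z" for u
  proof -
    have "dd (sqrt 2 *\<^sub>R u) (dd (sqrt 2 *\<^sub>R u) \<psi>) z = dd (sqrt 2 *\<^sub>R u) (\<lambda>x. sqrt 2 * dd u \<psi> x) z"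
      by (rule dd_cong_open[OF V]) (simp add: dd_scaleR_dir[OF d\<psi>])
    also have "\<dots> = sqrt 2 * dd (sqrt 2 *\<^sub>R u) (dd u \<psi>) z"
      by (rule dd_bounded_linear[OF bounded_linear_mult_right
            smooth_on_differentiable[OF smooth_on_dd[OF f[folded \<psi>_def]] V(2)]])
    also have "dd (sqrt 2 *\<^sub>R u) (dd u \<psi>) z = sqrt 2 * dd u (dd u \<psi>) z"
      by (simp add: dd_scaleR_dir[OF smooth_on_differentiable[OF smooth_on_dd[OF f[folded \<psi>_def]] V(2)]])
    finally show ?thesis by simp
  qed
  have u1: "(1 / sqrt 2) *\<^sub>R (s *s a i) \<in> B" if "s = 1 \<or> s = \<i>" for s
    unfolding B_def real_frame_def using that by force
  have "\<bar>dd (s *s a i) (dd (s *s a i) \<psi>) z\<bar> \<le> 2 * (K2 + 2 * real CARD('n) * (3 * b * R ^ 3 * K1))"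
    if "s = 1 \<or> s = \<i>" for s
    using double[of "(1 / sqrt 2) *\<^sub>R (s *s a i)"] X[OF u1[OF that]] by (simp add: abs_mult)
  from this[of 1] this[of \<i>] show ?thesis
    unfolding \<psi>_def[symmetric]
    using Re_del_delbar[OF V d\<psi> smooth_on_differentiable[OF smooth_on_dd[OF f[folded \<psi>_def]] V(2)], of "a i"]
    by simp
qed

text \<open>The quantifiers over \<open>a\<close> and \<open>F\<close> are inside, so
  \<open>c\<close> is fixed before F is given and before the frame that diagonalises g' is
  known.\<close>

definition frame_bounds ::
    "('a, 'n::finite) chart set \<Rightarrow> ('a, 'n) metric \<Rightarrow> (nat \<Rightarrow> real) \<Rightarrow> ('a, 'n) chart \<Rightarrow> complex^'n \<Rightarrow> real \<Rightarrow> bool" where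
  "frame_bounds \<A> g K \<kappa> z c \<longleftrightarrow> (\<forall>a. unitary_frame (g \<kappa> z) a \<longrightarrow>
     (\<forall>i j k. norm (del (a k) (\<lambda>w. herm_prod (g \<kappa> w) (a i) (a j)) z) \<le> c) \<and>
     (\<forall>i k. norm (del (a k) (delbar (a k) (\<lambda>w. herm_prod (g \<kappa> w) (a i) (a i))) z) \<le> c) \<and>
     (\<forall>F i. smooth_function \<A> F \<and> (\<forall>m. cm_norm \<A> g m F \<le> ennreal (K m)) \<longrightarrow>
       \<bar>Re (del (a i) (delbar (a i) (\<lambda>w. of_real ((F \<circ> chart_inv \<kappa>) w))) z)\<bar> \<le> c))"

lemma frame_bounds_mono: "frame_bounds \<A> g K \<kappa> z c \<Longrightarrow> c \<le> d \<Longrightarrow> frame_bounds \<A> g K \<kappa> z d"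
  unfolding frame_bounds_def by (meson order_trans)

lemma smooth_on_entry:
  fixes G :: "complex^'n::finite \<Rightarrow> complex^'n^'n"
  assumes "open S" "smooth_on G S"
  shows "smooth_on (\<lambda>w. G w $ i $ j) S"
  by (rule smooth_on_bounded_linear[OF assms(1) _ assms(2)])
    (rule bounded_linear_compose[OF bounded_linear_vec_nth bounded_linear_vec_nth])

lemma frame_bounds_local:
  fixes g :: "('a, 'n::finite) metric"
  assumes M: "complex_manifold X \<A>" and g: "hermitian_metric \<A> g" and K: "\<And>m. K m > 0"
    and \<kappa>: "\<kappa> \<in> \<A>" and p: "p \<in> fst \<kappa>"
  shows "\<exists>N c. openin X N \<and> p \<in> N \<and> N \<subseteq> fst \<kappa> \<and> (\<forall>q\<in>N. frame_bounds \<A> g K \<kappa> (snd \<kappa> q) c)"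
proof -
  note ck = chart_facts[OF M \<kappa>]
  let ?V = "chart_image \<kappa>"
  obtain r where r: "r > 0" "cball (snd \<kappa> p) r \<subseteq> ?V"
    using open_contains_cball ck(2) ck(5)[OF p] by blast
  define L where "L = cball (snd \<kappa> p) r"
  have L: "compact L" "L \<subseteq> ?V" using r by (auto simp: L_def)
  have smg: "smooth_on (\<lambda>w. g \<kappa> w $ i $ j) ?V" for i j
    using g \<kappa> by (intro smooth_on_entry ck(2)) (auto simp: hermitian_metric_def)
  have pos: "hermitian_pos_def (g \<kappa> w)" if "w \<in> ?V" for w
    using g \<kappa> that by (auto simp: hermitian_metric_def)
  have posL: "\<And>w. w \<in> L \<Longrightarrow> hermitian_pos_def (g \<kappa> w)" using L(2) pos by blast
  obtain R where R: "R > 0" "\<forall>z\<in>L. \<forall>a. unitary_frame (g \<kappa> z) a \<longrightarrow> (\<forall>i. norm (a i) \<le> R)"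
    using unitary_frame_bound_compact[OF L(1) continuous_on_subset[OF smooth_on_continuous[OF smg] L(2)] posL]
    by blast
  obtain b where b: "0 \<le> b" "\<forall>z\<in>L. \<forall>x y u v. norm (dd x (\<lambda>w. herm_prod (g \<kappa> w) u v) z) \<le> b * norm x * norm u * norm v \<and>
    norm (dd x (dd y (\<lambda>w. herm_prod (g \<kappa> w) u v)) z) \<le> b * norm x * norm y * norm u * norm v"
    using herm_prod_dd_bound_compact[OF ck(2) L(2,1) smg] by blast
  \<comment> \<open>One summand for each of the three parts of \<open>frame_bounds\<close>. The
    powers of \<open>R\<close> count the vectors involved: two slots of the metric and one or two
    directions of differentiation.\<close>
  define c where "c = b * R ^ 3 + b * R ^ 4 + (K 2 + 2 * real CARD('n) * (3 * b * R ^ 3 * K 1))"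
  have c: "b * R ^ 3 \<le> c" "b * R ^ 4 \<le> c" "K 2 + 2 * real CARD('n) * (3 * b * R ^ 3 * K 1) \<le> c"
    using b(1) R(1) K[of 1] K[of 2] by (simp_all add: c_def add_nonneg_nonneg)
  have "frame_bounds \<A> g K \<kappa> z c" if z: "z \<in> L" for z
    unfolding frame_bounds_def
  proof (intro allI impI conjI)
    fix a assume a: "unitary_frame (g \<kappa> z) a"
    have aR: "norm (a i) \<le> R" for i using R(2) z a by blast
    have zV: "z \<in> ?V" using L(2) z by blast
    have smh: "smooth_on (\<lambda>w. herm_prod (g \<kappa> w) u v) ?V" for u v by (rule smooth_on_herm_prod[OF ck(2) smg])
    have d1: "norm (dd x (\<lambda>w. herm_prod (g \<kappa> w) u v) z) \<le> b * R ^ 3" if "norm x \<le> R" "norm u \<le> R" "norm v \<le> R" for x u v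
    proof -
      have "norm (dd x (\<lambda>w. herm_prod (g \<kappa> w) u v) z) \<le> b * norm x * norm u * norm v" using b(2) z by blast
      also have "\<dots> \<le> b * R * R * R" using that b(1) R(1) by (intro mult_mono) auto
      finally show ?thesis by (simp add: power3_eq_cube mult.assoc)
    qed
    have d2: "norm (dd x (dd y (\<lambda>w. herm_prod (g \<kappa> w) u v)) z) \<le> b * R ^ 4"
      if "norm x \<le> R" "norm y \<le> R" "norm u \<le> R" "norm v \<le> R" for x y u v
    proof -
      have "norm (dd x (dd y (\<lambda>w. herm_prod (g \<kappa> w) u v)) z) \<le> b * norm x * norm y * norm u * norm v" using b(2) z by blast
      also have "\<dots> \<le> b * R * R * R * R" using that b(1) R(1) by (intro mult_mono) auto
      finally show ?thesis by (simp add: power4_eq_xxxx mult.assoc)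
    qed
    show "norm (del (a k) (\<lambda>w. herm_prod (g \<kappa> w) (a i) (a j)) z) \<le> c" for i j k
      by (rule norm_del_le; rule order_trans[OF d1 c(1)]) (simp_all add: aR)
    show "norm (del (a k) (delbar (a k) (\<lambda>w. herm_prod (g \<kappa> w) (a i) (a i))) z) \<le> c" for i k
    proof (rule norm_del_delbar_le[OF ck(2) zV smh])
      fix x y assume "x \<in> {a k, \<i> *s a k}" "y \<in> {a k, \<i> *s a k}"
      then have "norm x \<le> R" "norm y \<le> R" using aR[of k] by auto
      then show "norm (dd x (dd y (\<lambda>w. herm_prod (g \<kappa> w) (a i) (a i))) z) \<le> c"
        by (intro order_trans[OF d2 c(2)] aR)
    qed
    fix F i assume F: "smooth_function \<A> F \<and> (\<forall>m. cm_norm \<A> g m F \<le> ennreal (K m))"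
    have "\<bar>Re (del (a i) (delbar (a i) (\<lambda>w. of_real ((F \<circ> chart_inv \<kappa>) w))) z)\<bar>
        \<le> K 2 + 2 * real CARD('n) * (3 * b * R ^ 3 * K 1)"
    proof (rule second_derivative_bound[where g = g and \<kappa> = \<kappa> and \<A> = \<A> and f = F and a = a and b = b and R = R, OF ck(2) zV \<kappa> smg pos[OF zV] _ _ _ _ _ a aR b(1)])
      show "smooth_on (F \<circ> chart_inv \<kappa>) ?V" using F \<kappa> by (auto simp: smooth_function_def)
      show "norm (dd x (\<lambda>w. herm_prod (g \<kappa> w) u v) z) \<le> b * norm x * norm u * norm v" for x u v
        using b(2) z by blast
    qed (use F K in \<open>auto simp: less_imp_le\<close>)
    then show "\<bar>Re (del (a i) (delbar (a i) (\<lambda>w. of_real ((F \<circ> chart_inv \<kappa>) w))) z)\<bar> \<le> c"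
      using c(3) by linarith
  qed
  then have "\<forall>q\<in>{q \<in> fst \<kappa>. snd \<kappa> q \<in> ball (snd \<kappa> p) r}. frame_bounds \<A> g K \<kappa> (snd \<kappa> q) c"
    by (auto simp: L_def)
  moreover have "openin X {q \<in> fst \<kappa>. snd \<kappa> q \<in> ball (snd \<kappa> p) r}" by (rule ck(9)) simp
  moreover have "p \<in> {q \<in> fst \<kappa>. snd \<kappa> q \<in> ball (snd \<kappa> p) r}" using p r(1) by simp
  ultimately show ?thesis by blast
qed

text \<open>The bounds depend on the chart, so each neighbourhood of the cover keeps the chart in
  which its bounds hold; after passing to a finite subcover only finitely many constants
  remain.\<close>

lemma frame_bounds_global:
  fixes g :: "('a, 'n::finite) metric"
  assumes M: "complex_manifold X \<A>" and X: "compact_space X" and g: "hermitian_metric \<A> g" and K: "\<And>m. K m > 0"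
  shows "\<exists>c\<ge>1. \<forall>q\<in>topspace X. \<exists>\<kappa>\<in>\<A>. q \<in> fst \<kappa> \<and> frame_bounds \<A> g K \<kappa> (snd \<kappa> q) c"
proof -
  have "\<exists>N. openin X N \<and> p \<in> N \<and> (\<exists>c. \<exists>\<kappa>\<in>\<A>. N \<subseteq> fst \<kappa> \<and> (\<forall>q\<in>N. frame_bounds \<A> g K \<kappa> (snd \<kappa> q) c))"
    if p: "p \<in> topspace X" for p
  proof -
    have "\<Union> (fst ` \<A>) = topspace X" using M by (simp add: complex_manifold_def)
    then have "p \<in> \<Union> (fst ` \<A>)" using p by simp
    then obtain \<kappa> where \<kappa>: "\<kappa> \<in> \<A>" "p \<in> fst \<kappa>" by blast
    show ?thesis using frame_bounds_local[where K = K, OF M g K \<kappa>] \<kappa>(1) by blast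
  qed
  then have "\<forall>p\<in>topspace X. \<exists>N. openin X N \<and> p \<in> N \<and> (\<exists>c. \<exists>\<kappa>\<in>\<A>. N \<subseteq> fst \<kappa> \<and> (\<forall>q\<in>N. frame_bounds \<A> g K \<kappa> (snd \<kappa> q) c))"
    by blast
  then obtain N where N: "\<forall>p\<in>topspace X. openin X (N p) \<and> p \<in> N p \<and>
      (\<exists>c. \<exists>\<kappa>\<in>\<A>. N p \<subseteq> fst \<kappa> \<and> (\<forall>q\<in>N p. frame_bounds \<A> g K \<kappa> (snd \<kappa> q) c))"
    by (rule bchoice[THEN exE])
  then have "\<forall>p\<in>topspace X. \<exists>c. \<exists>\<kappa>\<in>\<A>. N p \<subseteq> fst \<kappa> \<and> (\<forall>q\<in>N p. frame_bounds \<A> g K \<kappa> (snd \<kappa> q) c)" by blast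
  then obtain c where c: "\<forall>p\<in>topspace X. \<exists>\<kappa>\<in>\<A>. N p \<subseteq> fst \<kappa> \<and> (\<forall>q\<in>N p. frame_bounds \<A> g K \<kappa> (snd \<kappa> q) (c p))"
    by (rule bchoice[THEN exE])
  have cover: "topspace X \<subseteq> \<Union> (N ` topspace X)" using N by blast
  have "\<forall>U\<in>N ` topspace X. openin X U" using N by blast
  with X cover obtain \<F> where F: "finite \<F>" "\<F> \<subseteq> N ` topspace X" "topspace X \<subseteq> \<Union> \<F>"
    unfolding compact_space_alt by meson
  then obtain P where P: "P \<subseteq> topspace X" "finite P" "\<F> = N ` P" by (meson finite_subset_image)
  \<comment> \<open>The summand 1 gives \<open>1 \<le> d\<close>, from which
    \<open>2 \<le> A\<close> follows in the theorem.\<close>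
  define d where "d = 1 + (\<Sum>p\<in>P. \<bar>c p\<bar>)"
  have "\<exists>\<kappa>\<in>\<A>. q \<in> fst \<kappa> \<and> frame_bounds \<A> g K \<kappa> (snd \<kappa> q) d" if q: "q \<in> topspace X" for q
  proof -
    obtain p where p: "p \<in> P" "q \<in> N p" using F(3) q P(3) by auto
    then obtain \<kappa> where \<kappa>: "\<kappa> \<in> \<A>" "N p \<subseteq> fst \<kappa>" "frame_bounds \<A> g K \<kappa> (snd \<kappa> q) (c p)"
      using c P(1) by blast
    have "\<bar>c p\<bar> \<le> (\<Sum>p\<in>P. \<bar>c p\<bar>)" using p(1) P(2) by (intro member_le_sum) auto
    then have "c p \<le> d" by (simp add: d_def)
    then show ?thesis using \<kappa> p(2) frame_bounds_mono by blast
  qed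
  moreover have "1 \<le> d" by (simp add: d_def sum_nonneg)
  ultimately show ?thesis by blast
qed

section \<open>Functions on the manifold described in charts\<close>

lemma continuous_map_of_charts:
  fixes f :: "'a \<Rightarrow> real" and \<A> :: "('a, 'n::finite) chart set"
  assumes M: "complex_manifold X \<A>"
    and cont: "\<And>\<kappa>. \<kappa> \<in> \<A> \<Longrightarrow> continuous_on (chart_image \<kappa>) (\<lambda>z. f (chart_inv \<kappa> z))"
  shows "continuous_map X euclideanreal f"
  unfolding continuous_map_def
proof (intro conjI allI impI)
  fix V :: "real set" assume "openin euclideanreal V"
  then have V: "open V" by simp
  have "openin X {q \<in> fst \<kappa>. f q \<in> V}" if \<kappa>: "\<kappa> \<in> \<A>" for \<kappa>
  proof -
    note ck = chart_facts[OF M \<kappa>]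
    have "open {z \<in> chart_image \<kappa>. f (chart_inv \<kappa> z) \<in> V}"
      using continuous_open_preimage[OF cont[OF \<kappa>] ck(2) V] by (simp add: vimage_def Int_def)
    then have "openin X {q \<in> fst \<kappa>. snd \<kappa> q \<in> {z \<in> chart_image \<kappa>. f (chart_inv \<kappa> z) \<in> V}}" by (rule ck(9))
    moreover have "{q \<in> fst \<kappa>. snd \<kappa> q \<in> {z \<in> chart_image \<kappa>. f (chart_inv \<kappa> z) \<in> V}} = {q \<in> fst \<kappa>. f q \<in> V}"
      using ck(4,5) by auto
    ultimately show ?thesis by simp
  qed
  then have "openin X (\<Union>\<kappa>\<in>\<A>. {q \<in> fst \<kappa>. f q \<in> V})" by blast
  moreover have "\<Union> (fst ` \<A>) = topspace X" using M by (simp add: complex_manifold_def)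
  then have "(\<Union>\<kappa>\<in>\<A>. {q \<in> fst \<kappa>. f q \<in> V}) = {q \<in> topspace X. f q \<in> V}" by auto
  ultimately show "openin X {q \<in> topspace X. f q \<in> V}" by simp
qed simp

lemma compact_image_of_charts:
  fixes f :: "'a \<Rightarrow> real" and \<A> :: "('a, 'n::finite) chart set"
  assumes M: "complex_manifold X \<A>" and X: "compact_space X"
    and cont: "\<And>\<kappa>. \<kappa> \<in> \<A> \<Longrightarrow> continuous_on (chart_image \<kappa>) (\<lambda>z. f (chart_inv \<kappa> z))"
  shows "compact (f ` topspace X)"
  using image_compactin[OF _ continuous_map_of_charts[OF M cont], of "topspace X"] X
  by (simp add: compact_space_def)

lemma continuous_on_herm_trace:
  fixes G H :: "complex^'n::finite \<Rightarrow> complex^'n^'n"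
  assumes S: "open S" and G: "\<And>i j. smooth_on (\<lambda>w. G w $ i $ j) S" and H: "\<And>i j. smooth_on (\<lambda>w. H w $ i $ j) S"
    and nz: "\<And>w. w \<in> S \<Longrightarrow> det (G w) \<noteq> 0"
  shows "continuous_on S (\<lambda>w. herm_trace (G w) (H w))"
proof -
  have "continuous_on S (\<lambda>w. matrix_inv (G w) $ k $ l)" for k l
  proof (rule continuous_at_imp_continuous_on, rule ballI)
    fix w assume w: "w \<in> S"
    show "isCont (\<lambda>w. matrix_inv (G w) $ k $ l) w"
      by (rule differentiable_imp_continuous_within[OF differentiable_matrix_inv[OF S w smooth_on_differentiable[OF G w] nz]])
  qed
  then show ?thesis
    unfolding herm_trace_def
    by (intro continuous_on_Re continuous_on_sum continuous_on_mult smooth_on_continuous[OF H])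
qed

theorem theorem2p1:
  fixes X :: "'a topology"
    and \<A> :: "('a, 'n::finite) chart set"
    and g :: "('a, 'n) metric"
    and K :: "nat \<Rightarrow> real"
  assumes "CARD('n) \<ge> 2"
    and "complex_manifold X \<A>"
    and "compact_space X"
    and "hermitian_metric \<A> g"
    and "CARD('n) = 2 \<or> (CARD('n) > 2 \<and> balanced \<A> g)"
    and "\<And>m. K m > 0"
  shows "\<exists>C A :: real. \<forall>F \<phi> :: 'a \<Rightarrow> real.
    smooth_function \<A> F \<and> (\<forall>m. cm_norm \<A> g m F \<le> ennreal (K m)) \<and>
    smooth_function \<A> \<phi> \<and>
    monge_ampere \<A> g F \<phi> \<and>
    (\<forall>\<kappa>\<in>\<A>. \<forall>z\<in>chart_image \<kappa>. hermitian_pos_def (perturbed_metric g \<phi> \<kappa> z)) \<and>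
    (SUP p\<in>topspace X. \<phi> p) = 0 \<longrightarrow>
    (\<forall>p\<in>topspace X. \<forall>\<kappa>\<in>\<A>. p \<in> fst \<kappa> \<longrightarrow>
      herm_trace (g \<kappa> (snd \<kappa> p)) (perturbed_metric g \<phi> \<kappa> (snd \<kappa> p))
        \<le> C * exp (A * (\<phi> p - (INF q\<in>topspace X. \<phi> q))))"
proof -
  note M = assms(2) and X = assms(3) and g = assms(4) and K = assms(6)
  obtain c where c: "c \<ge> 1" "\<forall>q\<in>topspace X. \<exists>\<kappa>\<in>\<A>. q \<in> fst \<kappa> \<and> frame_bounds \<A> g K \<kappa> (snd \<kappa> q) c"
    using frame_bounds_global[where K = K, OF M X g K] by blast
  define n where "n = real CARD('n)"
  \<comment> \<open>\<open>C1\<close>, \<open>C2\<close> and \<open>A\<close> are the constants of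
    \<open>trace_bound_at_max\<close>. \<open>U0\<close> is its bound with F replaced by its upper
    bound \<open>K 0\<close>. In \<open>C\<close> the factor \<open>exp 1\<close> pays for the
    bounded summand of the auxiliary function, and \<open>U0 + A + 2\<close> dominates 1,
    \<open>A + 1\<close> and \<open>U0\<close>, the bounds of the three cases at the
    maximum.\<close>
  define C1 where "C1 = 5 * c\<^sup>2 * n\<^sup>2 + n * (c + n * c + n\<^sup>2 * c\<^sup>2) + 2 * c * n + c"
  define C2 where "C2 = 2 * c * n"
  define A where "A = C1 + C2\<^sup>2 + 1"
  define U0 where "U0 = n * (exp (K 0) * ((A + 1) * n) ^ (CARD('n) - 1))"
  define C where "C = exp 1 * (U0 + A + 2)"
  have n0: "0 \<le> n" by (simp add: n_def)
  have "c \<le> C1" unfolding C1_def using c(1) n0 by (simp add: add_nonneg_nonneg)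
  then have A2: "2 \<le> A" unfolding A_def using c(1) zero_le_power2[of C2] by linarith
  have U00: "0 \<le> U0" unfolding U0_def using n0 A2 by simp
  have C0: "0 < C" unfolding C_def using U00 A2 by (simp add: add_pos_nonneg)
  show ?thesis
  proof (rule exI[of _ C], rule exI[of _ A], intro allI impI ballI)
    fix F \<phi> :: "'a \<Rightarrow> real" and p and \<mu> :: "('a, 'n) chart"
    assume H: "smooth_function \<A> F \<and> (\<forall>m. cm_norm \<A> g m F \<le> ennreal (K m)) \<and>
      smooth_function \<A> \<phi> \<and> monge_ampere \<A> g F \<phi> \<and>
      (\<forall>\<kappa>\<in>\<A>. \<forall>z\<in>chart_image \<kappa>. hermitian_pos_def (perturbed_metric g \<phi> \<kappa> z)) \<and>
      (SUP p\<in>topspace X. \<phi> p) = 0"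
      and p: "p \<in> topspace X" and \<mu>: "\<mu> \<in> \<A>" "p \<in> fst \<mu>"
    have F: "smooth_function \<A> F" "\<And>m. cm_norm \<A> g m F \<le> ennreal (K m)" and \<phi>: "smooth_function \<A> \<phi>"
      and MA: "monge_ampere \<A> g F \<phi>"
      and posH: "\<And>\<kappa> z. \<kappa> \<in> \<A> \<Longrightarrow> z \<in> chart_image \<kappa> \<Longrightarrow> hermitian_pos_def (perturbed_metric g \<phi> \<kappa> z)"
      using H by blast+
    have posG: "hermitian_pos_def (g \<kappa> z)" if "\<kappa> \<in> \<A>" "z \<in> chart_image \<kappa>" for \<kappa> z
      using g that by (auto simp: hermitian_metric_def)
    have smG: "smooth_on (\<lambda>w. g \<kappa> w $ i $ j) (chart_image \<kappa>)" if "\<kappa> \<in> \<A>" for \<kappa> i j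
      using g that chart_facts(2)[OF M that] by (intro smooth_on_entry) (auto simp: hermitian_metric_def)
    have sm\<phi>: "smooth_on (\<phi> \<circ> chart_inv \<kappa>) (chart_image \<kappa>)"
      and smF: "smooth_on (F \<circ> chart_inv \<kappa>) (chart_image \<kappa>)" if "\<kappa> \<in> \<A>" for \<kappa>
      using \<phi> F(1) that by (auto simp: smooth_function_def)
    define m where "m = (INF q\<in>topspace X. \<phi> q)"
    have cont\<phi>: "continuous_on (chart_image \<kappa>) (\<lambda>z. \<phi> (chart_inv \<kappa> z))" if "\<kappa> \<in> \<A>" for \<kappa>
      using smooth_on_continuous[OF sm\<phi>[OF that]] by (simp add: o_def)
    have m: "m \<le> \<phi> q" if "q \<in> topspace X" for q
      unfolding m_def
      using compact_imp_bounded[OF compact_image_of_charts[OF M X cont\<phi>]] that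
      by (intro cINF_lower bounded_imp_bdd_below)
    define tr where "tr = (\<lambda>\<kappa> z. herm_trace (g \<kappa> z) (perturbed_metric g \<phi> \<kappa> z))"
    \<comment> \<open>The trace as a function on \<open>X\<close>, computed in an arbitrarily chosen
      chart; by \<open>herm_trace_transition\<close> the choice does not matter.\<close>
    define u where "u = (\<lambda>q. tr (SOME \<kappa>. \<kappa> \<in> \<A> \<and> q \<in> fst \<kappa>) (snd (SOME \<kappa>. \<kappa> \<in> \<A> \<and> q \<in> fst \<kappa>) q))"
    have u: "u q = tr \<kappa> (snd \<kappa> q)" if "\<kappa> \<in> \<A>" "q \<in> fst \<kappa>" for \<kappa> q
    proof -
      define \<kappa>' where "\<kappa>' = (SOME \<kappa>. \<kappa> \<in> \<A> \<and> q \<in> fst \<kappa>)"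
      have "\<kappa>' \<in> \<A> \<and> q \<in> fst \<kappa>'" unfolding \<kappa>'_def by (rule someI[of _ \<kappa>]) (use that in simp)
      then show ?thesis
        unfolding u_def \<kappa>'_def[symmetric] tr_def using herm_trace_transition[OF M g \<phi>] that by blast
    qed
    define E where "E = (\<lambda>q. exp (- A * \<phi> q + 1 / (\<phi> q - m + 1)))"
    have cont: "continuous_on (chart_image \<kappa>) (\<lambda>z. u (chart_inv \<kappa> z) * E (chart_inv \<kappa> z))" if \<kappa>: "\<kappa> \<in> \<A>" for \<kappa>
    proof -
      note ck = chart_facts[OF M \<kappa>]
      have smH: "smooth_on (\<lambda>w. perturbed_metric g \<phi> \<kappa> w $ i $ j) (chart_image \<kappa>)" for i j
        unfolding perturbed_metric_def complex_hessian_def vector_add_component vec_lambda_beta wirt_eq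
          wirtbar_eq[abs_def]
        by (intro smooth_on_add smG[OF \<kappa>] smooth_on_wd smooth_on_of_real sm\<phi>[OF \<kappa>] ck(2))
      have "continuous_on (chart_image \<kappa>) (\<lambda>z. tr \<kappa> z)"
        unfolding tr_def by (rule continuous_on_herm_trace[OF ck(2) smG[OF \<kappa>] smH])
          (rule hermitian_pos_def_det_nz[OF posG[OF \<kappa>]])
      moreover have "tr \<kappa> z = u (chart_inv \<kappa> z)" if "z \<in> chart_image \<kappa>" for z
        using u[OF \<kappa> ck(7)[OF that]] ck(6)[OF that] by simp
      ultimately have 1: "continuous_on (chart_image \<kappa>) (\<lambda>z. u (chart_inv \<kappa> z))"
        by (rule continuous_on_eq)
      have "\<phi> (chart_inv \<kappa> z) - m + 1 \<noteq> 0" if "z \<in> chart_image \<kappa>" for z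
        using m[of "chart_inv \<kappa> z"] ck(7)[OF that] ck(3) by auto
      then have "continuous_on (chart_image \<kappa>) (\<lambda>z. E (chart_inv \<kappa> z))"
        unfolding E_def by (intro continuous_intros cont\<phi>[OF \<kappa>]) auto
      with 1 show ?thesis by (rule continuous_on_mult)
    qed
    have "(\<lambda>q. u q * E q) ` topspace X \<noteq> {}" using p by blast
    from compact_attains_sup[OF compact_image_of_charts[OF M X cont] this]
    obtain p0 where p0: "p0 \<in> topspace X" "\<And>q. q \<in> topspace X \<Longrightarrow> u q * E q \<le> u p0 * E p0"
      by blast
    \<comment> \<open>At the maximum the chart that carries the uniform bounds is used; the claim
      itself concerns another point and another chart.\<close>
    obtain \<kappa> where \<kappa>: "\<kappa> \<in> \<A>" "p0 \<in> fst \<kappa>" "frame_bounds \<A> g K \<kappa> (snd \<kappa> p0) c"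
      using c(2) p0(1) by blast
    note ck = chart_facts[OF M \<kappa>(1)]
    define z where "z = snd \<kappa> p0"
    have z: "z \<in> chart_image \<kappa>" unfolding z_def by (rule ck(5)[OF \<kappa>(2)])
    have invz: "chart_inv \<kappa> z = p0" unfolding z_def by (rule ck(4)[OF \<kappa>(2)])
    have "perturbed_metric g \<phi> \<kappa> z $ i $ j = cnj (perturbed_metric g \<phi> \<kappa> z $ j $ i)" for i j
      using posH[OF \<kappa>(1) z] unfolding hermitian_pos_def_def by blast
    from simultaneous_diagonalization[OF posG[OF \<kappa>(1) z] this]
    obtain a lam where a: "unitary_frame (g \<kappa> z) a"
      and lam: "\<forall>i j. herm_prod (perturbed_metric g \<phi> \<kappa> z) (a i) (a j) = (if i = j then of_real (lam i) else 0)"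
      by (elim exE conjE) (rule that)
    interpret metric_pair "chart_image \<kappa>" z "g \<kappa>" "\<phi> \<circ> chart_inv \<kappa>" a lam
      by unfold_locales
        (use ck(2) z smG[OF \<kappa>(1)] sm\<phi>[OF \<kappa>(1)] posG[OF \<kappa>(1)] posH[OF \<kappa>(1)] a lam in \<open>auto simp: perturbed_metric_def\<close>)
    define U where "U = tr \<kappa> z"
    have Up0: "u p0 = U" unfolding U_def z_def by (rule u[OF \<kappa>(1,2)])
    have upper: "U \<le> U0" if "1 \<le> U" "(A + 1)\<^sup>2 * (\<phi> p0 - m + 1) ^ 3 \<le> U\<^sup>2"
    proof -
      have "U \<le> n * (exp ((F \<circ> chart_inv \<kappa>) z) * ((A + 1) * n) ^ (CARD('n) - 1))"
      proof (rule trace_bound_at_max[OF smF[OF \<kappa>(1)] _ _ _ _ n_def C1_def C2_def A_def])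
        fix w assume w: "w \<in> chart_image \<kappa>"
        show "det (g \<kappa> w + complex_hessian (\<phi> \<circ> chart_inv \<kappa>) w) = of_real (exp ((F \<circ> chart_inv \<kappa>) w)) * det (g \<kappa> w)"
        proof (rule det_eq_of_wedge_power_eq[OF posG[OF \<kappa>(1) w]])
          show "hermitian_pos_def (g \<kappa> w + complex_hessian (\<phi> \<circ> chart_inv \<kappa>) w)"
            using posH[OF \<kappa>(1) w] by (simp add: perturbed_metric_def)
          show "wedge_power CARD('n) (form11 (g \<kappa> w + complex_hessian (\<phi> \<circ> chart_inv \<kappa>) w)) v
            = of_real (exp ((F \<circ> chart_inv \<kappa>) w)) * wedge_power CARD('n) (form11 (g \<kappa> w)) v" for v
            using MA \<kappa>(1) w by (simp add: monge_ampere_def fundamental_form_def perturbed_metric_def)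
        qed
        have top: "chart_inv \<kappa> w \<in> topspace X" using ck(3) ck(7)[OF w] by blast
        then show "m \<le> (\<phi> \<circ> chart_inv \<kappa>) w" using m by simp
        have "u (chart_inv \<kappa> w) = herm_trace (g \<kappa> w) (g \<kappa> w + complex_hessian (\<phi> \<circ> chart_inv \<kappa>) w)"
          using u[OF \<kappa>(1) ck(7)[OF w]] ck(6)[OF w] by (simp add: tr_def perturbed_metric_def)
        moreover have "u p0 = herm_trace (g \<kappa> z) (g \<kappa> z + complex_hessian (\<phi> \<circ> chart_inv \<kappa>) z)"
          unfolding Up0 U_def by (simp add: tr_def perturbed_metric_def)
        ultimately show "herm_trace (g \<kappa> w) (g \<kappa> w + complex_hessian (\<phi> \<circ> chart_inv \<kappa>) w)
            * exp (- A * (\<phi> \<circ> chart_inv \<kappa>) w + 1 / ((\<phi> \<circ> chart_inv \<kappa>) w - m + 1))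
          \<le> herm_trace (g \<kappa> z) (g \<kappa> z + complex_hessian (\<phi> \<circ> chart_inv \<kappa>) z)
            * exp (- A * (\<phi> \<circ> chart_inv \<kappa>) z + 1 / ((\<phi> \<circ> chart_inv \<kappa>) z - m + 1))"
          using p0(2)[OF top] by (simp add: E_def invz)
      next
        show "U = herm_trace (g \<kappa> z) (g \<kappa> z + complex_hessian (\<phi> \<circ> chart_inv \<kappa>) z)"
          unfolding U_def by (simp add: tr_def perturbed_metric_def)
      qed (use \<kappa>(3) a F that in \<open>auto simp: frame_bounds_def z_def[symmetric] invz\<close>)
      also have "\<dots> \<le> U0"
      proof -
        have "\<bar>cov_deriv (riem g \<kappa>) (F \<circ> chart_inv \<kappa>) [] z\<bar> \<le> K 0"
          by (rule cov_deriv_bound[OF F(2) less_imp_le[OF K] \<kappa>(1) z orthonormal_real_frame[of g \<kappa> z, OF a]]) simp_all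
        then have "exp ((F \<circ> chart_inv \<kappa>) z) \<le> exp (K 0)" by simp
        then show ?thesis unfolding U0_def using n0 A2 by (intro mult_left_mono mult_right_mono) auto
      qed
      finally show ?thesis .
    qed
    define x where "x = \<phi> p0 - m"
    have x: "0 \<le> x" using m[OF p0(1)] by (simp add: x_def)
    have U_le: "U \<le> (U0 + A + 2) * exp (A * x)"
    proof -
      have e1: "1 \<le> exp (A * x)" using x A2 by simp
      \<comment> \<open>The first two cases are those in which the hypotheses of
        \<open>upper\<close> fail, and they bound \<open>U\<close> directly.\<close>
      consider "U < 1" | "U\<^sup>2 < (A + 1)\<^sup>2 * (x + 1) ^ 3" | "U \<le> U0"
        using upper by (force simp: x_def)
      then show ?thesis
      proof cases
        case 1
        have "U \<le> (U0 + A + 2) * 1" using 1 U00 A2 by simp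
        also have "\<dots> \<le> (U0 + A + 2) * exp (A * x)" using e1 U00 A2 by (intro mult_left_mono) auto
        finally show ?thesis .
      next
        case 2
        \<comment> \<open>The cube grows at most like \<open>exp (3 * x)\<close>, and
          \<open>3 \<le> 2 * A\<close> fits this under the square of
          \<open>exp (A * x)\<close>.\<close>
        have "x + 1 \<le> exp x" using exp_ge_add_one_self[of x] by linarith
        then have "(x + 1) ^ 3 \<le> exp x ^ 3" using x by (intro power_mono) auto
        also have "\<dots> = exp (3 * x)" by (simp add: exp_of_nat_mult[symmetric])
        also have "\<dots> \<le> exp (2 * (A * x))"
        proof -
          have "3 * x \<le> (2 * A) * x" using x A2 by (intro mult_right_mono) auto
          then show ?thesis by simp
        qed
        also have "\<dots> = (exp (A * x))\<^sup>2" by (simp add: exp_double)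
        finally have "(A + 1)\<^sup>2 * (x + 1) ^ 3 \<le> ((A + 1) * exp (A * x))\<^sup>2"
          unfolding power_mult_distrib by (intro mult_left_mono) auto
        then have "U\<^sup>2 \<le> ((A + 1) * exp (A * x))\<^sup>2" using 2 by linarith
        then have "U \<le> (A + 1) * exp (A * x)"
          by (rule power2_le_imp_le) (use A2 in simp)
        also have "\<dots> \<le> (U0 + A + 2) * exp (A * x)" using U00 by (intro mult_right_mono) auto
        finally show ?thesis .
      next
        case 3
        have "U \<le> (U0 + A + 2) * 1" using 3 A2 by simp
        also have "\<dots> \<le> (U0 + A + 2) * exp (A * x)" using e1 U00 A2 by (intro mult_left_mono) auto
        finally show ?thesis .
      qed
    qed
    \<comment> \<open>The growth \<open>exp (A * x)\<close> allowed for \<open>U\<close> cancels the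
      decay of \<open>E p0\<close>, because \<open>A * x - A * \<phi> p0 = - A * m\<close>; the
      unknown point \<open>p0\<close> disappears from the bound.\<close>
    have "u p0 * E p0 \<le> C * exp (- A * m)"
    proof -
      have "1 / (x + 1) \<le> 1" using x by simp
      then have "E p0 \<le> exp (- A * \<phi> p0 + 1)" by (simp add: E_def x_def)
      then have "u p0 * E p0 \<le> ((U0 + A + 2) * exp (A * x)) * exp (- A * \<phi> p0 + 1)"
        unfolding Up0 using U_le U00 A2 by (intro mult_mono) (auto simp: E_def)
      also have "\<dots> = (U0 + A + 2) * (exp (A * x) * exp (- A * \<phi> p0 + 1))" by (simp only: mult.assoc)
      also have "exp (A * x) * exp (- A * \<phi> p0 + 1) = exp 1 * exp (- A * m)"
        unfolding exp_add[symmetric] by (simp add: x_def algebra_simps)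
      finally show ?thesis by (simp add: C_def mult_ac)
    qed
    then have bound: "u p * E p \<le> C * exp (- A * m)" using p0(2)[OF p] by linarith
    have "u p \<le> C * exp (A * (\<phi> p - m))"
    \<comment> \<open>Replacing \<open>E p\<close> by the smaller
      \<open>exp (- A * \<phi> p)\<close> preserves the bound only for nonnegative
      \<open>u p\<close>; for negative \<open>u p\<close> the claim is immediate.\<close>
    proof (cases "0 \<le> u p")
      case True
      have "exp (- A * \<phi> p) \<le> E p" using m[OF p] by (simp add: E_def)
      then have "u p * exp (- A * \<phi> p) \<le> C * exp (- A * m)"
        using mult_left_mono[OF _ True] bound order_trans by blast
      then have "u p * exp (- A * \<phi> p) * exp (A * \<phi> p) \<le> C * exp (- A * m) * exp (A * \<phi> p)"
        by (rule mult_right_mono) simp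
      then show ?thesis by (simp add: mult.assoc exp_add[symmetric] algebra_simps)
    next
      case False
      moreover have "0 \<le> C * exp (A * (\<phi> p - m))" using C0 by simp
      ultimately show ?thesis by linarith
    qed
    then show "herm_trace (g \<mu> (snd \<mu> p)) (perturbed_metric g \<phi> \<mu> (snd \<mu> p))
        \<le> C * exp (A * (\<phi> p - (INF q\<in>topspace X. \<phi> q)))"
      using u[OF \<mu>] by (simp add: tr_def m_def)
  qed
qed

end
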